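(* Let $Q:\mathbb{N}\times\mathbb{N}\to\{0,1\}$ be a decision function that can be evaluated in $O(1)$ time. There is a randomized algorithm (in the real RAM model described in the context) which, given integers $n$ and $m$ with $n\le m\le n\log n$, outputs a random vector whose law is exactly the law of the vector of bin cardinalities of the $\mathrm{TwoSample}(Q)$ process on $n$ bins after $m$ steps, and whose running time $T$ satisfies, for some constant $C$ and some $\varepsilon(n)\to 0$, \[ \mathbb{E}[T]\le C\sqrt{n}\,(\log n)^6 \quad\text{and}\quad \Pr\big[T\le C\sqrt{n}\,(\log n)^6\big]\ge 1-\varepsilon(n). \]
   Context: The $\mathrm{TwoSample}(Q)$ process on $n$ bins: start with all loads $N_i^0=0$. At each step $t\ge0$, sample two bins $i_1,i_2$ independently and uniformly at random; if $Q(N_{i_1}^t,N_{i_2}^t)=0$ set $i=i_1$, otherwise $i=i_2$; then $N_i^{t+1}=N_i^t+1$ and all other loads are unchanged. (E.g. Two-Choice corresponds to $Q(a,b)=\mathbf{1}_{\{a>b\}}$.) The vector of bin cardinalities after $m$ steps is $(X_0,\dots,X_K)$ with $X_j=\#\{i:N_i^m=j\}$ and $K=\max_i N_i^m$. Computational model: idealized real RAM, in which real numbers are stored exactly and the standard arithmetic operations, comparison, truncation, exponentiation, logarithms and trigonometric functions each take constant time, and i.i.d. $\mathrm{Uniform}(0,1)$ random variables are available at unit cost each. *)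

theory Defs
  imports "HOL-Probability.Probability"
begin

subsection \<open>The TwoSample process\<close>

text \<open>Bins are numbered \<open>0, \<dots>, n - 1\<close>; only the values of a load function on \<open>{..<n}\<close> matter.\<close>

definition two_sample_step ::
  "(nat \<Rightarrow> nat \<Rightarrow> nat) \<Rightarrow> nat \<Rightarrow> (nat \<Rightarrow> nat) \<Rightarrow> (nat \<Rightarrow> nat) pmf" where
  "two_sample_step Q n N =
     bind_pmf (pmf_of_set {..<n}) (\<lambda>i1.
     bind_pmf (pmf_of_set {..<n}) (\<lambda>i2.
       let i = (if Q (N i1) (N i2) = 0 then i1 else i2)
       in return_pmf (N(i := N i + 1))))"

primrec two_sample :: "(nat \<Rightarrow> nat \<Rightarrow> nat) \<Rightarrow> nat \<Rightarrow> nat \<Rightarrow> (nat \<Rightarrow> nat) pmf" where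
  "two_sample Q n 0 = return_pmf (\<lambda>_. 0)"
| "two_sample Q n (Suc t) = bind_pmf (two_sample Q n t) (two_sample_step Q n)"

definition bin_cardinalities :: "nat \<Rightarrow> (nat \<Rightarrow> nat) \<Rightarrow> nat list" where
  "bin_cardinalities n N =
     map (\<lambda>j. card {i \<in> {..<n}. N i = j}) [0..<Suc (Max (N ` {..<n}))]"

definition bin_cardinalities_law :: "(nat \<Rightarrow> nat \<Rightarrow> nat) \<Rightarrow> nat \<Rightarrow> nat \<Rightarrow> nat list pmf" where
  "bin_cardinalities_law Q n m = map_pmf (bin_cardinalities n) (two_sample Q n m)"


subsection \<open>A randomized real RAM\<close>

text \<open>
  Memory is a sequence of cells, each holding an exact real number. Every instruction has cells
  as operands, performs a single operation, and costs one time unit; only \<open>Query\<close>, the evaluation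
  of the decision function, has the additional cost given by a parameter. Indirect addressing is
  provided by \<open>Load\<close> and \<open>Store\<close>. The only literals are integers: an arbitrary real literal could
  encode an infinite table.

  Control flow is structured instead of by jumps; every test of a branch or loop condition
  costs one time unit.
\<close>

datatype unop = Floor | Exp | Ln | Sin | Cos | Tan

datatype binop = Add | Sub | Mul | Div | Powr

datatype cmp = Lt | Le | Eq

datatype instr =
    Const nat int
  | Move nat nat
  | Unary unop nat nat
  | Binary binop nat nat nat
  | Load nat nat
  | Store nat nat
  | Uniform nat
  | Query nat nat nat

datatype stmt =
    Basic instr
  | Branch cmp nat nat "stmt list" "stmt list"
  | Loop cmp nat nat "stmt list"

text \<open>Outside their natural domains (division by 0, logarithm of a nonpositive number, \<dots>) the
  operations return the value that the HOL function has there.\<close>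

primrec unop_val :: "unop \<Rightarrow> real \<Rightarrow> real" where
  "unop_val Floor x = of_int \<lfloor>x\<rfloor>"
| "unop_val Exp x = exp x"
| "unop_val Ln x = ln x"
| "unop_val Sin x = sin x"
| "unop_val Cos x = cos x"
| "unop_val Tan x = tan x"

primrec binop_val :: "binop \<Rightarrow> real \<Rightarrow> real \<Rightarrow> real" where
  "binop_val Add x y = x + y"
| "binop_val Sub x y = x - y"
| "binop_val Mul x y = x * y"
| "binop_val Div x y = x / y"
| "binop_val Powr x y = x powr y"

primrec cmp_val :: "cmp \<Rightarrow> real \<Rightarrow> real \<Rightarrow> bool" where
  "cmp_val Lt x y \<longleftrightarrow> x < y"
| "cmp_val Le x y \<longleftrightarrow> x \<le> y"
| "cmp_val Eq x y \<longleftrightarrow> x = y"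

text \<open>The natural number denoted by the content of a cell, where one is needed (an address, an
  argument of the decision function, an output entry).\<close>

definition to_nat_cell :: "real \<Rightarrow> nat" where
  "to_nat_cell x = nat \<lfloor>x\<rfloor>"

text \<open>A state consists of the memory, the number of uniform variates consumed so far and the time
  spent so far. The variates are read in order from a tape \<open>\<omega>\<close>. The time for evaluating \<open>Q a b\<close>
  is \<open>cost a b\<close>.\<close>

type_synonym state = "(nat \<Rightarrow> real) \<times> nat \<times> nat"

type_synonym config = "stmt list \<times> state"

fun exec ::
  "(nat \<Rightarrow> nat \<Rightarrow> nat) \<Rightarrow> (nat \<Rightarrow> nat \<Rightarrow> nat) \<Rightarrow> (nat \<Rightarrow> real) \<Rightarrow> instr \<Rightarrow> state \<Rightarrow> state" where
  "exec Q cost \<omega> (Const d c) (M, p, t) = (M(d := of_int c), p, t + 1)"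
| "exec Q cost \<omega> (Move d x) (M, p, t) = (M(d := M x), p, t + 1)"
| "exec Q cost \<omega> (Unary f d x) (M, p, t) = (M(d := unop_val f (M x)), p, t + 1)"
| "exec Q cost \<omega> (Binary f d x y) (M, p, t) = (M(d := binop_val f (M x) (M y)), p, t + 1)"
| "exec Q cost \<omega> (Load d x) (M, p, t) = (M(d := M (to_nat_cell (M x))), p, t + 1)"
| "exec Q cost \<omega> (Store d x) (M, p, t) = (M(to_nat_cell (M d) := M x), p, t + 1)"
| "exec Q cost \<omega> (Uniform d) (M, p, t) = (M(d := \<omega> p), p + 1, t + 1)"
| "exec Q cost \<omega> (Query d x y) (M, p, t) =
     (let a = to_nat_cell (M x); b = to_nat_cell (M y)
      in (M(d := real (Q a b)), p, t + 1 + cost a b))"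

text \<open>The first component of a configuration is the code that remains to be executed; the machine
  has halted when it is empty.\<close>

fun step ::
  "(nat \<Rightarrow> nat \<Rightarrow> nat) \<Rightarrow> (nat \<Rightarrow> nat \<Rightarrow> nat) \<Rightarrow> (nat \<Rightarrow> real) \<Rightarrow> config \<Rightarrow> config" where
  "step Q cost \<omega> ([], s) = ([], s)"
| "step Q cost \<omega> (Basic i # k, s) = (k, exec Q cost \<omega> i s)"
| "step Q cost \<omega> (Branch r x y A B # k, (M, p, t)) =
     ((if cmp_val r (M x) (M y) then A else B) @ k, (M, p, t + 1))"
| "step Q cost \<omega> (Loop r x y A # k, (M, p, t)) =
     ((if cmp_val r (M x) (M y) then A @ Loop r x y A # k else k), (M, p, t + 1))"

text \<open>The input \<open>n\<close>, \<open>m\<close> is in cells 0 and 1; all other cells are initially 0.\<close>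

definition start :: "stmt list \<Rightarrow> nat \<Rightarrow> nat \<Rightarrow> config" where
  "start prog n m = (prog, ((\<lambda>_. 0)(0 := real n, 1 := real m), 0, 0))"

definition config_after ::
  "(nat \<Rightarrow> nat \<Rightarrow> nat) \<Rightarrow> (nat \<Rightarrow> nat \<Rightarrow> nat) \<Rightarrow> stmt list \<Rightarrow> nat \<Rightarrow> nat \<Rightarrow> (nat \<Rightarrow> real) \<Rightarrow> nat \<Rightarrow> config"
  where
  "config_after Q cost prog n m \<omega> k = (step Q cost \<omega> ^^ k) (start prog n m)"

definition final_state ::
  "(nat \<Rightarrow> nat \<Rightarrow> nat) \<Rightarrow> (nat \<Rightarrow> nat \<Rightarrow> nat) \<Rightarrow> stmt list \<Rightarrow> nat \<Rightarrow> nat \<Rightarrow> (nat \<Rightarrow> real) \<Rightarrow> state option"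
  where
  "final_state Q cost prog n m \<omega> =
     (if \<exists>k. fst (config_after Q cost prog n m \<omega> k) = []
      then Some (snd (config_after Q cost prog n m \<omega>
                   (LEAST k. fst (config_after Q cost prog n m \<omega> k) = [])))
      else None)"

definition running_time ::
  "(nat \<Rightarrow> nat \<Rightarrow> nat) \<Rightarrow> (nat \<Rightarrow> nat \<Rightarrow> nat) \<Rightarrow> stmt list \<Rightarrow> nat \<Rightarrow> nat \<Rightarrow> (nat \<Rightarrow> real) \<Rightarrow> ennreal"
  where
  "running_time Q cost prog n m \<omega> =
     (case final_state Q cost prog n m \<omega> of None \<Rightarrow> \<infinity> | Some (M, p, t) \<Rightarrow> of_nat t)"

text \<open>The output is a list of natural numbers: cell 0 holds its length, the following cells its
  entries. It is \<open>None\<close> if the machine does not halt.\<close>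

definition algorithm_output ::
  "(nat \<Rightarrow> nat \<Rightarrow> nat) \<Rightarrow> (nat \<Rightarrow> nat \<Rightarrow> nat) \<Rightarrow> stmt list \<Rightarrow> nat \<Rightarrow> nat \<Rightarrow> (nat \<Rightarrow> real) \<Rightarrow> nat list option"
  where
  "algorithm_output Q cost prog n m \<omega> =
     map_option (\<lambda>(M, p, t). map (\<lambda>j. to_nat_cell (M (Suc j))) [0..<to_nat_cell (M 0)])
       (final_state Q cost prog n m \<omega>)"

definition uniform_tape :: "(nat \<Rightarrow> real) measure" where
  "uniform_tape = Pi\<^sub>M UNIV (\<lambda>_. uniform_measure lborel {0<..<1})"

end

theory Submission
  imports Defs
begin

text \<open>
  It suffices to simulate the counts \<open>x a\<close> of bins with load \<open>a\<close>, of which there are about \<open>ln n\<close>. A step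
  draws a pair \<open>(a, b)\<close> of loads with weight \<open>x a * x b\<close>. Put \<open>s = \<lfloor>sqrt n\<rfloor>\<close> and \<open>y a = max 0 (x a - s)\<close>.
  During the next \<open>s\<close> steps the counts dominate \<open>y\<close>, so each step is, with the fixed probability
  \<open>p = (sum y)\<^sup>2 / n\<^sup>2\<close>, a draw with the fixed weights \<open>y a * y b\<close>, and otherwise a draw with the remaining
  weights. The number of steps of the first kind before the first of the second kind is a capped
  geometric variable, and all of them together are a multinomial sample, obtained from about \<open>(ln n)\<^sup>2\<close>
  binomial ones. As \<open>1 - p\<close> is of order \<open>ln n / s\<close>, about \<open>sqrt n * (ln n)\<^sup>2\<close> such iterations suffice.

  Geometric and binomial variables have integer weights \<open>B j\<close> with a common denominator \<open>N\<close>; exact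
  arithmetic on large numbers gives their generating polynomial in constant time, and a bisection
  finds the value that belongs to a uniform integer below \<open>N\<close>.

  The expected cost is controlled by the sum of \<open>2 ^ load\<close> over the bins, which grows at most by
  the factor \<open>1 + 2 / n\<close> per step in expectation: it is of order \<open>sqrt n * (ln n) ^ 5\<close>, and Markov's
  inequality gives the bound in probability.
\<close>

text \<open>Choice of \<open>s\<close>: with \<open>D\<close> load levels, a step ends its iteration
  early with probability at most \<open>2 * s * D / n\<close>, and an iteration is cut off after
  \<open>s\<close> steps. So about \<open>m * (1 / s + 2 * s * D / n)\<close> iterations occur, and
  \<open>s\<close> near \<open>sqrt n\<close> balances the two terms. Each iteration costs about
  \<open>D ^ 2\<close> binomial samples, each with a bisection of order \<open>ln n\<close> rounds.
  For \<open>m <= n * ln n\<close> and \<open>D\<close> of order \<open>ln n\<close> this gives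
  \<open>sqrt n * (ln n) ^ 5\<close>; the sixth power leaves a factor \<open>ln n\<close> for
  Markov's inequality.

  The obstacle is that \<open>Q\<close> is arbitrary and may favour the fuller bin, so
  \<open>D\<close> has no sure bound of order \<open>ln n\<close>. The cost is therefore amortized
  against \<open>\<alpha> + \<beta> * potential\<close>. The potential may reach
  \<open>n ^ 3\<close> in expectation, but \<beta> is of order \<open>ln n / n ^ 3\<close>.

  Exactness of the law and correctness of the code are kept apart: the program reads a single
  variate, so its run can be compared, for every tape, with the evaluation of a choice tree whose
  law is computed independently of the machine.\<close>

subsection \<open>Program logic\<close>

text \<open>Code is part of a configuration; countability of \<open>stmt\<close> lets the
  measurability proofs treat the remaining code as a discrete random variable.\<close>

instance unop :: countable by countable_datatype
instance binop :: countable by countable_datatype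
instance cmp :: countable by countable_datatype
instance instr :: countable by countable_datatype
instance stmt :: countable by countable_datatype

text \<open>\<open>wp Q cost A c P M\<close>: for code that reads no variate, total correctness with running time at most \<open>c\<close>.\<close>

definition wp :: "(nat \<Rightarrow> nat \<Rightarrow> nat) \<Rightarrow> (nat \<Rightarrow> nat \<Rightarrow> nat) \<Rightarrow> stmt list \<Rightarrow> nat \<Rightarrow> ((nat \<Rightarrow> real) \<Rightarrow> bool) \<Rightarrow> (nat \<Rightarrow> real) \<Rightarrow> bool" where
  "wp Q cost A c P M \<longleftrightarrow> (\<exists>M'. P M' \<and> (\<forall>\<omega> k p t. \<exists>j t'. t' \<le> t + c \<and>
     (step Q cost \<omega> ^^ j) (A @ k, (M, p, t)) = (k, (M', p, t'))))"

text \<open>The value at \<open>Uniform\<close> is a dummy; \<open>reads_tape\<close> excludes it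
  wherever \<open>upd\<close> describes an execution.\<close>

fun upd :: "(nat \<Rightarrow> nat \<Rightarrow> nat) \<Rightarrow> instr \<Rightarrow> (nat \<Rightarrow> real) \<Rightarrow> nat \<Rightarrow> real" where
  "upd Q (Const d c) M = M(d := of_int c)"
| "upd Q (Move d x) M = M(d := M x)"
| "upd Q (Unary f d x) M = M(d := unop_val f (M x))"
| "upd Q (Binary f d x y) M = M(d := binop_val f (M x) (M y))"
| "upd Q (Load d x) M = M(d := M (to_nat_cell (M x)))"
| "upd Q (Store d x) M = M(to_nat_cell (M d) := M x)"
| "upd Q (Uniform d) M = M"
| "upd Q (Query d x y) M = M(d := real (Q (to_nat_cell (M x)) (to_nat_cell (M y))))"

lemma wp_Nil: "P M \<Longrightarrow> wp Q cost [] c P M"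
  unfolding wp_def by (intro exI[of _ M] conjI allI, assumption) (rule exI[of _ 0], auto)

lemma wp_mono: "wp Q cost A c P M \<Longrightarrow> (\<And>M'. P M' \<Longrightarrow> P' M') \<Longrightarrow> c \<le> c' \<Longrightarrow> wp Q cost A c' P' M"
  unfolding wp_def by (meson add_left_mono order_trans)

lemma wp_append:
  assumes "wp Q cost A c (wp Q cost A' c' P) M"
  shows "wp Q cost (A @ A') (c + c') P M"
proof -
  obtain M1 where w: "wp Q cost A' c' P M1" and 1: "\<And>\<omega> k p t. \<exists>j t'. t' \<le> t + c \<and>
     (step Q cost \<omega> ^^ j) (A @ k, (M, p, t)) = (k, (M1, p, t'))"
    using assms unfolding wp_def by meson
  obtain M2 where 2: "P M2" "\<And>\<omega> k p t. \<exists>j t'. t' \<le> t + c' \<and>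
     (step Q cost \<omega> ^^ j) (A' @ k, (M1, p, t)) = (k, (M2, p, t'))"
    using w unfolding wp_def by meson
  show ?thesis unfolding wp_def
  proof (intro exI[of _ M2] conjI allI)
    fix \<omega> k p t
    obtain j t1 where a: "t1 \<le> t + c" "(step Q cost \<omega> ^^ j) (A @ A' @ k, (M, p, t)) = (A' @ k, (M1, p, t1))"
      using 1 by meson
    obtain j' t2 where b: "t2 \<le> t1 + c'" "(step Q cost \<omega> ^^ j') (A' @ k, (M1, p, t1)) = (k, (M2, p, t2))"
      using 2 by meson
    show "\<exists>j t'. t' \<le> t + (c + c') \<and> (step Q cost \<omega> ^^ j) ((A @ A') @ k, (M, p, t)) = (k, (M2, p, t'))"
      by (rule exI[of _ "j' + j"], rule exI[of _ t2]) (use a b in \<open>auto simp: funpow_add\<close>)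
  qed (use 2 in auto)
qed

lemma wp_step:
  assumes "wp Q cost A' c P M'"
    and "\<And>\<omega> k p t. \<exists>t'. t' \<le> t + d \<and> step Q cost \<omega> (A @ k, (M, p, t)) = (A' @ k, (M', p, t'))"
  shows "wp Q cost A (c + d) P M"
proof -
  obtain M1 where 1: "P M1" "\<And>\<omega> k p t. \<exists>j t'. t' \<le> t + c \<and>
     (step Q cost \<omega> ^^ j) (A' @ k, (M', p, t)) = (k, (M1, p, t'))"
    using assms(1) unfolding wp_def by meson
  show ?thesis unfolding wp_def
  proof (intro exI[of _ M1] conjI allI)
    fix \<omega> k p t
    obtain t1 where a: "t1 \<le> t + d" "step Q cost \<omega> (A @ k, (M, p, t)) = (A' @ k, (M', p, t1))"
      using assms(2) by meson
    obtain j t2 where b: "t2 \<le> t1 + c" "(step Q cost \<omega> ^^ j) (A' @ k, (M', p, t1)) = (k, (M1, p, t2))"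
      using 1 by meson
    show "\<exists>j t'. t' \<le> t + (c + d) \<and> (step Q cost \<omega> ^^ j) (A @ k, (M, p, t)) = (k, (M1, p, t'))"
      by (rule exI[of _ "Suc j"], rule exI[of _ t2]) (use a b in \<open>auto simp: funpow_Suc_right simp del: funpow.simps\<close>)
  qed (use 1 in auto)
qed

fun instr_bound :: "nat \<Rightarrow> instr \<Rightarrow> nat" where
  "instr_bound q (Query d x y) = 1 + q"
| "instr_bound q _ = 1"

fun reads_tape :: "instr \<Rightarrow> bool" where
  "reads_tape (Uniform d) = True"
| "reads_tape _ = False"

lemma wp_Basic:
  assumes "\<And>a b. cost a b \<le> q" "wp Q cost A c P (upd Q i M)" "\<not> reads_tape i"
  shows "wp Q cost (Basic i # A) (c + (1 + q)) P M"
proof (rule wp_step[OF assms(2)])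
  fix \<omega> k p t
  show "\<exists>t'. t' \<le> t + (1 + q) \<and> step Q cost \<omega> ((Basic i # A) @ k, M, p, t) = (A @ k, upd Q i M, p, t')"
    using assms(1,3) by (cases i) (auto simp: Let_def)
qed

lemma wp_line:
  assumes "\<And>a b. cost a b \<le> q" "list_all (\<lambda>i. \<not> reads_tape i) is" "wp Q cost A c P (fold (upd Q) is M)"
  shows "wp Q cost (map Basic is @ A) (c + length is * (1 + q)) P M"
  using assms(2,3)
proof (induction "is" arbitrary: M)
  case (Cons i js)
  have "wp Q cost (map Basic js @ A) (c + length js * (1 + q)) P (upd Q i M)"
    using Cons by auto
  from wp_Basic[OF assms(1) this] Cons.prems show ?case
    by (simp add: algebra_simps)
qed auto

lemma wp_Branch:
  assumes "wp Q cost ((if cmp_val r (M x) (M y) then A else B) @ k) c P M"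
  shows "wp Q cost (Branch r x y A B # k) (c + 1) P M"
  by (rule wp_step[OF assms]) auto

lemma wp_Loop:
  assumes "wp Q cost (if cmp_val r (M x) (M y) then A @ Loop r x y A # k else k) c P M"
  shows "wp Q cost (Loop r x y A # k) (c + 1) P M"
  by (rule wp_step[OF assms]) auto

text \<open>The invariant \<open>I\<close> is indexed by the data on which the loop works, \<open>T\<close> bounds the total time.\<close>

lemma wp_while:
  fixes I :: "'a \<Rightarrow> (nat \<Rightarrow> real) \<Rightarrow> bool" and T :: "'a \<Rightarrow> nat"
  assumes "wf R" and "I a M"
    and body: "\<And>a M. I a M \<Longrightarrow> cmp_val r (M x) (M y) \<Longrightarrow>
      \<exists>b c. (b, a) \<in> R \<and> c + 1 + T b \<le> T a \<and> wp Q cost A c (I b) M"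
    and exit: "\<And>a M. I a M \<Longrightarrow> \<not> cmp_val r (M x) (M y) \<Longrightarrow> 1 \<le> T a \<and> P M"
  shows "wp Q cost [Loop r x y A] (T a) P M"
  using assms(1,2)
proof (induction a arbitrary: M rule: wf_induct_rule)
  case (less a)
  show ?case
  proof (cases "cmp_val r (M x) (M y)")
    case True
    obtain b c where b: "(b, a) \<in> R" "c + 1 + T b \<le> T a" "wp Q cost A c (I b) M"
      using body[OF less.prems True] by blast
    have "wp Q cost (A @ [Loop r x y A]) (c + T b) P M"
      by (rule wp_append, rule wp_mono[OF b(3)]) (use less.IH[OF b(1)] in auto)
    then have "wp Q cost [Loop r x y A] (c + T b + 1) P M"
      by (intro wp_Loop) (use True in auto)
    then show ?thesis by (rule wp_mono) (use b in auto)
  next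
    case False
    have "wp Q cost [] 0 P M" using exit[OF less.prems False] by (intro wp_Nil) auto
    then have "wp Q cost [Loop r x y A] (0 + 1) P M" by (intro wp_Loop) (use False in auto)
    then show ?thesis by (rule wp_mono) (use exit[OF less.prems False] in auto)
  qed
qed

subsection \<open>Measurability of the running time\<close>

lemma prob_space_uniform_tape: "prob_space uniform_tape"
  unfolding uniform_tape_def by (intro prob_space_PiM prob_space_uniform_measure) auto

lemma sets_uniform_tape: "sets uniform_tape = sets (Pi\<^sub>M UNIV (\<lambda>_. borel))"
  unfolding uniform_tape_def by (rule sets_PiM_cong) auto

lemma space_uniform_tape: "space uniform_tape = UNIV"
  by (simp add: uniform_tape_def space_PiM)

lemma measurable_tape_component: "(\<lambda>\<omega>. \<omega> i) \<in> borel_measurable uniform_tape"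
  using measurable_component_singleton[of i UNIV "\<lambda>_. borel :: real measure"]
  by (simp add: measurable_cong_sets[OF sets_uniform_tape refl])

lemma measurable_unop_val: "f \<in> borel_measurable L \<Longrightarrow> (\<lambda>w. unop_val g (f w)) \<in> borel_measurable L"
  by (cases g) (auto simp: tan_def)

lemma measurable_binop_val: "f \<in> borel_measurable L \<Longrightarrow> f' \<in> borel_measurable L \<Longrightarrow>
    (\<lambda>w. binop_val g (f w) (f' w)) \<in> borel_measurable L"
  by (cases g) auto

lemma pred_cmp_val: "f \<in> borel_measurable L \<Longrightarrow> f' \<in> borel_measurable L \<Longrightarrow>
    Measurable.pred L (\<lambda>w. cmp_val g (f w) (f' w))"
  by (cases g) auto

lemma measurable_to_nat_cell: "f \<in> borel_measurable L \<Longrightarrow> (\<lambda>w. to_nat_cell (f w)) \<in> measurable L (count_space UNIV)"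
  unfolding to_nat_cell_def by measurable

text \<open>Memory is required to be measurable cell by cell. This suffices for indirect addressing
  because a random address takes only countably many values.\<close>

definition measurable_config :: "((nat \<Rightarrow> real) \<Rightarrow> config) \<Rightarrow> bool" where
  "measurable_config c \<longleftrightarrow>
     (\<lambda>\<omega>. fst (c \<omega>)) \<in> measurable uniform_tape (count_space UNIV) \<and>
     (\<forall>i. (\<lambda>\<omega>. fst (snd (c \<omega>)) i) \<in> borel_measurable uniform_tape) \<and>
     (\<lambda>\<omega>. fst (snd (snd (c \<omega>)))) \<in> measurable uniform_tape (count_space UNIV) \<and>
     (\<lambda>\<omega>. snd (snd (snd (c \<omega>)))) \<in> measurable uniform_tape (count_space UNIV)"

text \<open>A discrete component takes countably many values, so it may be frozen before
  measurability is checked.\<close>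

lemma measurable_config_split:
  assumes "k \<in> measurable uniform_tape (count_space (UNIV :: 'k :: countable set))"
    and "\<And>j. measurable_config (\<lambda>\<omega>. c j \<omega>)"
  shows "measurable_config (\<lambda>\<omega>. c (k \<omega>) \<omega>)"
proof -
  note c = assms(2)[unfolded measurable_config_def]
  show ?thesis unfolding measurable_config_def
    using measurable_compose_countable[where f = "\<lambda>j \<omega>. fst (c j \<omega>)", OF _ assms(1)]
      measurable_compose_countable[where f = "\<lambda>j \<omega>. fst (snd (c j \<omega>)) i" for i, OF _ assms(1)]
      measurable_compose_countable[where f = "\<lambda>j \<omega>. fst (snd (snd (c j \<omega>)))", OF _ assms(1)]
      measurable_compose_countable[where f = "\<lambda>j \<omega>. snd (snd (snd (c j \<omega>)))", OF _ assms(1)] c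
    by blast
qed

lemma measurable_config_exec:
  assumes M: "\<And>i. (\<lambda>\<omega>. M \<omega> i) \<in> borel_measurable uniform_tape"
    and p[measurable]: "p \<in> measurable uniform_tape (count_space UNIV)"
    and t[measurable]: "t \<in> measurable uniform_tape (count_space UNIV)"
  shows "measurable_config (\<lambda>\<omega>. (k, exec Q cost \<omega> i (M \<omega>, p \<omega>, t \<omega>)))"
proof -
  have N: "(\<lambda>\<omega>. to_nat_cell (M \<omega> d)) \<in> measurable uniform_tape (count_space UNIV)" for d
    by (intro measurable_to_nat_cell M)
  have upd: "(\<lambda>\<omega>. ((M \<omega>)(d := v \<omega>)) j) \<in> borel_measurable uniform_tape"
    if "v \<in> borel_measurable uniform_tape" for v d j
    using that M by (cases "j = d") simp_all
  have q: "(\<lambda>\<omega>. f (to_nat_cell (M \<omega> a)) (to_nat_cell (M \<omega> b))) \<in> measurable uniform_tape (count_space UNIV)"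
    for f :: "nat \<Rightarrow> nat \<Rightarrow> nat" and a b
  proof (rule measurable_compose_countable[OF _ N[of a], where f = "\<lambda>c \<omega>. f c (to_nat_cell (M \<omega> b))"])
    show "(\<lambda>\<omega>. f c (to_nat_cell (M \<omega> b))) \<in> measurable uniform_tape (count_space UNIV)" for c
      by (rule measurable_compose[OF N[of b], of "f c" "count_space UNIV"]) simp
  qed
  have st: "(\<lambda>\<omega>. ((M \<omega>)(to_nat_cell (M \<omega> d) := M \<omega> x)) j) \<in> borel_measurable uniform_tape" for d x j
    unfolding fun_upd_apply
    by (rule measurable_If[OF M M]) (use measurable_sets[OF N[of d], of "{j}"] in
      \<open>simp add: vimage_def Int_def conj_commute eq_commute\<close>)
  have conf: "measurable_config (\<lambda>\<omega>. (k, M' \<omega>, p' \<omega>, t' \<omega>))"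
    if "\<And>j. (\<lambda>\<omega>. M' \<omega> j) \<in> borel_measurable uniform_tape"
      "p' \<in> measurable uniform_tape (count_space UNIV)" "t' \<in> measurable uniform_tape (count_space UNIV)"
    for M' p' t'
    using that by (simp add: measurable_config_def)
  have t1: "(\<lambda>\<omega>. t \<omega> + 1) \<in> measurable uniform_tape (count_space UNIV)" by measurable
  have p1: "(\<lambda>\<omega>. p \<omega> + 1) \<in> measurable uniform_tape (count_space UNIV)" by measurable
  show ?thesis
  proof (cases i)
    case (Const d c) show ?thesis unfolding Const exec.simps by (rule conf[OF upd p t1]) simp
  next
    case (Move d x) show ?thesis unfolding Move exec.simps by (rule conf[OF upd p t1]) (rule M)
  next
    case (Unary f d x) show ?thesis unfolding Unary exec.simps
      by (rule conf[OF upd p t1]) (rule measurable_unop_val[OF M])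
  next
    case (Binary f d x y) show ?thesis unfolding Binary exec.simps
      by (rule conf[OF upd p t1]) (rule measurable_binop_val[OF M M])
  next
    case (Load d x) show ?thesis unfolding Load exec.simps
      by (rule conf[OF upd p t1]) (rule measurable_compose_countable[where f = "\<lambda>i \<omega>. M \<omega> i", OF M N])
  next
    case (Store d x) show ?thesis unfolding Store exec.simps by (rule conf[OF st p t1])
  next
    case (Uniform d) show ?thesis unfolding Uniform exec.simps
      by (rule conf[OF upd p1 t1]) (rule measurable_compose_countable[where f = "\<lambda>i \<omega>. \<omega> i", OF measurable_tape_component p])
  next
    case (Query d x y)
    have "(\<lambda>\<omega>. real (Q (to_nat_cell (M \<omega> x)) (to_nat_cell (M \<omega> y)))) \<in> borel_measurable uniform_tape"
      using measurable_compose[OF q[of Q x y], of real borel] by simp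
    moreover have "(\<lambda>\<omega>. t \<omega> + 1 + cost (to_nat_cell (M \<omega> x)) (to_nat_cell (M \<omega> y)))
        \<in> measurable uniform_tape (count_space UNIV)"
      by (rule measurable_compose_countable[OF _ q[of cost x y], where f = "\<lambda>c \<omega>. t \<omega> + 1 + c"]) measurable
    ultimately show ?thesis unfolding Query exec.simps Let_def by (intro conf[OF upd p])
  qed
qed

lemma measurable_config_step:
  assumes "measurable_config c"
  shows "measurable_config (\<lambda>\<omega>. step Q cost \<omega> (c \<omega>))"
proof -
  have k: "(\<lambda>\<omega>. fst (c \<omega>)) \<in> measurable uniform_tape (count_space UNIV)"
    and M: "\<And>i. (\<lambda>\<omega>. fst (snd (c \<omega>)) i) \<in> borel_measurable uniform_tape"
    and p: "(\<lambda>\<omega>. fst (snd (snd (c \<omega>)))) \<in> measurable uniform_tape (count_space UNIV)"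
    and t: "(\<lambda>\<omega>. snd (snd (snd (c \<omega>)))) \<in> measurable uniform_tape (count_space UNIV)"
    using assms unfolding measurable_config_def by auto
  have t1: "(\<lambda>\<omega>. snd (snd (snd (c \<omega>))) + 1) \<in> measurable uniform_tape (count_space UNIV)"
    using t by measurable
  have if_code: "(\<lambda>\<omega>. if cmp_val r (fst (snd (c \<omega>)) x) (fst (snd (c \<omega>)) y) then A else B)
      \<in> measurable uniform_tape (count_space UNIV)" for r x y and A B :: "stmt list"
    by (rule measurable_If) (auto intro!: pred_cmp_val[unfolded pred_def] M)
  have "measurable_config (\<lambda>\<omega>. step Q cost \<omega> (K, fst (snd (c \<omega>)), fst (snd (snd (c \<omega>))), snd (snd (snd (c \<omega>)))))"
    for K
  proof (cases K)
    case Nil then show ?thesis using M p t by (simp add: measurable_config_def)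
  next
    case (Cons s k)
    show ?thesis
    proof (cases s)
      case (Basic i) show ?thesis
        unfolding Cons Basic step.simps by (rule measurable_config_exec[OF M p t])
    next
      case (Branch r x y A B) show ?thesis
        unfolding Cons Branch step.simps measurable_config_def fst_conv snd_conv if_distrib[of "\<lambda>l. l @ k"]
        using M p t1 if_code[of r x y "A @ k" "B @ k"] by blast
    next
      case (Loop r x y A) show ?thesis
        unfolding Cons Loop step.simps measurable_config_def fst_conv snd_conv
        using M p t1 if_code[of r x y "A @ Loop r x y A # k" k] by blast
    qed
  qed
  from measurable_config_split[OF k, where c = "\<lambda>K \<omega>. step Q cost \<omega>
      (K, fst (snd (c \<omega>)), fst (snd (snd (c \<omega>))), snd (snd (snd (c \<omega>))))", OF this]
  show ?thesis by simp
qed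

lemma measurable_config_after: "measurable_config (\<lambda>\<omega>. config_after Q cost prog n m \<omega> k)"
proof (induction k)
  case 0
  then show ?case by (simp add: config_after_def start_def measurable_config_def)
next
  case (Suc k)
  from measurable_config_step[OF this] show ?case by (simp add: config_after_def)
qed

text \<open>The output will turn out to be an explicit function of the first variate, but the
  running time is only bounded from above, so its measurability must come from the machine
  itself.\<close>

lemma running_time_measurable: "running_time Q cost prog n m \<in> borel_measurable uniform_tape"
proof -
  note meas = measurable_config_after[of Q cost prog n m, unfolded measurable_config_def]
  define k where "k = (\<lambda>\<omega>. LEAST k. fst (config_after Q cost prog n m \<omega> k) = [])"
  have [measurable]: "Measurable.pred uniform_tape (\<lambda>\<omega>. fst (config_after Q cost prog n m \<omega> j) = [])" for j
    using measurable_compose[OF conjunct1[OF meas[of j]], of "\<lambda>l. l = []" "count_space UNIV"] by simp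
  have [measurable]: "k \<in> measurable uniform_tape (count_space UNIV)"
    unfolding k_def by measurable
  have [measurable]: "(\<lambda>\<omega>. snd (snd (snd (config_after Q cost prog n m \<omega> (k \<omega>)))))
      \<in> measurable uniform_tape (count_space UNIV)"
    by (rule measurable_compose_countable[where g = k and f = "\<lambda>k \<omega>. snd (snd (snd (config_after Q cost prog n m \<omega> k)))"])
      (use meas in auto)
  have "running_time Q cost prog n m = (\<lambda>\<omega>. if \<exists>j. fst (config_after Q cost prog n m \<omega> j) = []
      then of_nat (snd (snd (snd (config_after Q cost prog n m \<omega> (k \<omega>))))) else \<infinity>)"
    by (auto simp: running_time_def final_state_def k_def fun_eq_iff split: prod.split)
  also have "\<dots> \<in> borel_measurable uniform_tape" by measurable
  finally show ?thesis .
qed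

text \<open>Once the only variate has been read, the rest of the run is deterministic, so
  \<open>wp\<close> with its tape-independent final memory applies to it.\<close>

lemma final_state_wp:
  assumes "wp Q cost A c P ((\<lambda>_. 0)(0 := real n, 1 := real m, d := \<omega> 0))"
  shows "\<exists>M p t. final_state Q cost (Basic (Uniform d) # A) n m \<omega> = Some (M, p, t) \<and> P M \<and> t \<le> c + 1"
proof -
  obtain M' where P: "P M'" and run: "\<And>p t. \<exists>j t'. t' \<le> t + c \<and>
     (step Q cost \<omega> ^^ j) (A @ [], ((\<lambda>_. 0)(0 := real n, 1 := real m, d := \<omega> 0), p, t)) = ([], (M', p, t'))"
    using assms unfolding wp_def by metis
  obtain j t' where t': "t' \<le> 1 + c"
    "(step Q cost \<omega> ^^ j) (A, ((\<lambda>_. 0)(0 := real n, 1 := real m, d := \<omega> 0), 1, 1)) = ([], (M', 1, t'))"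
    using run[of 1 1] by auto
  let ?cf = "config_after Q cost (Basic (Uniform d) # A) n m \<omega>"
  have j: "?cf (Suc j) = ([], (M', 1, t'))"
    using t'(2) by (simp add: config_after_def start_def funpow_Suc_right del: funpow.simps)
  define l where "l = (LEAST k. fst (?cf k) = [])"
  have l: "fst (?cf l) = []" "l \<le> Suc j"
    unfolding l_def using j by (auto intro: LeastI[of "\<lambda>k. fst (?cf k) = []" "Suc j"] Least_le)
  \<comment> \<open>A halted configuration is a fixed point of \<open>step\<close>, so the first
    halting time yields the same state as time \<open>Suc j\<close>.\<close>
  have "?cf (i + l) = ?cf l" for i
    using l(1) by (induction i) (auto simp: config_after_def, metis prod.collapse step.simps(1))
  from this[of "Suc j - l"] l j have "?cf l = ([], (M', 1, t'))" by simp
  then have "final_state Q cost (Basic (Uniform d) # A) n m \<omega> = Some (M', 1, t')"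
    unfolding final_state_def l_def[symmetric] using l(1) by (auto intro!: exI[of _ l])
  with P t' show ?thesis by auto
qed

subsection \<open>Choice trees\<close>

text \<open>A sampler that makes successive uniform integer choices. All choices are taken from a single
  uniform variate \<open>u\<close>: the integer part of \<open>u * N\<close> is uniform below \<open>N\<close> and independent of the
  fractional part, which is again uniform.\<close>

datatype 'a sampler = Ret 'a | Choose nat "nat \<Rightarrow> 'a sampler"

primrec run :: "'a sampler \<Rightarrow> real \<Rightarrow> 'a \<times> real" where
  "run (Ret a) u = (a, u)"
| "run (Choose N f) u = run (f (nat \<lfloor>u * real N\<rfloor>)) (frac (u * real N))"

primrec law :: "'a sampler \<Rightarrow> 'a pmf" where
  "law (Ret a) = return_pmf a"
| "law (Choose N f) = bind_pmf (pmf_of_set {..<N}) (\<lambda>k. law (f k))"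

text \<open>\<open>pmf_of_set\<close> is meaningless on the empty set, hence \<open>0 < N\<close>;
  only subtrees that can be reached are constrained.\<close>

primrec wf_sampler :: "'a sampler \<Rightarrow> bool" where
  "wf_sampler (Ret a) = True"
| "wf_sampler (Choose N f) = (0 < N \<and> (\<forall>k<N. wf_sampler (f k)))"

primrec bind_sampler :: "'a sampler \<Rightarrow> ('a \<Rightarrow> 'b sampler) \<Rightarrow> 'b sampler" where
  "bind_sampler (Ret a) f = f a"
| "bind_sampler (Choose N g) f = Choose N (\<lambda>k. bind_sampler (g k) f)"

lemma run_bind: "run (bind_sampler t f) u = (let (a, v) = run t u in run (f a) v)"
  by (induction t arbitrary: u) auto

lemma law_bind: "wf_sampler t \<Longrightarrow> law (bind_sampler t f) = bind_pmf (law t) (\<lambda>a. law (f a))"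
proof (induction t)
  case (Choose N g)
  have "pmf_of_set {..<N} \<bind> (\<lambda>k. law (bind_sampler (g k) f)) =
      pmf_of_set {..<N} \<bind> (\<lambda>k. law (g k) \<bind> (\<lambda>a. law (f a)))"
    using Choose by (intro bind_pmf_cong) (auto simp: set_pmf_of_set lessThan_empty_iff)
  then show ?case by (simp add: bind_assoc_pmf)
qed (simp add: bind_return_pmf)

lemma wf_bind: "wf_sampler t \<Longrightarrow> (\<And>a. a \<in> set_pmf (law t) \<Longrightarrow> wf_sampler (f a)) \<Longrightarrow> wf_sampler (bind_sampler t f)"
  by (induction t) (auto simp: set_pmf_of_set lessThan_empty_iff)

lemma run_snd: "0 \<le> u \<Longrightarrow> u < 1 \<Longrightarrow> 0 \<le> snd (run t u) \<and> snd (run t u) < 1"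
  by (induction t arbitrary: u) (auto simp: frac_lt_1)

lemma measurable_frac: "f \<in> borel_measurable L \<Longrightarrow> (\<lambda>w. frac (f w) :: real) \<in> borel_measurable L"
  unfolding frac_def by (intro borel_measurable_diff measurable_compose[OF _ borel_measurable_real_floor])

lemma run_measurable: "(\<lambda>u. fst (run t u)) \<in> measurable borel (count_space UNIV)"
proof (induction t)
  case (Choose N f)
  have 1: "(\<lambda>u. frac (u * real N)) \<in> borel_measurable borel"
    by (intro measurable_frac) simp
  have 2: "(\<lambda>u. nat \<lfloor>u * real N\<rfloor>) \<in> measurable borel (count_space UNIV)"
    by measurable
  have 3: "(\<lambda>u. fst (run (f k) (frac (u * real N)))) \<in> measurable borel (count_space UNIV)" for k
    by (rule measurable_compose[OF 1 Choose]) simp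
  show ?case
    unfolding run.simps
    by (rule measurable_compose_countable[where f = "\<lambda>k u. fst (run (f k) (frac (u * real N)))", OF 3 2])
qed simp

text \<open>On each of the \<open>N\<close> intervals of length \<open>1 / N\<close> the fractional
  part of \<open>u * N\<close> is an affine rescaling onto the whole unit interval, so the induction
  hypothesis applies with the factor \<open>1 / N\<close>. The interval is half-open because
  \<open>frac\<close> takes values in it.\<close>

lemma emeasure_run:
  assumes "wf_sampler t"
  shows "(\<integral>\<^sup>+u. indicator {0..<1} u * indicator A (fst (run t u)) \<partial>lborel) = emeasure (law t) A"
  using assms
proof (induction t)
  case (Ret a)
  have "(\<integral>\<^sup>+u. indicator {0..<1::real} u * indicator A a \<partial>lborel) = indicator A a"
    by (subst nn_integral_multc) auto
  then show ?case by (simp add: indicator_def)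
next
  case (Choose N f)
  define g :: "nat \<Rightarrow> real \<Rightarrow> ennreal"
    where "g = (\<lambda>k u. indicator {0..<1} u * indicator A (fst (run (f k) u)))"
  have N: "0 < N" using Choose by auto
  have [measurable]: "g k \<in> borel_measurable borel" for k
    unfolding g_def by (intro borel_measurable_times_ennreal measurable_compose[OF run_measurable]) auto
  have g0: "g k v = 0" if "\<not> (0 \<le> v \<and> v < 1)" for k v
    using that by (auto simp: g_def indicator_def)
  \<comment> \<open>The intervals are disjoint and \<open>g k\<close> vanishes outside the unit
    interval, so only the summand with \<open>k\<close> the integer part of \<open>u * N\<close> can
    be nonzero.\<close>
  have eq: "indicator {0..<1} u * indicator A (fst (run (Choose N f) u)) = (\<Sum>k<N. g k (- real k + real N * u))" for u
  proof (cases "0 \<le> u \<and> u < 1")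
    case True
    let ?k = "nat \<lfloor>u * real N\<rfloor>"
    have "u * real N < 1 * real N" using True N by (intro mult_strict_right_mono) auto
    then have "\<lfloor>u * real N\<rfloor> < int N" by (simp add: floor_less_iff)
    then have k: "?k \<in> {..<N}" using N by (simp add: nat_less_iff)
    have z: "g k (- real k + real N * u) = 0" if "k \<noteq> ?k" for k
    proof (rule g0, rule notI)
      assume "0 \<le> - real k + real N * u \<and> - real k + real N * u < 1"
      then have "\<lfloor>u * real N\<rfloor> = int k" by (intro floor_unique) (auto simp: mult.commute)
      then show False using that by simp
    qed
    have fr: "- real ?k + real N * u = frac (u * real N)"
      using True by (simp add: frac_def mult.commute)
    have "(\<Sum>k<N. g k (- real k + real N * u)) = (\<Sum>k\<in>{?k}. g k (- real k + real N * u))"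
      by (rule sum.mono_neutral_right) (use k z in auto)
    also have "\<dots> = g ?k (frac (u * real N))" unfolding fr[symmetric] by simp
    finally show ?thesis using True by (simp add: g_def indicator_def frac_lt_1)
  next
    case False
    have "g k (- real k + real N * u) = 0" if "k < N" for k
    proof (rule g0, rule notI)
      assume *: "0 \<le> - real k + real N * u \<and> - real k + real N * u < 1"
      then have "0 \<le> real N * u" by linarith
      moreover have "real N * u < real N * 1" using * that by linarith
      ultimately show False using False N by (simp add: zero_le_mult_iff)
    qed
    with False show ?thesis by (auto simp: indicator_def)
  qed
  have "(\<integral>\<^sup>+u. indicator {0..<1} u * indicator A (fst (run (Choose N f) u)) \<partial>lborel)
      = (\<Sum>k<N. \<integral>\<^sup>+u. g k (- real k + real N * u) \<partial>lborel)"
    unfolding eq by (rule nn_integral_sum) measurable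
  also have "\<dots> = (\<Sum>k<N. emeasure (law (f k)) A / of_nat N)"
  proof (rule sum.cong[OF refl])
    fix k assume k: "k \<in> {..<N}"
    have "(\<integral>\<^sup>+u. g k u \<partial>lborel) = ennreal \<bar>real N\<bar> * (\<integral>\<^sup>+u. g k (- real k + real N * u) \<partial>lborel)"
      using N by (intro nn_integral_real_affine) auto
    moreover have "(\<integral>\<^sup>+u. g k u \<partial>lborel) = emeasure (law (f k)) A"
      using Choose k by (auto simp: g_def)
    ultimately have *: "emeasure (law (f k)) A = (\<integral>\<^sup>+u. g k (- real k + real N * u) \<partial>lborel) * of_nat N"
      by (simp add: ennreal_of_nat_eq_real_of_nat mult.commute)
    show "(\<integral>\<^sup>+u. g k (- real k + real N * u) \<partial>lborel) = emeasure (law (f k)) A / of_nat N"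
      unfolding * using N by (subst mult_divide_eq_ennreal) simp_all
  qed
  also have "\<dots> = emeasure (law (Choose N f)) A"
  proof -
    have "{..<N} \<noteq> {}" using N by auto
    from nn_integral_pmf_of_set[OF this finite_lessThan] show ?thesis
      by (simp only: law.simps emeasure_bind_pmf card_lessThan divide_ennreal_def sum_distrib_right)
  qed
  finally show ?case .
qed

text \<open>\<open>frac\<close> changes the variate only on a null set, but puts it into the unit
  interval for every tape, as the pathwise verification of the program requires.\<close>

lemma distr_run:
  assumes "wf_sampler t"
  shows "distr uniform_tape (count_space UNIV) (\<lambda>\<omega>. fst (run t (frac (\<omega> 0)))) = measure_pmf (law t)"
    and "(\<lambda>\<omega>. fst (run t (frac (\<omega> 0)))) \<in> measurable uniform_tape (count_space UNIV)"
proof -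
  let ?V = "uniform_measure lborel {0<..<1::real}"
  have g: "(\<lambda>u. fst (run t (frac u))) \<in> measurable borel (count_space UNIV)"
    by (rule measurable_compose[OF _ run_measurable]) (auto intro!: measurable_frac)
  show m: "(\<lambda>\<omega>. fst (run t (frac (\<omega> 0)))) \<in> measurable uniform_tape (count_space UNIV)"
    by (rule measurable_compose[OF measurable_tape_component g])
  have V: "distr uniform_tape ?V (\<lambda>\<omega>. \<omega> 0) = ?V"
    unfolding uniform_tape_def
    by (rule distr_PiM_component) (auto intro!: prob_space_uniform_measure)
  show "distr uniform_tape (count_space UNIV) (\<lambda>\<omega>. fst (run t (frac (\<omega> 0)))) = measure_pmf (law t)"
  proof (rule measure_eqI)
    fix A assume "A \<in> sets (distr uniform_tape (count_space UNIV) (\<lambda>\<omega>. fst (run t (frac (\<omega> 0)))))"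
    define B where "B = (\<lambda>u. fst (run t (frac u))) -` A"
    have B[measurable]: "B \<in> sets borel" using measurable_sets[OF g, of A] by (simp add: B_def)
    have m0: "(\<lambda>\<omega>. \<omega> 0) \<in> measurable uniform_tape ?V"
      using measurable_tape_component by (simp add: measurable_def)
    have "(\<lambda>\<omega>. fst (run t (frac (\<omega> 0)))) -` A \<inter> space uniform_tape = (\<lambda>\<omega>. \<omega> 0) -` B \<inter> space uniform_tape"
      by (auto simp: B_def)
    then have 1: "emeasure (distr uniform_tape (count_space UNIV) (\<lambda>\<omega>. fst (run t (frac (\<omega> 0))))) A
        = emeasure (distr uniform_tape ?V (\<lambda>\<omega>. \<omega> 0)) B"
      by (simp add: emeasure_distr[OF m] emeasure_distr[OF m0])
    have 2: "emeasure ?V B = emeasure lborel ({0<..<1} \<inter> B)"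
      by (subst emeasure_uniform_measure) (simp_all add: divide_ennreal_def)
    \<comment> \<open>The tape is uniform on the open interval, \<open>emeasure_run\<close>
      integrates over the half-open one; the point 0 is a null set.\<close>
    have "{0<..<1} = {0..<1} - {0::real}" by (auto simp: less_le)
    then have 3: "{0<..<1} \<inter> B = {0..<1} \<inter> B - {0}" by blast
    have 4: "emeasure lborel ({0..<1} \<inter> B - {0}) = emeasure lborel ({0..<1} \<inter> B)"
      by (rule emeasure_Diff_null_set) (simp_all add: countable_imp_null_set_lborel)
    have "indicator ({0..<1} \<inter> B) u = indicator {0..<1} u * (indicator A (fst (run t u)) :: ennreal)" for u
      by (cases "u \<in> {0..<1}") (auto simp: indicator_def B_def frac_eq[THEN iffD2])
    then have 5: "emeasure lborel ({0..<1} \<inter> B) = emeasure (law t) A"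
      using nn_integral_indicator[of "{0..<1} \<inter> B" lborel] emeasure_run[OF assms, of A] by simp
    show "emeasure (distr uniform_tape (count_space UNIV) (\<lambda>\<omega>. fst (run t (frac (\<omega> 0))))) A
      = emeasure (measure_pmf (law t)) A"
      by (simp only: 1 2 3 4 5 V)
  qed (simp only: sets_distr sets_count_space sets_measure_pmf Pow_UNIV)
qed

subsection \<open>Sampling from integer weights\<close>

text \<open>Inversion of the distribution function: \<open>W\<close> lies between two consecutive
  prefix sums. \<open>GREATEST\<close> skips zero weights, and its condition on a prefix sum is
  exactly what a bisection can test.\<close>

definition pick :: "(nat \<Rightarrow> nat) \<Rightarrow> nat \<Rightarrow> nat \<Rightarrow> nat" where
  "pick B h W = (GREATEST j. j \<le> h \<and> (\<Sum>i<j. B i) \<le> W)"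

lemma pick_eqI:
  assumes "j \<le> h" "(\<Sum>i<j. B i) \<le> W" "j = h \<or> W < (\<Sum>i<Suc j. B i)"
  shows "pick B h W = j"
  unfolding pick_def
proof (rule Greatest_equality)
  fix k assume k: "k \<le> h \<and> (\<Sum>i<k. B i) \<le> W"
  show "k \<le> j"
  proof (rule ccontr)
    assume "\<not> k \<le> j"
    moreover from this have "(\<Sum>i<Suc j. B i) \<le> (\<Sum>i<k. B i)" by (intro sum_mono2) auto
    ultimately show False using k assms(3) by linarith
  qed
qed (use assms in auto)

lemma pick_spec:
  shows "pick B h W \<le> h" "(\<Sum>i<pick B h W. B i) \<le> W"
    "pick B h W = h \<or> W < (\<Sum>i<Suc (pick B h W). B i)"
proof -
  let ?P = "\<lambda>j. j \<le> h \<and> (\<Sum>i<j. B i) \<le> W"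
  have *: "?P (pick B h W)" unfolding pick_def
    by (rule GreatestI_nat[of ?P 0 h]) auto
  then show "pick B h W \<le> h" "(\<Sum>i<pick B h W. B i) \<le> W" by auto
  show "pick B h W = h \<or> W < (\<Sum>i<Suc (pick B h W). B i)"
  proof (rule ccontr)
    assume "\<not> ?thesis"
    then have "?P (Suc (pick B h W))" using * by auto
    then have "Suc (pick B h W) \<le> pick B h W" unfolding pick_def
      by (rule Greatest_le_nat[of ?P _ h]) auto
    then show False by simp
  qed
qed

text \<open>Between two consecutive prefix sums there are exactly \<open>B j\<close>
  integers.\<close>

lemma map_pick:
  assumes N: "N = (\<Sum>i\<le>h. B i)" "0 < N" and j: "j \<le> h"
  shows "pmf (map_pmf (pick B h) (pmf_of_set {..<N})) j = real (B j) / real N"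
proof -
  have S: "(\<Sum>i<Suc j. B i) \<le> N" unfolding N using j by (intro sum_mono2) auto
  have N': "N = (\<Sum>i<Suc h. B i)" using N(1) by (simp only: lessThan_Suc_atMost)
  have "W < N \<and> pick B h W = j \<longleftrightarrow> (\<Sum>i<j. B i) \<le> W \<and> W < (\<Sum>i<Suc j. B i)" for W
  proof
    assume *: "W < N \<and> pick B h W = j"
    have "(\<Sum>i<j. B i) \<le> W" "j = h \<or> W < (\<Sum>i<Suc j. B i)" using pick_spec(2,3)[of B h W] * by blast+
    then show "(\<Sum>i<j. B i) \<le> W \<and> W < (\<Sum>i<Suc j. B i)" using * N' by blast
  next
    assume *: "(\<Sum>i<j. B i) \<le> W \<and> W < (\<Sum>i<Suc j. B i)"
    have "pick B h W = j" by (rule pick_eqI) (use * j in blast)+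
    then show "W < N \<and> pick B h W = j" using * S by linarith
  qed
  then have "{..<N} \<inter> pick B h -` {j} = {(\<Sum>i<j. B i)..<(\<Sum>i<Suc j. B i)}"
    by (simp only: set_eq_iff Int_iff lessThan_iff vimage_eq singleton_iff atLeastLessThan_iff) blast
  then have "card ({..<N} \<inter> pick B h -` {j}) = B j" by simp
  moreover have "{..<N} \<noteq> {}" using N by auto
  ultimately show ?thesis by (simp add: pmf_map measure_pmf_of_set)
qed

lemma law_pick:
  assumes N: "N = (\<Sum>i\<le>h. B i)" "0 < N"
    and p: "\<And>j. j \<le> h \<Longrightarrow> pmf p j = real (B j) / real N" "\<And>j. h < j \<Longrightarrow> pmf p j = 0"
  shows "map_pmf (pick B h) (pmf_of_set {..<N}) = p"
proof (rule pmf_eqI)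
  fix j
  show "pmf (map_pmf (pick B h) (pmf_of_set {..<N})) j = pmf p j"
  proof (cases "j \<le> h")
    case True
    then show ?thesis using map_pick[OF N True] p by simp
  next
    case False
    then have "j \<notin> set_pmf (map_pmf (pick B h) (pmf_of_set {..<N}))"
      using pick_spec(1)[of B h] by (auto simp: set_map_pmf)
    then have "pmf (map_pmf (pick B h) (pmf_of_set {..<N})) j = 0"
      unfolding pmf_eq_0_set_pmf .
    then show ?thesis using False p(2)[of j] by simp
  qed
qed

section \<open>Binomial and capped geometric laws as integer weights with denominators
  \<open>q ^ L\<close> and \<open>H ^ h\<close>\<close>

definition binomial_weights :: "nat \<Rightarrow> nat \<Rightarrow> nat \<Rightarrow> nat \<Rightarrow> nat" where
  "binomial_weights p q L j = (L choose j) * p ^ j * (q - p) ^ (L - j)"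

lemma sum_binomial_weights: "p \<le> q \<Longrightarrow> (\<Sum>j\<le>L. binomial_weights p q L j) = q ^ L"
  using binomial[of p "q - p" L] by (simp add: binomial_weights_def)

lemma law_pick_binomial:
  assumes "p \<le> q" "0 < q"
  shows "map_pmf (pick (binomial_weights p q L) L) (pmf_of_set {..<q ^ L}) = binomial_pmf L (p / q)"
proof (rule law_pick)
  fix j assume j: "j \<le> L"
  have "1 - real p / real q = real (q - p) / real q" using assms by (simp add: field_simps of_nat_diff)
  moreover have "real q ^ L = real q ^ j * real q ^ (L - j)" using j by (simp flip: power_add)
  ultimately show "pmf (binomial_pmf L (p / q)) j = real (binomial_weights p q L j) / real (q ^ L)"
    using assms by (simp add: binomial_weights_def power_divide)
next
  fix j assume "L < j"
  then show "pmf (binomial_pmf L (p / q)) j = 0" using assms by simp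
qed (use assms in \<open>auto simp: sum_binomial_weights\<close>)

text \<open>The number of successes before the first failure, observed for at most \<open>h\<close>
  trials. The recursion mirrors that of \<open>iteration\<close>.\<close>

primrec capped_geometric :: "real \<Rightarrow> nat \<Rightarrow> nat pmf" where
  "capped_geometric p 0 = return_pmf 0"
| "capped_geometric p (Suc h) = bernoulli_pmf p \<bind> (\<lambda>b.
     if b then map_pmf Suc (capped_geometric p h) else return_pmf 0)"

lemma pmf_capped_geometric:
  assumes "0 \<le> p" "p \<le> 1"
  shows "pmf (capped_geometric p h) j = (if j < h then p ^ j * (1 - p) else if j = h then p ^ h else 0)"
proof (induction h arbitrary: j)
  case (Suc h)
  have "pmf (capped_geometric p (Suc h)) j =
      p * pmf (map_pmf Suc (capped_geometric p h)) j + (1 - p) * pmf (return_pmf 0) j"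
    using assms by (simp add: pmf_bind)
  also have "pmf (map_pmf Suc (capped_geometric p h)) j = (case j of 0 \<Rightarrow> 0 | Suc i \<Rightarrow> pmf (capped_geometric p h) i)"
    by (cases j) (auto simp: pmf_map_inj' pmf_map_outside)
  finally show ?case by (cases j) (auto simp: Suc.IH)
qed (auto simp: indicator_def)

text \<open>Numerators over \<open>H ^ h\<close> for success probability \<open>G / H\<close>; the
  atom at \<open>h\<close> collects the whole tail.\<close>

definition geometric_weights :: "nat \<Rightarrow> nat \<Rightarrow> nat \<Rightarrow> nat \<Rightarrow> nat" where
  "geometric_weights G H h j = (if j < h then G ^ j * (H - G) * H ^ (h - Suc j) else G ^ h)"

lemma real_geometric_weights:
  assumes "G \<le> H" "0 < H" "j \<le> h"
  shows "real (geometric_weights G H h j) = real H ^ h * pmf (capped_geometric (G / H) h) j"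
proof (cases "j < h")
  case True
  have "h = j + Suc (h - Suc j)" using True by simp
  then have "real H ^ h = real H ^ j * (real H * real H ^ (h - Suc j))" by (metis power_add power_Suc)
  then show ?thesis using assms True
    by (simp add: geometric_weights_def pmf_capped_geometric of_nat_diff field_simps)
next
  case False
  then show ?thesis using assms by (simp add: geometric_weights_def pmf_capped_geometric power_divide)
qed

lemma sum_geometric_weights:
  assumes "G \<le> H" "0 < H"
  shows "(\<Sum>j\<le>h. geometric_weights G H h j) = H ^ h"
proof -
  \<comment> \<open>The telescoping sum is read off from the total mass 1 of the
    distribution.\<close>
  have "set_pmf (capped_geometric (G / H) h) \<subseteq> {..h}"
    using assms by (auto simp: set_pmf_iff pmf_capped_geometric split: if_splits)
  then have "(\<Sum>j\<le>h. pmf (capped_geometric (G / H) h) j) = 1" by (intro sum_pmf_eq_1) auto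
  then have "real (\<Sum>j\<le>h. geometric_weights G H h j) = real (H ^ h)"
    using assms by (simp add: real_geometric_weights flip: sum_distrib_left)
  then show ?thesis by (simp only: of_nat_eq_iff)
qed

lemma law_pick_geometric:
  assumes "G \<le> H" "0 < H"
  shows "map_pmf (pick (geometric_weights G H h) h) (pmf_of_set {..<H ^ h}) = capped_geometric (G / H) h"
proof (rule law_pick)
  fix j assume j: "j \<le> h"
  show "pmf (capped_geometric (G / H) h) j = real (geometric_weights G H h j) / real (H ^ h)"
    using assms j by (simp add: real_geometric_weights)
next
  fix j assume "h < j"
  then show "pmf (capped_geometric (G / H) h) j = 0" using assms by (simp add: pmf_capped_geometric)
qed (use assms in \<open>auto simp: sum_geometric_weights\<close>)

section \<open>Finite distributions proportional to integer weights\<close>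

definition weighted_pmf :: "'a set \<Rightarrow> ('a \<Rightarrow> nat) \<Rightarrow> 'a pmf" where
  "weighted_pmf A v = embed_pmf (\<lambda>a. if a \<in> A then real (v a) / real (sum v A) else 0)"

lemma pmf_weighted_pmf:
  assumes "finite A" "0 < sum v A"
  shows "pmf (weighted_pmf A v) a = (if a \<in> A then real (v a) / real (sum v A) else 0)"
  unfolding weighted_pmf_def
proof (rule pmf_embed_pmf)
  have "(\<integral>\<^sup>+a. ennreal (if a \<in> A then real (v a) / real (sum v A) else 0) \<partial>count_space UNIV)
      = (\<Sum>a\<in>A. ennreal (if a \<in> A then real (v a) / real (sum v A) else 0))"
    using assms(1) by (intro nn_integral_count_space'[symmetric, symmetric]) (auto split: if_splits)
  also have "\<dots> = ennreal (\<Sum>a\<in>A. real (v a) / real (sum v A))"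
    by (subst sum_ennreal[symmetric]) (auto intro!: divide_nonneg_nonneg simp del: of_nat_sum)
  also have "(\<Sum>a\<in>A. real (v a) / real (sum v A)) = 1"
    using assms(2) by (simp flip: sum_divide_distrib of_nat_sum)
  finally show "(\<integral>\<^sup>+a. ennreal (if a \<in> A then real (v a) / real (sum v A) else 0) \<partial>count_space UNIV) = 1" by simp
qed (simp add: sum_nonneg)

lemma set_weighted_pmf:
  assumes "finite A" "0 < sum v A"
  shows "set_pmf (weighted_pmf A v) = {a \<in> A. 0 < v a}"
  using assms by (auto simp: set_pmf_iff pmf_weighted_pmf simp del: of_nat_sum split: if_splits)

lemma weighted_pmf_mono_neutral:
  assumes "finite B" "A \<subseteq> B" "\<And>a. a \<in> B - A \<Longrightarrow> v a = 0" "0 < sum v B"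
  shows "weighted_pmf A v = weighted_pmf B v"
proof -
  have "sum v A = sum v B" using assms by (intro sum.mono_neutral_left) auto
  then show ?thesis using assms finite_subset[OF assms(2,1)]
    by (intro pmf_eqI) (auto simp: pmf_weighted_pmf)
qed

lemma weighted_pmf_cong: "(\<And>a. a \<in> A \<Longrightarrow> v a = w a) \<Longrightarrow> weighted_pmf A v = weighted_pmf A w"
  unfolding weighted_pmf_def by (intro arg_cong[of _ _ embed_pmf]) (auto simp: fun_eq_iff cong: sum.cong)

lemma pmf_bind_bernoulli:
  "0 \<le> p \<Longrightarrow> p \<le> 1 \<Longrightarrow> pmf (bernoulli_pmf p \<bind> f) a = p * pmf (f True) a + (1 - p) * pmf (f False) a"
  by (simp add: pmf_bind)

text \<open>If one of the two sums of weights vanishes then the corresponding mixture component is junk,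
  but it has probability 0.\<close>

lemma weighted_pmf_add:
  assumes "finite A" "0 < sum v A + sum w A"
  shows "weighted_pmf A (\<lambda>a. v a + w a) =
    bernoulli_pmf (real (sum v A) / real (sum v A + sum w A)) \<bind> (\<lambda>b. if b then weighted_pmf A v else weighted_pmf A w)"
proof (rule pmf_eqI)
  fix a
  obtain V W where V: "sum v A = V" and W: "sum w A = W" by blast
  have T: "(\<Sum>a\<in>A. v a + w a) = V + W" using V W by (simp add: sum.distrib)
  have VW: "0 < V + W" using assms(2) V W by simp
  have v0: "v a = 0" if "V = 0" "a \<in> A" using V that assms(1) by auto
  have w0: "w a = 0" if "W = 0" "a \<in> A" using W that assms(1) by auto
  have pv: "pmf (weighted_pmf A v) a = (if a \<in> A then v a / V else 0)" if "0 < V"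
    using pmf_weighted_pmf[OF assms(1), of v] V that by simp
  have pw: "pmf (weighted_pmf A w) a = (if a \<in> A then w a / W else 0)" if "0 < W"
    using pmf_weighted_pmf[OF assms(1), of w] W that by simp
  have pvw: "pmf (weighted_pmf A (\<lambda>a. v a + w a)) a = (if a \<in> A then (v a + w a) / (V + W) else 0)"
    using pmf_weighted_pmf[OF assms(1), of "\<lambda>a. v a + w a"] T VW by simp
  have p: "0 \<le> real V / real (V + W)" "real V / real (V + W) \<le> 1"
    using VW by (auto simp: divide_le_eq_1)
  have "real (V + W) \<noteq> 0" using VW by (simp only: of_nat_eq_0_iff)
  then have e: "1 - real V / real (V + W) = real W / real (V + W)" by (simp add: diff_divide_eq_iff eq_divide_eq)
  consider "V = 0" "0 < W" | "W = 0" "0 < V" | "0 < V" "0 < W" using VW by linarith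
  then show "pmf (weighted_pmf A (\<lambda>a. v a + w a)) a = pmf (bernoulli_pmf (real (sum v A) / real (sum v A + sum w A)) \<bind>
      (\<lambda>b. if b then weighted_pmf A v else weighted_pmf A w)) a"
    unfolding V W pmf_bind_bernoulli[OF p] e pvw
    by cases (use v0 w0 in \<open>auto simp: pv pw add_divide_distrib\<close>)
qed

text \<open>Write \<open>v\<close> as its value at \<open>k\<close> plus the rest and apply
  \<open>weighted_pmf_add\<close>. This peels one outcome off a draw, which is how multinomial
  sampling reduces to binomial sampling.\<close>

lemma weighted_pmf_insert:
  assumes "finite A" "k \<notin> A" "0 < v k + sum v A"
  shows "weighted_pmf (insert k A) v =
    bernoulli_pmf (real (v k) / real (v k + sum v A)) \<bind> (\<lambda>b. if b then return_pmf k else weighted_pmf A v)"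
proof -
  let ?f = "\<lambda>a. if a = k then v k else 0" and ?g = "\<lambda>a. if a = k then 0 else v a"
  have s: "sum ?f (insert k A) = v k" "sum ?g (insert k A) = sum v A"
    using assms by (auto intro!: sum.neutral sum.cong)
  have "weighted_pmf (insert k A) v = weighted_pmf (insert k A) (\<lambda>a. ?f a + ?g a)"
    by (intro weighted_pmf_cong) auto
  also have "\<dots> = bernoulli_pmf (real (v k) / real (v k + sum v A)) \<bind>
      (\<lambda>b. if b then weighted_pmf (insert k A) ?f else weighted_pmf (insert k A) ?g)"
    using weighted_pmf_add[of "insert k A" ?f ?g] assms(1,3) by (simp only: s finite_insert)
  also have "\<dots> = bernoulli_pmf (real (v k) / real (v k + sum v A)) \<bind> (\<lambda>b. if b then return_pmf k else weighted_pmf A v)"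
  proof (rule bind_pmf_cong[OF refl])
    fix b assume b: "b \<in> set_pmf (bernoulli_pmf (real (v k) / real (v k + sum v A)))"
    have p: "0 \<le> real (v k) / real (v k + sum v A)" "real (v k) / real (v k + sum v A) \<le> 1"
      using assms(3) by (auto simp: divide_le_eq_1 simp del: of_nat_sum)
    show "(if b then weighted_pmf (insert k A) ?f else weighted_pmf (insert k A) ?g)
        = (if b then return_pmf k else weighted_pmf A v)"
    proof (cases b)
      case True
      then have "0 < v k" using b p by (auto simp: set_pmf_iff intro: ccontr)
      then have "weighted_pmf (insert k A) ?f = return_pmf k"
        using assms s by (intro pmf_eqI) (auto simp: pmf_weighted_pmf indicator_def)
      with True show ?thesis by simp
    next
      case False
      \<comment> \<open>A failure of positive probability leaves positive weight on
        \<open>A\<close>, so \<open>weighted_pmf A v\<close> is a genuine distribution in this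
        branch.\<close>
      have "pmf (bernoulli_pmf (real (v k) / real (v k + sum v A))) False \<noteq> 0"
        using b False by (simp add: set_pmf_iff)
      then have "real (v k) / real (v k + sum v A) \<noteq> 1" unfolding pmf_bernoulli_False[OF p] by simp
      then have v: "0 < sum v A" using assms(3) by (cases "sum v A = 0") simp_all
      have "weighted_pmf (insert k A) ?g = weighted_pmf A v"
        using assms s v by (intro pmf_eqI) (auto simp: pmf_weighted_pmf)
      with False show ?thesis by simp
    qed
  qed
  finally show ?thesis .
qed

subsection \<open>The process of bin cardinalities\<close>

text \<open>With integer values \<open>shift\<close> is a true translation: shifts commute and add
  up without side conditions, even where a count would become negative.\<close>

type_synonym counts = "nat \<Rightarrow> int"

definition counts_of :: "nat \<Rightarrow> (nat \<Rightarrow> nat) \<Rightarrow> counts" where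
  "counts_of n N a = int (card {i \<in> {..<n}. N i = a})"

definition shift :: "nat \<Rightarrow> nat \<Rightarrow> counts \<Rightarrow> counts" where
  "shift j c x a = x a + (if a = Suc c then int j else 0) - (if a = c then int j else 0)"

text \<open>For the counts of \<open>n > 0\<close> bins this is the maximal load plus one, hence the
  length of the output vector.\<close>

definition dim :: "counts \<Rightarrow> nat" where
  "dim x = (LEAST D. \<forall>a\<ge>D. x a = 0)"

definition chosen :: "(nat \<Rightarrow> nat \<Rightarrow> nat) \<Rightarrow> nat \<times> nat \<Rightarrow> nat" where
  "chosen Q p = (if Q (fst p) (snd p) = 0 then fst p else snd p)"

definition square :: "nat \<Rightarrow> (nat \<times> nat) set" where
  "square D = {..<D} \<times> {..<D}"

definition product_weight :: "counts \<Rightarrow> nat \<times> nat \<Rightarrow> nat" where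
  "product_weight x p = nat (x (fst p) * x (snd p))"

lemma shift_commute: "shift i a (shift j b x) = shift j b (shift i a x)"
  by (simp add: shift_def fun_eq_iff)

lemma shift_shift: "shift i a (shift j a x) = shift (i + j) a x"
  by (simp add: shift_def fun_eq_iff)

lemma shift_0 [simp]: "shift 0 c x = x"
  by (simp add: shift_def fun_eq_iff)

section \<open>Independent draws and their regrouping into a multinomial sample\<close>

primrec draws :: "(nat \<Rightarrow> nat \<Rightarrow> nat) \<Rightarrow> (nat \<times> nat) set \<Rightarrow> (nat \<times> nat \<Rightarrow> nat) \<Rightarrow> nat \<Rightarrow> counts \<Rightarrow> counts pmf" where
  "draws Q A v 0 x = return_pmf x"
| "draws Q A v (Suc L) x = weighted_pmf A v \<bind> (\<lambda>k. draws Q A v L (shift 1 (chosen Q k) x))"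

lemma nat_ratio: "real a / real (a + b) \<in> {0..1}"
  by (auto simp: divide_le_eq_1)

text \<open>Since shifts commute, the order of the draws is irrelevant: the number of draws that hit
  \<open>k\<close> is binomial, and the others are independent draws conditioned to avoid
  \<open>k\<close>.\<close>

lemma draws_insert:
  assumes "finite A" "k \<notin> A" "0 < v k + sum v A"
  shows "draws Q (insert k A) v L x = binomial_pmf L (real (v k) / real (v k + sum v A)) \<bind>
    (\<lambda>j. draws Q A v (L - j) (shift j (chosen Q k) x))"
proof (induction L arbitrary: x)
  case 0
  show ?case by (simp only: binomial_pmf_0[OF nat_ratio] bind_return_pmf draws.simps diff_zero shift_0)
next
  case (Suc L)
  define r where "r = real (v k) / real (v k + sum v A)"
  have r: "r \<in> {0..1}" unfolding r_def by (rule nat_ratio)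
  have "draws Q (insert k A) v (Suc L) x = bernoulli_pmf r \<bind> (\<lambda>b. binomial_pmf L r \<bind> (\<lambda>j.
      draws Q A v (Suc L - (of_bool b + j)) (shift (of_bool b + j) (chosen Q k) x)))"
  proof -
    have "draws Q (insert k A) v (Suc L) x = bernoulli_pmf r \<bind> (\<lambda>b.
        (if b then return_pmf k else weighted_pmf A v) \<bind> (\<lambda>k'. binomial_pmf L r \<bind>
        (\<lambda>j. draws Q A v (L - j) (shift j (chosen Q k) (shift 1 (chosen Q k') x)))))"
      by (simp only: draws.simps weighted_pmf_insert[OF assms] Suc.IH bind_assoc_pmf r_def)
    also have "\<dots> = bernoulli_pmf r \<bind> (\<lambda>b. binomial_pmf L r \<bind> (\<lambda>j.
      draws Q A v (Suc L - (of_bool b + j)) (shift (of_bool b + j) (chosen Q k) x)))"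
    proof (rule bind_pmf_cong[OF refl])
      fix b
      show "(if b then return_pmf k else weighted_pmf A v) \<bind> (\<lambda>k'. binomial_pmf L r \<bind>
        (\<lambda>j. draws Q A v (L - j) (shift j (chosen Q k) (shift 1 (chosen Q k') x))))
        = binomial_pmf L r \<bind> (\<lambda>j.
          draws Q A v (Suc L - (of_bool b + j)) (shift (of_bool b + j) (chosen Q k) x))"
      proof (cases b)
        case True
        then show ?thesis by (simp add: bind_return_pmf shift_shift)
      next
        case False
        \<comment> \<open>The first draw misses \<open>k\<close>; it is independent of the binomial
          number of hits among the remaining \<open>L\<close> draws, so the two can be
          exchanged.\<close>
        have "weighted_pmf A v \<bind> (\<lambda>k'. binomial_pmf L r \<bind>
            (\<lambda>j. draws Q A v (L - j) (shift j (chosen Q k) (shift 1 (chosen Q k') x))))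
          = binomial_pmf L r \<bind> (\<lambda>j. draws Q A v (Suc (L - j)) (shift j (chosen Q k) x))"
          by (subst bind_commute_pmf) (simp add: shift_commute[of _ "chosen Q k"])
        also have "\<dots> = binomial_pmf L r \<bind> (\<lambda>j. draws Q A v (Suc L - j) (shift j (chosen Q k) x))"
        proof (rule bind_pmf_cong[OF refl])
          fix j assume "j \<in> set_pmf (binomial_pmf L r)"
          then have "j \<le> L" using r by (auto simp: set_pmf_binomial_eq split: if_splits)
          then show "draws Q A v (Suc (L - j)) (shift j (chosen Q k) x) = draws Q A v (Suc L - j) (shift j (chosen Q k) x)"
            by (simp only: Suc_diff_le)
        qed
        finally show ?thesis using False by simp
      qed
    qed
    finally show ?thesis .
  qed
  also have "\<dots> = binomial_pmf (Suc L) r \<bind> (\<lambda>j. draws Q A v (Suc L - j) (shift j (chosen Q k) x))"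
    using r by (subst binomial_pmf_Suc) (auto simp: bind_assoc_pmf bind_return_pmf of_bool_def simp del: draws.simps)
  finally show ?case by (simp only: r_def)
qed

text \<open>Successive conditional binomials, with \<open>q\<close> the total weight of the pairs
  still listed. The early stop at \<open>L = 0\<close> is that of the loop in
  \<open>multinomial_code\<close>.\<close>

fun multinomial :: "(nat \<Rightarrow> nat \<Rightarrow> nat) \<Rightarrow> (nat \<times> nat \<Rightarrow> nat) \<Rightarrow> (nat \<times> nat) list \<Rightarrow> nat \<Rightarrow> nat \<Rightarrow> counts \<Rightarrow> counts sampler" where
  "multinomial Q v [] q L x = Ret x"
| "multinomial Q v (k # ks) q L x = (if L = 0 then Ret x else Choose (q ^ L) (\<lambda>W.
     let j = pick (binomial_weights (v k) q L) L W
     in multinomial Q v ks (q - v k) (L - j) (shift j (chosen Q k) x)))"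

lemma law_multinomial:
  assumes "distinct ks" "q = sum v (set ks)" "0 < L \<longrightarrow> 0 < q"
  shows "law (multinomial Q v ks q L x) = draws Q (set ks) v L x \<and> wf_sampler (multinomial Q v ks q L x)"
  using assms
proof (induction ks arbitrary: q L x)
  case (Cons k ks)
  show ?case
  proof (cases "L = 0")
    case False
    have q: "q = v k + sum v (set ks)" using Cons.prems by simp
    have q0: "0 < q" "v k \<le> q" using Cons.prems False q by auto
    define r where "r = real (v k) / real q"
    define pk where "pk = pick (binomial_weights (v k) q L) L"
    have r: "r \<in> {0..1}" using q0 by (auto simp: r_def divide_le_eq_1)
    have bin: "map_pmf pk (pmf_of_set {..<q ^ L}) = binomial_pmf L r"
      unfolding pk_def r_def using law_pick_binomial q0 by simp
    have IH: "law (multinomial Q v ks (q - v k) (L - j) y) = draws Q (set ks) v (L - j) y \<and>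
        wf_sampler (multinomial Q v ks (q - v k) (L - j) y)" if "j \<in> set_pmf (binomial_pmf L r)" for j y
    proof (rule Cons.IH)
      \<comment> \<open>If no weight remains then the success probability was 1, so the binomial
        variable has used up all draws.\<close>
      show "0 < L - j \<longrightarrow> 0 < q - v k"
      proof (rule impI, rule ccontr)
        assume "0 < L - j" "\<not> 0 < q - v k"
        then have "r = 1" using q0 by (simp add: r_def)
        then show False using that \<open>0 < L - j\<close> by simp
      qed
    qed (use Cons.prems q in auto)
    have W: "pk W \<in> set_pmf (binomial_pmf L r)" if "W < q ^ L" for W
    proof -
      have "W \<in> set_pmf (pmf_of_set {..<q ^ L})" using that by (subst set_pmf_of_set) auto
      then show ?thesis unfolding bin[symmetric] by simp
    qed
    have wf: "wf_sampler (multinomial Q v (k # ks) q L x)"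
      using False q0 IH[OF W] by (simp add: Let_def pk_def[symmetric])
    have "law (multinomial Q v (k # ks) q L x) = map_pmf pk (pmf_of_set {..<q ^ L}) \<bind>
        (\<lambda>j. law (multinomial Q v ks (q - v k) (L - j) (shift j (chosen Q k) x)))"
      using False by (simp add: Let_def pk_def bind_map_pmf)
    also have "\<dots> = binomial_pmf L r \<bind> (\<lambda>j. draws Q (set ks) v (L - j) (shift j (chosen Q k) x))"
      unfolding bin by (rule bind_pmf_cong) (auto simp: IH)
    also have "\<dots> = draws Q (set (k # ks)) v L x"
      using draws_insert[of "set ks" k v Q L x] Cons.prems q q0 by (simp add: r_def)
    finally show ?thesis using wf by blast
  qed simp
qed simp

subsubsection \<open>Counts of a load vector\<close>

lemma counts_of_nonneg: "0 \<le> counts_of n N a"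
  by (simp add: counts_of_def)

lemma counts_of_upd:
  assumes "i < n"
  shows "counts_of n (N(i := Suc (N i))) = shift (Suc 0) (N i) (counts_of n N)"
proof
  fix a
  have "{l \<in> {..<n}. (N(i := Suc (N i))) l = a} = (if a = Suc (N i) then insert i {l \<in> {..<n}. N l = a}
      else {l \<in> {..<n}. N l = a} - (if a = N i then {i} else {}))"
    using assms by (auto split: if_splits)
  moreover have "0 < card {l \<in> {..<n}. N l = N i}" using assms by (auto simp: card_gt_0_iff)
  ultimately show "counts_of n (N(i := Suc (N i))) a = shift (Suc 0) (N i) (counts_of n N) a"
    using assms by (auto simp: counts_of_def shift_def card_Diff_singleton of_nat_diff)
qed

lemma counts_of_gt: "0 < counts_of n N a \<longleftrightarrow> (\<exists>i<n. N i = a)"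
  by (auto simp: counts_of_def card_gt_0_iff)

lemma dim_counts_of:
  assumes "0 < n"
  shows "dim (counts_of n N) = Suc (Max (N ` {..<n}))"
  unfolding dim_def
proof (rule Least_equality)
  show "\<forall>a\<ge>Suc (Max (N ` {..<n})). counts_of n N a = 0"
  proof (intro allI impI)
    fix a assume a: "Suc (Max (N ` {..<n})) \<le> a"
    have "N i \<noteq> a" if "i < n" for i
    proof -
      have "N i \<le> Max (N ` {..<n})" using that by (intro Max_ge) auto
      then show ?thesis using a by linarith
    qed
    then show "counts_of n N a = 0" by (auto simp: counts_of_def)
  qed
next
  fix D assume D: "\<forall>a\<ge>D. counts_of n N a = 0"
  have "Max (N ` {..<n}) \<in> N ` {..<n}" using assms by (intro Max_in) auto
  then have "0 < counts_of n N (Max (N ` {..<n}))" by (auto simp: counts_of_gt)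
  then show "Suc (Max (N ` {..<n})) \<le> D" using D by (metis less_irrefl not_less_eq_eq)
qed

lemma counts_of_ge_dim: "0 < n \<Longrightarrow> dim (counts_of n N) \<le> a \<Longrightarrow> counts_of n N a = 0"
  using dim_counts_of[of n N] Max_ge[of "N ` {..<n}"] 
  by (fastforce simp: counts_of_def)

lemma bin_cardinalities_counts:
  "0 < n \<Longrightarrow> bin_cardinalities n N = map (\<lambda>a. nat (counts_of n N a)) [0..<dim (counts_of n N)]"
  by (simp add: bin_cardinalities_def dim_counts_of counts_of_def)

lemma uniform_load:
  assumes "0 < n"
  shows "pmf (map_pmf N (pmf_of_set {..<n})) a = real_of_int (counts_of n N a) / n"
proof -
  have "{..<n} \<inter> N -` {a} = {i \<in> {..<n}. N i = a}" by auto
  then show ?thesis using assms by (simp add: pmf_map measure_pmf_of_set counts_of_def lessThan_empty_iff)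
qed

lemma sum_counts_of:
  assumes "0 < n" "dim (counts_of n N) \<le> D"
  shows "(\<Sum>a<D. counts_of n N a) = int n"
proof -
  have "(\<Sum>a<D. counts_of n N a) = int (card (\<Union>a<D. {i \<in> {..<n}. N i = a}))"
    unfolding counts_of_def by (subst card_UN_disjoint) auto
  also have "(\<Union>a<D. {i \<in> {..<n}. N i = a}) = {..<n}"
  proof -
    have "N i < D" if "i < n" for i
      using assms(2) counts_of_ge_dim[OF assms(1), of N "N i"] counts_of_gt[of n N "N i"] that
      by (metis less_irrefl not_le_imp_less order_trans)
    then show ?thesis by auto
  qed
  finally show ?thesis by simp
qed

section \<open>The chain of counts as a projection of the load process\<close>

definition valid :: "nat \<Rightarrow> counts \<Rightarrow> bool" where
  "valid n x \<longleftrightarrow> (\<exists>N. x = counts_of n N)"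

definition total :: "counts \<Rightarrow> nat \<Rightarrow> nat" where
  "total x D = sum (product_weight x) (square D)"

lemma total_eq:
  assumes "\<And>a. 0 \<le> x a"
  shows "int (total x D) = (\<Sum>a<D. x a)\<^sup>2"
  unfolding total_def square_def
  by (simp add: product_weight_def assms sum.cartesian_product power2_eq_square sum_product case_prod_unfold)

lemma valid_total: "0 < n \<Longrightarrow> valid n x \<Longrightarrow> dim x \<le> D \<Longrightarrow> total x D = n\<^sup>2"
  using total_eq[of x D] by (auto simp: valid_def counts_of_nonneg sum_counts_of simp flip: of_nat_power)

definition kernel :: "(nat \<Rightarrow> nat \<Rightarrow> nat) \<Rightarrow> counts \<Rightarrow> counts pmf" where
  "kernel Q x = map_pmf (\<lambda>k. shift 1 (chosen Q k) x) (weighted_pmf (square (dim x)) (product_weight x))"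

text \<open>The two sampled bins are independent, and a uniform bin has load \<open>a\<close> with
  probability \<open>x a / n\<close>; the common denominator \<open>n ^ 2\<close> is the total
  weight.\<close>

lemma weighted_pmf_counts:
  assumes "0 < n"
  shows "weighted_pmf (square (dim (counts_of n N))) (product_weight (counts_of n N)) =
    map_pmf (\<lambda>(i1, i2). (N i1, N i2)) (pair_pmf (pmf_of_set {..<n}) (pmf_of_set {..<n}))"
proof (rule pmf_eqI)
  fix k :: "nat \<times> nat"
  let ?x = "counts_of n N"
  have t: "sum (product_weight ?x) (square (dim ?x)) = n\<^sup>2"
    using valid_total[of n ?x "dim ?x"] assms by (auto simp: valid_def total_def)
  have "pmf (weighted_pmf (square (dim ?x)) (product_weight ?x)) k = real_of_int (?x (fst k)) / n * (real_of_int (?x (snd k)) / n)"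
  proof (cases "k \<in> square (dim ?x)")
    case True
    then show ?thesis using assms t
      by (subst pmf_weighted_pmf) (auto simp: square_def product_weight_def counts_of_nonneg power2_eq_square)
  next
    case False
    then have "?x (fst k) = 0 \<or> ?x (snd k) = 0"
      using counts_of_ge_dim[OF assms, of N] by (cases k) (auto simp: square_def not_less)
    then show ?thesis using assms t False
      by (subst pmf_weighted_pmf) (auto simp: square_def)
  qed
  also have "\<dots> = pmf (map_pmf (\<lambda>(i1, i2). (N i1, N i2)) (pair_pmf (pmf_of_set {..<n}) (pmf_of_set {..<n}))) k"
    unfolding map_pair by (cases k) (simp add: pmf_pair uniform_load[OF assms])
  finally show "pmf (weighted_pmf (square (dim ?x)) (product_weight ?x)) k = \<dots>" .
qed

text \<open>Lumpability: the law of the next counts depends on the loads only through the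
  counts.\<close>

lemma kernel_counts_of:
  assumes "0 < n"
  shows "kernel Q (counts_of n N) = map_pmf (counts_of n) (two_sample_step Q n N)"
proof -
  have ne: "{..<n} \<noteq> {}" using assms by auto
  have "map_pmf (counts_of n) (two_sample_step Q n N) = pmf_of_set {..<n} \<bind> (\<lambda>i1. pmf_of_set {..<n} \<bind> (\<lambda>i2.
      return_pmf (shift 1 (chosen Q (N i1, N i2)) (counts_of n N))))"
    unfolding two_sample_step_def map_bind_pmf
    by (intro bind_pmf_cong refl) (use ne in \<open>auto simp: Let_def counts_of_upd chosen_def set_pmf_of_set\<close>)
  also have "\<dots> = kernel Q (counts_of n N)"
    unfolding kernel_def weighted_pmf_counts[OF assms]
    by (simp add: pair_pmf_def map_bind_pmf bind_assoc_pmf bind_return_pmf)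
  finally show ?thesis ..
qed

primrec steps :: "(nat \<Rightarrow> nat \<Rightarrow> nat) \<Rightarrow> nat \<Rightarrow> counts \<Rightarrow> counts pmf" where
  "steps Q 0 x = return_pmf x"
| "steps Q (Suc r) x = kernel Q x \<bind> steps Q r"

text \<open>\<open>two_sample\<close> appends its last step whereas \<open>steps\<close> prepends
  its first one; keeping \<open>r\<close> arbitrary lets the induction carry one step at a time
  across.\<close>

lemma two_sample_steps:
  assumes "0 < n"
  shows "two_sample Q n t \<bind> (\<lambda>N. steps Q r (counts_of n N)) = steps Q (t + r) (counts_of n (\<lambda>_. 0))"
proof (induction t arbitrary: r)
  case (Suc t)
  have "two_sample Q n (Suc t) \<bind> (\<lambda>N. steps Q r (counts_of n N)) =
      two_sample Q n t \<bind> (\<lambda>N. steps Q (Suc r) (counts_of n N))"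
    by (simp add: bind_assoc_pmf kernel_counts_of[OF assms] bind_map_pmf)
  then show ?case using Suc[of "Suc r"] by simp
qed (simp add: bind_return_pmf)

lemma map_counts_two_sample:
  "0 < n \<Longrightarrow> map_pmf (counts_of n) (two_sample Q n m) = steps Q m (counts_of n (\<lambda>_. 0))"
  using two_sample_steps[of n Q m 0] by (simp add: map_pmf_def)

lemma bin_cardinalities_law_steps:
  assumes "0 < n"
  shows "bin_cardinalities_law Q n m =
    map_pmf (\<lambda>x. map (\<lambda>a. nat (x a)) [0..<dim x]) (steps Q m (counts_of n (\<lambda>_. 0)))"
  unfolding bin_cardinalities_law_def map_counts_two_sample[OF assms, symmetric] pmf.map_comp
  by (intro map_pmf_cong) (simp_all add: bin_cardinalities_counts[OF assms])

lemma valid_shift: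
  assumes "valid n x" "0 < x c"
  shows "valid n (shift 1 c x)"
proof -
  obtain N where N: "x = counts_of n N" using assms by (auto simp: valid_def)
  then obtain i where "i < n" "N i = c" using assms(2) by (auto simp: counts_of_gt)
  then have "shift 1 c x = counts_of n (N(i := Suc (N i)))" using counts_of_upd[of i n N] N by simp
  then show ?thesis unfolding valid_def by blast
qed

subsection \<open>Runs of moves with a fixed law\<close>

text \<open>Let \<open>y = low s x\<close>. As long as fewer than \<open>s\<close> balls have been thrown since \<open>x\<close>, the current counts
  dominate \<open>y\<close>. Hence a step splits into two cases: with a probability \<open>p\<close> that does not depend on the
  current counts, the pair of loads is drawn with weights \<open>y a * y b\<close>, which do not depend on them
  either; otherwise it is drawn with the remaining weights. An iteration consists of the steps up to
  and including the first of the second kind, but of at most \<open>h\<close>.\<close>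

definition low :: "nat \<Rightarrow> counts \<Rightarrow> counts" where
  "low s x a = max 0 (x a - int s)"

text \<open>The natural subtraction is exact as long as \<open>x\<close> dominates \<open>y\<close>,
  by \<open>product_weight_mono\<close>.\<close>

definition excess :: "counts \<Rightarrow> counts \<Rightarrow> nat \<times> nat \<Rightarrow> nat" where
  "excess x y k = product_weight x k - product_weight y k"

primrec iteration :: "(nat \<Rightarrow> nat \<Rightarrow> nat) \<Rightarrow> real \<Rightarrow> counts \<Rightarrow> nat \<Rightarrow> nat \<Rightarrow> counts \<Rightarrow> (nat \<times> counts) pmf" where
  "iteration Q p y D 0 x = return_pmf (0, x)"
| "iteration Q p y D (Suc h) x = bernoulli_pmf p \<bind> (\<lambda>b.
     if b then weighted_pmf (square D) (product_weight y) \<bind> (\<lambda>k.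
       map_pmf (apfst Suc) (iteration Q p y D h (shift 1 (chosen Q k) x)))
     else map_pmf (\<lambda>k. (1, shift 1 (chosen Q k) x)) (weighted_pmf (square (dim x)) (excess x y)))"

text \<open>\<open>h\<close> is the number of further steps for which domination of \<open>y\<close>
  is guaranteed, as a step lowers each count by at most one. The bound \<open>max 0\<close> matches
  the truncation in \<open>low\<close>.\<close>

definition dominated :: "nat \<Rightarrow> counts \<Rightarrow> nat \<Rightarrow> nat \<Rightarrow> counts \<Rightarrow> bool" where
  "dominated n y D h x \<longleftrightarrow> valid n x \<and> (\<forall>a. 0 \<le> y a \<and> y a \<le> max 0 (x a - int h)) \<and> (\<forall>a\<ge>D. y a = 0)"

lemma finite_square [simp]: "finite (square D)"
  by (simp add: square_def)

lemma valid_nonneg: "valid n x \<Longrightarrow> 0 \<le> x a"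
  by (auto simp: valid_def counts_of_nonneg)

lemma valid_ge_dim: "0 < n \<Longrightarrow> valid n x \<Longrightarrow> dim x \<le> a \<Longrightarrow> x a = 0"
  by (auto simp: valid_def counts_of_ge_dim)

lemma dominated_le: "dominated n y D h x \<Longrightarrow> y a \<le> x a"
proof -
  assume "dominated n y D h x"
  then have "y a \<le> max 0 (x a - int h)" "0 \<le> x a" by (auto simp: dominated_def valid_nonneg)
  then show "y a \<le> x a" by linarith
qed

lemma dominated_0: "dominated n y D h x \<Longrightarrow> dominated n y D 0 x"
proof -
  have "max 0 (x a - int h) \<le> max 0 (x a - int 0)" for a by (rule max.mono) auto
  then show "dominated n y D h x \<Longrightarrow> dominated n y D 0 x"
    unfolding dominated_def by (meson order_trans)
qed

lemma product_weight_mono: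
  assumes "dominated n y D h x"
  shows "product_weight y k \<le> product_weight x k"
  unfolding product_weight_def
  by (intro nat_mono mult_mono dominated_le[OF assms]) (use assms in \<open>auto simp: dominated_def valid_nonneg\<close>)

lemma product_weight_outside:
  "(\<And>a. D \<le> a \<Longrightarrow> y a = 0) \<Longrightarrow> k \<notin> square D \<Longrightarrow> product_weight y k = 0"
  by (cases "fst k < D"; cases "snd k < D") (auto simp: square_def product_weight_def mem_Times_iff not_less)

lemma total_cong:
  assumes "\<And>a. D \<le> a \<Longrightarrow> y a = 0" "D \<le> D'"
  shows "total y D = total y D'"
  unfolding total_def
  by (rule sum.mono_neutral_left)
    (use assms product_weight_outside[of D y] in \<open>auto simp: square_def\<close>)

text \<open>\<open>D'\<close> is free because \<open>dim x\<close> may grow during an iteration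
  beyond the dimension \<open>D\<close> at which \<open>y\<close> was fixed; the weights of
  \<open>y\<close> vanish on the additional pairs.\<close>

lemma dominated_total:
  assumes "0 < n" "dominated n y D h x" "dim x \<le> D'"
  shows "sum (product_weight y) (square D') = total y D"
    and "sum (excess x y) (square D') = n\<^sup>2 - total y D" and "total y D \<le> n\<^sup>2"
proof -
  have y0: "y a = 0" if "dim x \<le> a" for a
    using valid_ge_dim[OF assms(1) _ that] dominated_le[OF assms(2), of a] assms(2)
    by (auto simp: dominated_def intro: antisym)
  have "total y D' = total y (max D D')"
    by (rule total_cong) (use y0 assms(3) in auto)
  moreover have "total y D = total y (max D D')"
    by (rule total_cong) (use assms(2) in \<open>auto simp: dominated_def\<close>)
  ultimately show 1: "sum (product_weight y) (square D') = total y D" by (simp add: total_def)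
  have 2: "sum (product_weight x) (square D') = n\<^sup>2"
    using valid_total[of n x D'] assms by (simp add: dominated_def total_def)
  show "sum (excess x y) (square D') = n\<^sup>2 - total y D"
    unfolding excess_def by (subst sum_subtractf_nat) (use 1 2 product_weight_mono[OF assms(2)] in auto)
  show "total y D \<le> n\<^sup>2"
    using 1 2 sum_mono[of "square D'" "product_weight y" "product_weight x"] product_weight_mono[OF assms(2)] by simp
qed

text \<open>The weights of \<open>x\<close> are those of \<open>y\<close> plus the excess, and their
  total is \<open>n ^ 2\<close> for all valid counts. So the mixing probability depends on
  \<open>y\<close> alone.\<close>

lemma kernel_mixture:
  assumes "0 < n" "dominated n y D h x" "p = real (total y D) / real (n\<^sup>2)"
  shows "kernel Q x = bernoulli_pmf p \<bind> (\<lambda>b. map_pmf (\<lambda>k. shift 1 (chosen Q k) x)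
    (if b then weighted_pmf (square D) (product_weight y) else weighted_pmf (square (dim x)) (excess x y)))"
proof -
  note t = dominated_total[OF assms(1,2)]
  have p: "p \<in> {0..1}" using t(3)[of "dim x"] nat_ratio[of "total y D" "n\<^sup>2 - total y D"] assms(3) by simp
  have "weighted_pmf (square (dim x)) (product_weight x) =
      weighted_pmf (square (dim x)) (\<lambda>k. product_weight y k + excess x y k)"
    by (rule weighted_pmf_cong) (simp add: excess_def product_weight_mono[OF assms(2)])
  also have "\<dots> = bernoulli_pmf p \<bind> (\<lambda>b. if b then weighted_pmf (square (dim x)) (product_weight y)
      else weighted_pmf (square (dim x)) (excess x y))"
    using weighted_pmf_add[of "square (dim x)" "product_weight y" "excess x y"] t[of "dim x"] assms(1,3) by simp
  also have "\<dots> = bernoulli_pmf p \<bind> (\<lambda>b. if b then weighted_pmf (square D) (product_weight y)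
      else weighted_pmf (square (dim x)) (excess x y))"
  proof (rule bind_pmf_cong[OF refl])
    fix b assume b: "b \<in> set_pmf (bernoulli_pmf p)"
    have "weighted_pmf (square (dim x)) (product_weight y) = weighted_pmf (square D) (product_weight y)" if b
    proof -
      \<comment> \<open>This branch has positive probability, so \<open>y\<close> has positive total
        weight and restricting it to either square gives the same distribution.\<close>
      have "p \<noteq> 0" using b that p by (auto simp: set_pmf_iff)
      then have t0: "0 < total y D" using assms(3) by (cases "total y D = 0") auto
      have s: "0 < sum (product_weight y) (square (max D (dim x)))"
        using t(1)[of "max D (dim x)"] t0 by simp
      have y0: "y a = 0" if "dim x \<le> a" for a
        using valid_ge_dim[OF assms(1) _ that] dominated_le[OF assms(2), of a] assms(2)
        by (auto simp: dominated_def intro: antisym)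
      have "weighted_pmf (square (dim x)) (product_weight y) = weighted_pmf (square (max D (dim x))) (product_weight y)"
        by (rule weighted_pmf_mono_neutral)
          (use s product_weight_outside[of "dim x" y, OF y0] in \<open>auto simp: square_def\<close>)
      moreover have "weighted_pmf (square D) (product_weight y) = weighted_pmf (square (max D (dim x))) (product_weight y)"
        by (rule weighted_pmf_mono_neutral)
          (use assms(2) s product_weight_outside[of D y] in \<open>auto simp: square_def dominated_def\<close>)
      ultimately show ?thesis by simp
    qed
    then show "(if b then weighted_pmf (square (dim x)) (product_weight y) else weighted_pmf (square (dim x)) (excess x y))
      = (if b then weighted_pmf (square D) (product_weight y) else weighted_pmf (square (dim x)) (excess x y))" by simp
  qed
  finally show ?thesis by (simp add: kernel_def map_bind_pmf)
qed

lemma positive_product: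
  "(\<And>a. 0 \<le> x a) \<Longrightarrow> 0 < product_weight x k \<Longrightarrow> 0 < x (chosen Q k)"
  unfolding product_weight_def chosen_def
  by (smt (verit) mult_eq_0_iff zero_less_nat_eq)

lemma dominated_step:
  assumes "dominated n y D (Suc h) x" "0 < total y D" "k \<in> set_pmf (weighted_pmf (square D) (product_weight y))"
  shows "dominated n y D h (shift 1 (chosen Q k) x)"
proof -
  have "0 < product_weight y k" using assms by (auto simp: set_weighted_pmf total_def)
  then have "0 < y (chosen Q k)" using assms(1) by (intro positive_product) (auto simp: dominated_def)
  then have "0 < x (chosen Q k)" using dominated_le[OF assms(1), of "chosen Q k"] by simp
  then have "valid n (shift 1 (chosen Q k) x)" using assms(1) by (intro valid_shift) (auto simp: dominated_def)
  moreover have "max 0 (x a - int (Suc h)) \<le> max 0 (shift 1 (chosen Q k) x a - int h)" for a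
    by (rule max.mono) (auto simp: shift_def)
  ultimately show ?thesis using assms(1) unfolding dominated_def by (meson order_trans)
qed

lemma valid_excess:
  assumes "0 < n" "dominated n y D h x" "total y D < n\<^sup>2"
    "k \<in> set_pmf (weighted_pmf (square (dim x)) (excess x y))"
  shows "valid n (shift 1 (chosen Q k) x)" "0 < x (chosen Q k)"
proof -
  have "0 < excess x y k"
    using assms(3,4) dominated_total[OF assms(1,2), of "dim x"] by (auto simp: set_weighted_pmf)
  then have "0 < product_weight x k" by (simp add: excess_def)
  then show "0 < x (chosen Q k)" using assms(2) by (intro positive_product) (auto simp: dominated_def valid_nonneg)
  then show "valid n (shift 1 (chosen Q k) x)" using assms(2) by (intro valid_shift) (auto simp: dominated_def)
qed

lemma bernoulli_True:
  assumes "b \<in> set_pmf (bernoulli_pmf (real t / real N))" "t \<le> N" "0 < N"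
  shows "b \<Longrightarrow> 0 < t" "\<not> b \<Longrightarrow> t < N"
proof -
  have r: "0 \<le> real t / real N" "real t / real N \<le> 1" using assms(2,3) by auto
  show "0 < t" if b using that assms(1) r by (cases "t = 0") (auto simp: set_pmf_iff)
  show "t < N" if "\<not> b" using that assms r by (cases "t = N") (auto simp: set_pmf_iff)
qed

lemma set_iteration:
  assumes "0 < n" "dominated n y D h x" "(l, x') \<in> set_pmf (iteration Q (real (total y D) / real (n\<^sup>2)) y D h x)"
  shows "valid n x' \<and> l \<le> h \<and> (0 < h \<longrightarrow> 0 < l)"
  using assms(2,3)
proof (induction h arbitrary: x l)
  case 0
  then show ?case by (simp add: dominated_def)
next
  case (Suc h)
  let ?p = "real (total y D) / real (n\<^sup>2)"
  have t: "total y D \<le> n\<^sup>2" "0 < n\<^sup>2" using dominated_total(3)[OF assms(1) Suc.prems(1) order_refl] assms(1) by auto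
  from Suc.prems(2) obtain b where b: "b \<in> set_pmf (bernoulli_pmf ?p)" and
    m: "(l, x') \<in> set_pmf (if b then weighted_pmf (square D) (product_weight y) \<bind> (\<lambda>k.
       map_pmf (apfst Suc) (iteration Q ?p y D h (shift 1 (chosen Q k) x)))
     else map_pmf (\<lambda>k. (1, shift 1 (chosen Q k) x)) (weighted_pmf (square (dim x)) (excess x y)))"
    unfolding iteration.simps set_bind_pmf by blast
  show ?case
  proof (cases b)
    case True
    then obtain k l' where k: "k \<in> set_pmf (weighted_pmf (square D) (product_weight y))"
      and l: "l = Suc l'" "(l', x') \<in> set_pmf (iteration Q ?p y D h (shift 1 (chosen Q k) x))"
      using m by (auto simp: set_map_pmf)
    have "dominated n y D h (shift 1 (chosen Q k) x)"
      using dominated_step[OF Suc.prems(1) bernoulli_True(1)[OF b t True] k] .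
    from Suc.IH[OF this l(2)] l(1) show ?thesis by simp
  next
    case False
    then obtain k where "k \<in> set_pmf (weighted_pmf (square (dim x)) (excess x y))"
      and "l = 1" "x' = shift 1 (chosen Q k) x" using m by auto
    then show ?thesis using valid_excess(1)[OF assms(1) Suc.prems(1) bernoulli_True(2)[OF b t False]] by simp
  qed
qed

text \<open>An iteration is a stretch of the chain of random length \<open>l\<close>, determined by
  the past alone; the remaining \<open>R - l\<close> steps continue it. The cap \<open>h\<close>
  keeps \<open>y\<close> dominated throughout.\<close>

lemma steps_iteration:
  assumes "0 < n" "dominated n y D h x" "h \<le> R"
  shows "iteration Q (real (total y D) / real (n\<^sup>2)) y D h x \<bind> (\<lambda>(l, x'). steps Q (R - l) x') = steps Q R x"
  using assms(2,3)
proof (induction h arbitrary: x R)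
  case (Suc h)
  let ?p = "real (total y D) / real (n\<^sup>2)"
  have t: "total y D \<le> n\<^sup>2" "0 < n\<^sup>2" using dominated_total(3)[OF assms(1) Suc.prems(1) order_refl] assms(1) by auto
  obtain R' where R: "R = Suc R'" "h \<le> R'" using Suc.prems(2) by (cases R) auto
  have "iteration Q ?p y D (Suc h) x \<bind> (\<lambda>(l, x'). steps Q (R - l) x') =
    bernoulli_pmf ?p \<bind> (\<lambda>b. (if b then weighted_pmf (square D) (product_weight y)
      else weighted_pmf (square (dim x)) (excess x y)) \<bind> (\<lambda>k. steps Q R' (shift 1 (chosen Q k) x)))"
    unfolding iteration.simps bind_assoc_pmf
  proof (rule bind_pmf_cong[OF refl])
    fix b assume b: "b \<in> set_pmf (bernoulli_pmf ?p)"
    show "(if b then weighted_pmf (square D) (product_weight y) \<bind> (\<lambda>k.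
       map_pmf (apfst Suc) (iteration Q ?p y D h (shift 1 (chosen Q k) x)))
     else map_pmf (\<lambda>k. (1, shift 1 (chosen Q k) x)) (weighted_pmf (square (dim x)) (excess x y))) \<bind>
      (\<lambda>(l, x'). steps Q (R - l) x') = (if b then weighted_pmf (square D) (product_weight y)
      else weighted_pmf (square (dim x)) (excess x y)) \<bind> (\<lambda>k. steps Q R' (shift 1 (chosen Q k) x))"
    proof (cases b)
      case True
      have "weighted_pmf (square D) (product_weight y) \<bind> (\<lambda>k.
         map_pmf (apfst Suc) (iteration Q ?p y D h (shift 1 (chosen Q k) x)) \<bind> (\<lambda>(l, x'). steps Q (R - l) x')) =
         weighted_pmf (square D) (product_weight y) \<bind> (\<lambda>k. steps Q R' (shift 1 (chosen Q k) x))"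
      proof (rule bind_pmf_cong[OF refl])
        fix k assume k: "k \<in> set_pmf (weighted_pmf (square D) (product_weight y))"
        have "dominated n y D h (shift 1 (chosen Q k) x)"
          using dominated_step[OF Suc.prems(1) bernoulli_True(1)[OF b t True] k] .
        from Suc.IH[OF this R(2)]
        show "map_pmf (apfst Suc) (iteration Q ?p y D h (shift 1 (chosen Q k) x)) \<bind> (\<lambda>(l, x'). steps Q (R - l) x')
          = steps Q R' (shift 1 (chosen Q k) x)"
          by (simp add: bind_map_pmf case_prod_unfold R)
      qed
      then show ?thesis using True by (simp add: bind_assoc_pmf)
    next
      case False
      then show ?thesis by (simp add: bind_map_pmf R)
    qed
  qed
  also have "\<dots> = kernel Q x \<bind> steps Q R'"
    by (simp add: kernel_mixture[OF assms(1) Suc.prems(1) refl] bind_assoc_pmf bind_map_pmf)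
  finally show ?case by (simp add: R)
qed (simp add: bind_return_pmf)

section \<open>Splitting an iteration into a geometric and a multinomial sample\<close>

definition iteration_end :: "(nat \<Rightarrow> nat \<Rightarrow> nat) \<Rightarrow> counts \<Rightarrow> nat \<Rightarrow> nat \<Rightarrow> counts \<Rightarrow> (nat \<times> counts) pmf" where
  "iteration_end Q y h L x = (if L < h
     then map_pmf (\<lambda>k. (Suc L, shift 1 (chosen Q k) x)) (weighted_pmf (square (dim x)) (excess x y))
     else return_pmf (L, x))"

text \<open>Neither the coin nor the weights of \<open>y\<close> depend on the current counts, so
  all coins may be tossed before the draws; their run of successes is capped geometric. A run of
  length \<open>h\<close> ends without a draw from the excess.\<close>

lemma iteration_geometric:
  "capped_geometric p h \<bind> (\<lambda>L. draws Q (square D) (product_weight y) L x \<bind> iteration_end Q y h L)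
    = iteration Q p y D h x"
proof (induction h arbitrary: x)
  case (Suc h)
  have e: "iteration_end Q y (Suc h) (Suc L) x1 = map_pmf (apfst Suc) (iteration_end Q y h L x1)" for L x1
    by (simp add: iteration_end_def pmf.map_comp o_def)
  show ?case
    unfolding capped_geometric.simps iteration.simps bind_assoc_pmf
  proof (rule bind_pmf_cong[OF refl])
    fix b
    let ?w = "weighted_pmf (square D) (product_weight y)"
    have "map_pmf Suc (capped_geometric p h) \<bind> (\<lambda>L. draws Q (square D) (product_weight y) L x \<bind> iteration_end Q y (Suc h) L)
      = capped_geometric p h \<bind> (\<lambda>L. ?w \<bind> (\<lambda>k.
         draws Q (square D) (product_weight y) L (shift 1 (chosen Q k) x) \<bind> (\<lambda>x1. map_pmf (apfst Suc) (iteration_end Q y h L x1))))"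
      by (simp add: bind_map_pmf bind_assoc_pmf e[abs_def])
    also have "\<dots> = ?w \<bind> (\<lambda>k. map_pmf (apfst Suc) (capped_geometric p h \<bind> (\<lambda>L.
         draws Q (square D) (product_weight y) L (shift 1 (chosen Q k) x) \<bind> iteration_end Q y h L)))"
      by (subst bind_commute_pmf) (simp add: map_bind_pmf)
    finally show "(if b then map_pmf Suc (capped_geometric p h) else return_pmf 0) \<bind>
        (\<lambda>L. draws Q (square D) (product_weight y) L x \<bind> iteration_end Q y (Suc h) L) =
      (if b then ?w \<bind> (\<lambda>k. map_pmf (apfst Suc) (iteration Q p y D h (shift 1 (chosen Q k) x)))
       else map_pmf (\<lambda>k. (1, shift 1 (chosen Q k) x)) (weighted_pmf (square (dim x)) (excess x y)))"
      by (simp add: Suc.IH bind_return_pmf iteration_end_def)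
  qed
qed (simp add: bind_return_pmf iteration_end_def)

text \<open>Row by row, as the program runs through the pairs with two counters.\<close>

definition square_list :: "nat \<Rightarrow> (nat \<times> nat) list" where
  "square_list D = map (\<lambda>i. (i div D, i mod D)) [0..<D * D]"

lemma set_square_list: "set (square_list D) = square D"
proof -
  have "(a, b) \<in> (\<lambda>i. (i div D, i mod D)) ` {0..<D * D}" if "a < D" "b < D" for a b
  proof (rule image_eqI[of _ _ "a * D + b"])
    have "a * D + b < Suc a * D" using that by simp
    also have "\<dots> \<le> D * D" using that by (intro mult_le_mono1) auto
    finally show "a * D + b \<in> {0..<D * D}" by simp
  qed (use that in auto)
  then show ?thesis
    by (auto simp: square_list_def square_def less_mult_imp_div_less intro!: mod_less_divisor)
      (metis mult_is_0 not_gr_zero not_less_zero)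
qed

lemma distinct_square_list: "distinct (square_list D)"
  unfolding square_list_def distinct_map
  by (auto intro!: inj_onI) (metis div_mult_mod_eq)

text \<open>The concluding move is written as a multinomial sample of size 1, so that one subroutine
  serves both kinds of moves.\<close>

definition iteration_sampler :: "(nat \<Rightarrow> nat \<Rightarrow> nat) \<Rightarrow> nat \<Rightarrow> nat \<Rightarrow> nat \<Rightarrow> counts \<Rightarrow> (nat \<times> counts) sampler" where
  "iteration_sampler Q n s h x = (let y = low s x; D = dim x; G = total y D in
     Choose ((n\<^sup>2) ^ h) (\<lambda>W. let L = pick (geometric_weights G (n\<^sup>2) h) h W in
       bind_sampler (multinomial Q (product_weight y) (square_list D) G L x) (\<lambda>x1.
         if L < h then bind_sampler (multinomial Q (excess x1 y) (square_list (dim x1)) (n\<^sup>2 - G) 1 x1)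
           (\<lambda>x2. Ret (Suc L, x2))
         else Ret (L, x1))))"

lemma dominated_draws:
  assumes "dominated n y D h x" "L \<le> h" "0 < L \<longrightarrow> 0 < total y D"
    "x1 \<in> set_pmf (draws Q (square D) (product_weight y) L x)"
  shows "dominated n y D (h - L) x1"
  using assms
proof (induction L arbitrary: h x)
  case (Suc L)
  obtain h' where h: "h = Suc h'" using Suc.prems by (cases h) auto
  obtain k where k: "k \<in> set_pmf (weighted_pmf (square D) (product_weight y))"
    "x1 \<in> set_pmf (draws Q (square D) (product_weight y) L (shift 1 (chosen Q k) x))"
    using Suc.prems by auto
  have "dominated n y D h' (shift 1 (chosen Q k) x)"
    using dominated_step[of n y D h' x k Q] Suc.prems k h by simp
  from Suc.IH[OF this _ _ k(2)] Suc.prems show ?case by (simp add: h)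
qed auto

text \<open>On the support, moves of either kind are requested only if their total weight is
  positive, so no junk distribution is ever sampled.\<close>

lemma set_capped_geometric:
  assumes "L \<in> set_pmf (capped_geometric (real G / real H) h)" "G \<le> H" "0 < H"
  shows "L \<le> h" "0 < L \<Longrightarrow> 0 < G" "L < h \<Longrightarrow> G < H"
proof -
  have "0 \<le> real G / real H" "real G / real H \<le> 1" using assms by auto
  note p = pmf_capped_geometric[OF this, of h L]
  have "pmf (capped_geometric (real G / real H) h) L \<noteq> 0" using assms(1) by (simp add: set_pmf_iff)
  then show "L \<le> h" "0 < L \<Longrightarrow> 0 < G" "L < h \<Longrightarrow> G < H"
    using assms(2,3) by (auto simp: p split: if_splits intro!: le_neq_implies_less)
qed

lemma low_dominated: "0 < n \<Longrightarrow> valid n x \<Longrightarrow> h \<le> s \<Longrightarrow> dominated n (low s x) (dim x) h x"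
  unfolding dominated_def low_def by (auto simp: valid_ge_dim)

lemma law_iteration_sampler:
  assumes "0 < n" "valid n x" "h \<le> s"
  defines "y \<equiv> low s x"
  shows "law (iteration_sampler Q n s h x) = iteration Q (real (total y (dim x)) / real (n\<^sup>2)) y (dim x) h x"
    and "wf_sampler (iteration_sampler Q n s h x)"
proof -
  define G where "G = total y (dim x)"
  define p where "p = real G / real (n\<^sup>2)"
  define pk where "pk = pick (geometric_weights G (n\<^sup>2) h) h"
  have dom: "dominated n y (dim x) h x" unfolding y_def by (rule low_dominated[OF assms(1-3)])
  have G: "G \<le> n\<^sup>2" "0 < n\<^sup>2" using dominated_total(3)[OF assms(1) dom order_refl] assms(1) by (auto simp: G_def)
  have geo: "map_pmf pk (pmf_of_set {..<(n\<^sup>2) ^ h}) = capped_geometric p h"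
    unfolding pk_def p_def by (rule law_pick_geometric[OF G])
  define last where "last = (\<lambda>L x1. if L < h
    then bind_sampler (multinomial Q (excess x1 y) (square_list (dim x1)) (n\<^sup>2 - G) 1 x1) (\<lambda>x2. Ret (Suc L, x2))
    else Ret (L, x1))"
  define tail where "tail = (\<lambda>L. bind_sampler (multinomial Q (product_weight y) (square_list (dim x)) G L x) (last L))"
  have last: "law (last L x1) = iteration_end Q y h L x1 \<and> wf_sampler (last L x1)"
    if "L \<in> set_pmf (capped_geometric p h)" "dominated n y (dim x) (h - L) x1" for L x1
  proof (cases "L < h")
    case True
    have "G < n\<^sup>2" using set_capped_geometric(3)[OF that(1)[unfolded p_def] G True] .
    then have m: "law (multinomial Q (excess x1 y) (square_list (dim x1)) (n\<^sup>2 - G) 1 x1)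
          = draws Q (square (dim x1)) (excess x1 y) 1 x1 \<and>
        wf_sampler (multinomial Q (excess x1 y) (square_list (dim x1)) (n\<^sup>2 - G) 1 x1)"
      using law_multinomial[OF distinct_square_list, of "n\<^sup>2 - G" "excess x1 y" "dim x1" 1 Q x1]
        dominated_total(2)[OF assms(1) that(2) order_refl] by (simp add: set_square_list G_def)
    then show ?thesis using True
      by (auto simp: last_def law_bind iteration_end_def bind_assoc_pmf bind_return_pmf map_pmf_def intro!: wf_bind)
  qed (simp add: last_def iteration_end_def)
  have tail: "law (tail L) = draws Q (square (dim x)) (product_weight y) L x \<bind> iteration_end Q y h L \<and> wf_sampler (tail L)"
    if L: "L \<in> set_pmf (capped_geometric p h)" for L
  proof -
    note L' = set_capped_geometric[OF L[unfolded p_def] G]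
    have m: "law (multinomial Q (product_weight y) (square_list (dim x)) G L x) = draws Q (square (dim x)) (product_weight y) L x"
      "wf_sampler (multinomial Q (product_weight y) (square_list (dim x)) G L x)"
      using law_multinomial[OF distinct_square_list, of G "product_weight y" "dim x" L Q x] L'
      by (auto simp: set_square_list G_def total_def)
    have d: "dominated n y (dim x) (h - L) x1" if "x1 \<in> set_pmf (draws Q (square (dim x)) (product_weight y) L x)" for x1
      by (rule dominated_draws[OF dom _ _ that]) (use L' G_def in auto)
    have "law (tail L) = draws Q (square (dim x)) (product_weight y) L x \<bind> (\<lambda>x1. law (last L x1))"
      unfolding tail_def by (simp add: law_bind m)
    also have "\<dots> = draws Q (square (dim x)) (product_weight y) L x \<bind> iteration_end Q y h L"
      by (rule bind_pmf_cong[OF refl]) (use last[OF L d] in blast)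
    finally show ?thesis unfolding tail_def using m last[OF L d] by (auto intro!: wf_bind)
  qed
  have it: "iteration_sampler Q n s h x = Choose ((n\<^sup>2) ^ h) (\<lambda>W. tail (pk W))"
    unfolding iteration_sampler_def tail_def last_def pk_def Let_def G_def y_def by simp
  have "pk W \<in> set_pmf (capped_geometric p h)" if "W < (n\<^sup>2) ^ h" for W
  proof -
    have "W \<in> set_pmf (pmf_of_set {..<(n\<^sup>2) ^ h})" using that by (subst set_pmf_of_set) auto
    then show ?thesis unfolding geo[symmetric] by simp
  qed
  then show "wf_sampler (iteration_sampler Q n s h x)" unfolding it using tail assms(1) by simp
  have "law (iteration_sampler Q n s h x) = capped_geometric p h \<bind> (\<lambda>L. law (tail L))"
    unfolding it by (simp add: bind_map_pmf flip: geo)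
  also have "\<dots> = capped_geometric p h \<bind> (\<lambda>L. draws Q (square (dim x)) (product_weight y) L x \<bind> iteration_end Q y h L)"
    by (rule bind_pmf_cong[OF refl]) (use tail in blast)
  also have "\<dots> = iteration Q p y (dim x) h x" by (rule iteration_geometric)
  finally show "law (iteration_sampler Q n s h x) = iteration Q (real (total y (dim x)) / real (n\<^sup>2)) y (dim x) h x"
    by (simp add: p_def G_def)
qed

text \<open>The first argument of the recursion is fuel, which suffices if it is at least \<open>r\<close>. The last
  component accumulates the cost \<open>f (dim x)\<close> of the iterations.\<close>

primrec process_sampler :: "(nat \<Rightarrow> nat \<Rightarrow> nat) \<Rightarrow> nat \<Rightarrow> nat \<Rightarrow> (nat \<Rightarrow> nat) \<Rightarrow> nat \<Rightarrow> nat \<Rightarrow> counts \<Rightarrow> nat \<Rightarrow> (counts \<times> nat) sampler" where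
  "process_sampler Q n s f 0 r x t = Ret (x, t)"
| "process_sampler Q n s f (Suc i) r x t = (if r = 0 then Ret (x, t) else
     bind_sampler (iteration_sampler Q n s (min s r) x)
       (\<lambda>(l, x'). process_sampler Q n s f i (r - l) x' (t + f (dim x))))"

text \<open>By \<open>set_iteration\<close> every iteration makes at least one step, so
  \<open>r <= i\<close> survives the loss of one unit of fuel.\<close>

lemma law_process_sampler:
  assumes "0 < n" "valid n x" "r \<le> i" "0 < s"
  shows "map_pmf fst (law (process_sampler Q n s f i r x t)) = steps Q r x \<and> wf_sampler (process_sampler Q n s f i r x t)"
  using assms(2,3)
proof (induction i arbitrary: r x t)
  case (Suc i)
  show ?case
  proof (cases "r = 0")
    case False
    let ?h = "min s r" let ?y = "low s x"
    let ?I = "iteration Q (real (total ?y (dim x)) / real (n\<^sup>2)) ?y (dim x) ?h x"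
    note it = law_iteration_sampler[OF assms(1) Suc.prems(1), of ?h s Q]
    have dom: "dominated n ?y (dim x) ?h x" by (rule low_dominated[OF assms(1) Suc.prems(1)]) simp
    have IH: "map_pmf fst (law (process_sampler Q n s f i (r - l) x' (t + f (dim x)))) = steps Q (r - l) x' \<and>
        wf_sampler (process_sampler Q n s f i (r - l) x' (t + f (dim x)))" if "(l, x') \<in> set_pmf ?I" for l x'
      using set_iteration[OF assms(1) dom that] Suc.IH[of x' "r - l" "t + f (dim x)"] Suc.prems False assms(4) by auto
    have "map_pmf fst (law (process_sampler Q n s f (Suc i) r x t)) =
        ?I \<bind> (\<lambda>(l, x'). map_pmf fst (law (process_sampler Q n s f i (r - l) x' (t + f (dim x)))))"
      using False it by (simp add: law_bind map_bind_pmf case_prod_unfold)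
    also have "\<dots> = ?I \<bind> (\<lambda>(l, x'). steps Q (r - l) x')"
      by (rule bind_pmf_cong[OF refl]) (use IH in auto)
    also have "\<dots> = steps Q r x" by (rule steps_iteration[OF assms(1) dom]) simp
    finally show ?thesis using False it IH by (auto intro!: wf_bind)
  qed (simp add: )
qed simp

subsection \<open>The expected cost\<close>

text \<open>An exponential moment of the loads. It grows slowly in expectation whichever of the two
  bins \<open>Q\<close> prefers, and it dominates every power of the maximal load.\<close>

definition potential :: "counts \<Rightarrow> real" where
  "potential x = (\<Sum>a<dim x. 2 ^ a * real_of_int (x a))"

lemma potential_counts_of:
  assumes "0 < n"
  shows "potential (counts_of n N) = (\<Sum>i<n. 2 ^ N i)"
proof -
  let ?D = "dim (counts_of n N)"
  have "N i < ?D" if "i < n" for i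
    using counts_of_ge_dim[OF assms, of N "N i"] counts_of_gt[of n N "N i"] that
    by (metis less_irrefl not_le_imp_less)
  then have "N ` {..<n} \<subseteq> {..<?D}" by auto
  then have "(\<Sum>a<?D. \<Sum>i\<in>{i \<in> {..<n}. N i = a}. 2 ^ N i) = (\<Sum>i<n. (2::real) ^ N i)"
    by (intro sum.group) auto
  moreover have "(\<Sum>i\<in>{i \<in> {..<n}. N i = a}. (2::real) ^ N i) = 2 ^ a * real_of_int (counts_of n N a)" for a
    by (simp add: counts_of_def)
  ultimately show ?thesis unfolding potential_def by (simp only:)
qed

lemma valid_shift_cases:
  assumes "valid n x" "0 < x c"
  obtains N i where "x = counts_of n N" "i < n" "N i = c" "shift 1 c x = counts_of n (N(i := Suc (N i)))"
proof -
  obtain N where N: "x = counts_of n N" using assms by (auto simp: valid_def)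
  then obtain i where i: "i < n" "N i = c" using assms(2) by (auto simp: counts_of_gt)
  then show ?thesis using that[of N i] counts_of_upd[of i n N] N by simp
qed

lemma dim_shift:
  assumes "0 < n" "valid n x" "0 < x c"
  shows "dim x \<le> dim (shift 1 c x)" "dim (shift 1 c x) \<le> dim x + 1"
proof -
  obtain N i where N: "x = counts_of n N" "i < n" "N i = c" "shift 1 c x = counts_of n (N(i := Suc (N i)))"
    using valid_shift_cases[OF assms(2,3)] .
  define N' where "N' = N(i := Suc (N i))"
  have N': "N j \<le> N' j" "N' j \<le> Suc (N j)" for j by (auto simp: N'_def)
  have ne: "N ` {..<n} \<noteq> {}" "N' ` {..<n} \<noteq> {}" "finite (N ` {..<n})" "finite (N' ` {..<n})" using assms(1) by auto
  have "Max (N ` {..<n}) \<le> Max (N' ` {..<n})"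
    using N' ne by (subst Max_le_iff) (auto intro!: order_trans[OF N'(1) Max_ge])
  moreover have "Max (N' ` {..<n}) \<le> Suc (Max (N ` {..<n}))"
    using N' ne by (subst Max_le_iff) (auto intro!: order_trans[OF N'(2)] Suc_le_mono[THEN iffD2] Max_ge)
  ultimately show "dim x \<le> dim (shift 1 c x)" "dim (shift 1 c x) \<le> dim x + 1"
    unfolding N(4) unfolding N(1) using dim_counts_of[OF assms(1)] by (auto simp flip: N'_def)
qed

lemma potential_shift:
  assumes "0 < n" "valid n x" "0 < x c"
  shows "potential (shift 1 c x) = potential x + 2 ^ c"
proof -
  obtain N i where N: "x = counts_of n N" "i < n" "N i = c" "shift 1 c x = counts_of n (N(i := Suc (N i)))"
    using valid_shift_cases[OF assms(2,3)] .
  have "(\<Sum>j<n. 2 ^ (N(i := Suc (N i))) j) = (\<Sum>j<n. 2 ^ N j + (if j = i then 2 ^ N i else 0 :: real))"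
    by (intro sum.cong) auto
  also have "\<dots> = (\<Sum>j<n. 2 ^ N j) + 2 ^ N i" using N(2) by (simp add: sum.distrib)
  finally show ?thesis unfolding N(4) unfolding N(1) potential_counts_of[OF assms(1)] using N(3) by simp
qed

lemma potential_ge:
  assumes "0 < n" "valid n x"
  shows "2 ^ (dim x - 1) \<le> potential x" "1 \<le> dim x"
proof -
  obtain N where N: "x = counts_of n N" using assms by (auto simp: valid_def)
  have "Max (N ` {..<n}) \<in> N ` {..<n}" using assms by (intro Max_in) auto
  then obtain i where i: "i < n" "N i = Max (N ` {..<n})" by auto
  have "(2::real) ^ N i \<le> (\<Sum>i<n. 2 ^ N i)" using i by (intro member_le_sum) auto
  then show "2 ^ (dim x - 1) \<le> potential x" "1 \<le> dim x"
    unfolding N potential_counts_of[OF assms(1)] using dim_counts_of[OF assms(1), of N] i by auto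
qed

text \<open>A ball in a bin of load \<open>c\<close> adds \<open>2 ^ c\<close>. Whichever bin is
  chosen, this is at most the sum over both sampled bins, whose mean is \<open>2 / n\<close> times
  the potential.\<close>

lemma potential_kernel:
  assumes "0 < n" "valid n x" "0 \<le> a" "0 \<le> b"
  shows "(\<integral>\<^sup>+x'. ennreal (a + b * potential x') \<partial>kernel Q x) \<le> ennreal (a + b * ((1 + 2 / real n) * potential x))"
proof -
  obtain N where N: "x = counts_of n N" using assms by (auto simp: valid_def)
  let ?P = "potential x"
  have P: "?P = (\<Sum>i<n. 2 ^ N i)" by (simp add: N potential_counts_of[OF assms(1)])
  have ne: "{..<n} \<noteq> {}" using assms by auto
  have le: "potential (counts_of n (N(i := Suc (N i)))) \<le> ?P + 2 ^ N i1 + 2 ^ N i2"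
    if "i < n" "i = i1 \<or> i = i2" for i i1 i2
  proof -
    have "0 < counts_of n N (N i)" using that by (auto simp: counts_of_gt)
    then have "potential (shift 1 (N i) x) = ?P + 2 ^ N i" using potential_shift[OF assms(1,2)] by (simp add: N)
    moreover have "shift 1 (N i) x = counts_of n (N(i := Suc (N i)))" using counts_of_upd[OF that(1), of N] N by simp
    ultimately show ?thesis using that(2) by auto
  qed
  have "(\<integral>\<^sup>+x'. ennreal (a + b * potential x') \<partial>kernel Q x) =
      (\<integral>\<^sup>+i1. \<integral>\<^sup>+i2. ennreal (a + b * potential (counts_of n
        (let i = (if Q (N i1) (N i2) = 0 then i1 else i2) in N(i := Suc (N i))))) \<partial>pmf_of_set {..<n} \<partial>pmf_of_set {..<n})"
    by (simp add: N kernel_counts_of[OF assms(1)] two_sample_step_def Let_def)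
  also have "\<dots> \<le> (\<integral>\<^sup>+i1. \<integral>\<^sup>+i2. ennreal (a + b * (?P + 2 ^ N i1 + 2 ^ N i2)) \<partial>pmf_of_set {..<n} \<partial>pmf_of_set {..<n})"
  proof (intro nn_integral_mono_AE AE_pmfI)
    fix i1 i2 assume i1: "i1 \<in> set_pmf (pmf_of_set {..<n})" and i2: "i2 \<in> set_pmf (pmf_of_set {..<n})"
      have "potential (counts_of n (let i = (if Q (N i1) (N i2) = 0 then i1 else i2) in N(i := Suc (N i))))
          \<le> ?P + 2 ^ N i1 + 2 ^ N i2"
        unfolding Let_def by (rule le) (use i1 i2 ne in \<open>auto simp: set_pmf_of_set\<close>)
      then show "ennreal (a + b * potential (counts_of n (let i = (if Q (N i1) (N i2) = 0 then i1 else i2) in N(i := Suc (N i)))))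
        \<le> ennreal (a + b * (?P + 2 ^ N i1 + 2 ^ N i2))"
        by (intro ennreal_leI add_left_mono mult_left_mono assms)
  qed
  also have "\<dots> = ennreal (\<Sum>i1<n. (\<Sum>i2<n. a + b * (?P + 2 ^ N i1 + 2 ^ N i2)) / real n / real n)"
  proof -
    have P0: "0 \<le> ?P" unfolding P by (intro sum_nonneg) auto
    have nn: "0 \<le> a + b * (?P + 2 ^ N i1 + 2 ^ N i2)" for i1 i2
      using assms(3,4) P0 by (intro add_nonneg_nonneg mult_nonneg_nonneg) auto
    have avg: "(\<integral>\<^sup>+i. ennreal (g i) \<partial>pmf_of_set {..<n}) = ennreal ((\<Sum>i<n. g i) / real n)" if "\<And>i. 0 \<le> g i" for g :: "nat \<Rightarrow> real"
      using that assms(1) ne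
      by (subst nn_integral_pmf_of_set) (auto simp: sum_ennreal ennreal_of_nat_eq_real_of_nat divide_ennreal sum_nonneg)
    have "(\<integral>\<^sup>+i1. \<integral>\<^sup>+i2. ennreal (a + b * (?P + 2 ^ N i1 + 2 ^ N i2)) \<partial>pmf_of_set {..<n} \<partial>pmf_of_set {..<n})
      = (\<integral>\<^sup>+i1. ennreal ((\<Sum>i2<n. a + b * (?P + 2 ^ N i1 + 2 ^ N i2)) / real n) \<partial>pmf_of_set {..<n})"
      by (intro nn_integral_cong avg nn)
    also have "\<dots> = ennreal ((\<Sum>i1<n. (\<Sum>i2<n. a + b * (?P + 2 ^ N i1 + 2 ^ N i2)) / real n) / real n)"
      by (intro avg divide_nonneg_nonneg sum_nonneg nn) auto
    finally show ?thesis by (simp only: sum_divide_distrib)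
  qed
  also have "(\<Sum>i1<n. (\<Sum>i2<n. a + b * (?P + 2 ^ N i1 + 2 ^ N i2)) / real n / real n) = a + b * ((1 + 2 / real n) * ?P)"
  proof -
    have "(\<Sum>i2<n. a + b * (?P + 2 ^ N i1 + 2 ^ N i2)) = real n * (a + b * ?P) + real n * (b * 2 ^ N i1) + b * ?P" for i1
      by (simp add: sum.distrib distrib_left sum_distrib_left P)
    then have "(\<Sum>i1<n. (\<Sum>i2<n. a + b * (?P + 2 ^ N i1 + 2 ^ N i2)) / real n / real n) =
        (\<Sum>i1<n. (real n * (a + b * ?P) + real n * (b * 2 ^ N i1) + b * ?P)) / real n / real n"
      by (simp only: sum_divide_distrib)
    also have "(\<Sum>i1<n. (real n * (a + b * ?P) + real n * (b * 2 ^ N i1) + b * ?P)) = real n * (real n * (a + b * ?P)) + real n * (b * ?P) + real n * (b * ?P)"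
      by (simp add: sum.distrib sum_distrib_left P)
    also have "\<dots> / real n / real n = a + b * ((1 + 2 / real n) * ?P)" using assms(1) by (simp add: field_simps)
    finally show ?thesis .
  qed
  finally show ?thesis .
qed

text \<open>Truncation removes at most \<open>s\<close> from each of \<open>dim x\<close> counts, so
  the sum \<open>g\<close> of \<open>low s x\<close> satisfies \<open>n - g <= s * dim x\<close>;
  moreover \<open>n ^ 2 - g ^ 2 <= 2 * n * (n - g)\<close>.\<close>

lemma total_low_bound:
  assumes "0 < n" "valid n x"
  shows "1 - real (total (low s x) (dim x)) / real (n\<^sup>2) \<le> 2 * real s * real (dim x) / real n"
proof -
  define g where "g = (\<Sum>a<dim x. low s x a)"
  have g: "int (total (low s x) (dim x)) = g\<^sup>2" unfolding g_def by (rule total_eq) (simp add: low_def)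
  have "(\<Sum>a<dim x. x a - int s) \<le> g" unfolding g_def by (intro sum_mono) (simp add: low_def)
  moreover have "(\<Sum>a<dim x. x a) = int n" using assms sum_counts_of[OF assms(1)] by (auto simp: valid_def)
  ultimately have "int n - int (dim x) * int s \<le> g" by (simp add: sum_subtractf)
  then have "real_of_int (int n - int (dim x) * int s) \<le> real_of_int g" by (simp only: of_int_le_iff)
  then have 1: "real n - real_of_int g \<le> real (dim x) * real s" by simp
  have "real (total (low s x) (dim x)) = real_of_int (int (total (low s x) (dim x)))" by simp
  also have "\<dots> = (real_of_int g)\<^sup>2" unfolding g by simp
  finally have 2: "real (total (low s x) (dim x)) = (real_of_int g)\<^sup>2" .
  have "0 \<le> (real n - real_of_int g)\<^sup>2" by simp
  then have "(real n)\<^sup>2 - (real_of_int g)\<^sup>2 \<le> 2 * real n * (real n - real_of_int g)"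
    by (simp add: power2_eq_square algebra_simps)
  also have "\<dots> \<le> 2 * real n * (real (dim x) * real s)" using 1 by (intro mult_left_mono) auto
  finally have "((real n)\<^sup>2 - (real_of_int g)\<^sup>2) / (real n)\<^sup>2 \<le> 2 * real n * (real (dim x) * real s) / (real n)\<^sup>2"
    by (intro divide_right_mono) auto
  then show ?thesis unfolding 2 using assms(1) by (simp add: diff_divide_distrib power2_eq_square mult_ac)
qed

text \<open>\<open>f\<close> gives the cost of an iteration in terms of \<open>dim\<close>. In
  \<open>f_bound\<close>, the factor \<open>2 * dim x\<close> comes from the probability of an early
  end in \<open>total_low_bound\<close>, and \<open>dim x + 1\<close> bounds the dimension after the
  step that ends the iteration.\<close>

locale cost_potential =
  fixes n s :: nat and f :: "nat \<Rightarrow> nat" and \<alpha> \<beta> :: real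
  assumes n: "0 < n" and s: "0 < s" and nonneg: "0 \<le> \<alpha>" "0 \<le> \<beta>" and f_mono: "mono f"
    and f_bound: "\<And>x. valid n x \<Longrightarrow> 2 * real (dim x) * real (f (dim x + 1)) \<le> \<alpha> + \<beta> * potential x"
begin

text \<open>Bounds the expectation of \<open>\<alpha> + \<beta> * potential\<close> after
  \<open>r\<close> more steps. With \<open>r\<close> counted down it is a supermartingale
  (\<open>kernel_rate\<close>).\<close>

definition rate :: "nat \<Rightarrow> counts \<Rightarrow> real" where
  "rate r x = \<alpha> + \<beta> * ((1 + 2 / real n) ^ r * potential x)"

text \<open>\<open>1 / s\<close> saves for the iteration that follows a cut-off after
  \<open>s\<close> steps; \<open>s / n\<close> pays for an early end, the factor
  \<open>2 * dim x\<close> of its probability being part of \<open>f_bound\<close>.\<close>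

definition per_step :: real where
  "per_step = 1 / real s + real s / real n"

lemma per_step_nonneg: "0 \<le> per_step"
  by (simp add: per_step_def)

lemma potential_nonneg: "valid n x \<Longrightarrow> 0 \<le> potential x"
  by (rule order_trans[OF _ potential_ge(1)[OF n]]) auto

lemma rate_ge: "valid n x \<Longrightarrow> \<alpha> + \<beta> * potential x \<le> rate r x"
  unfolding rate_def
  by (intro add_left_mono mult_left_mono nonneg) (use potential_nonneg mult_right_mono[of 1 "(1 + 2 / real n) ^ r"] in auto)

lemma rate_nonneg: "valid n x \<Longrightarrow> 0 \<le> rate r x"
  by (rule order_trans[OF _ rate_ge]) (auto intro!: add_nonneg_nonneg mult_nonneg_nonneg nonneg potential_nonneg)

lemma f_le_rate: "valid n x \<Longrightarrow> 2 * real (dim x) * real (f (dim x + 1)) \<le> rate r x"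
  by (rule order_trans[OF f_bound rate_ge])

lemma f_le_rate': 
  assumes "valid n x" shows "real (f (dim x)) \<le> rate r x"
proof -
  have "f (dim x) \<le> f (dim x + 1)" by (intro monoD[OF f_mono]) simp
  also have "\<dots> \<le> 2 * dim x * f (dim x + 1)" using potential_ge(2)[OF n assms] by simp
  finally have "real (f (dim x)) \<le> 2 * real (dim x) * real (f (dim x + 1))"
    by (metis of_nat_le_iff of_nat_mult of_nat_numeral)
  then show ?thesis using f_le_rate[OF assms, of r] by linarith
qed

lemma kernel_rate:
  assumes "valid n x" "0 \<le> c"
  shows "(\<integral>\<^sup>+x'. ennreal (c * rate r x') \<partial>kernel Q x) \<le> ennreal (c * rate (Suc r) x)"
proof -
  have "(\<integral>\<^sup>+x'. ennreal (c * \<alpha> + (c * \<beta> * (1 + 2 / real n) ^ r) * potential x') \<partial>kernel Q x)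
      \<le> ennreal (c * \<alpha> + (c * \<beta> * (1 + 2 / real n) ^ r) * ((1 + 2 / real n) * potential x))"
    using nonneg assms by (intro potential_kernel n) auto
  then show ?thesis by (simp add: rate_def algebra_simps)
qed

text \<open>Bounds the expected cost of the rest when an iteration is about to start with
  \<open>r\<close> steps to go.\<close>

definition budget :: "nat \<Rightarrow> counts \<Rightarrow> real" where
  "budget r x = (if r = 0 then 0 else real (f (dim x)) + real r * per_step * rate r x)"

text \<open>For \<open>h = r\<close> the process is over when the cap is reached and no further
  iteration has to be financed. As the cap is \<open>min s r\<close>, the slack is 0 at the start of
  every iteration.\<close>

definition slack :: "nat \<Rightarrow> nat \<Rightarrow> real" where
  "slack h r = (if h = r then 0 else (real s - real h) / real s)"

text \<open>In an iteration of which \<open>h\<close> steps are left, the cost of the next iteration has been saved up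
  to the fraction \<open>slack h r\<close>.\<close>

lemma iteration_budget:
  assumes p: "p = real (total y D) / real (n\<^sup>2)" "1 - p \<le> 2 * real s * real D / real n"
    and "dominated n y D h x" "D \<le> dim x" "h \<le> r" "h \<le> s"
  shows "(\<integral>\<^sup>+(l, x'). ennreal (budget (r - l) x') \<partial>iteration Q p y D h x)
    \<le> ennreal ((real r * per_step + slack h r) * rate r x)"
  using assms(3-)
proof (induction h arbitrary: x r)
  case 0
  then have v: "valid n x" by (simp add: dominated_def)
  have "budget r x \<le> (real r * per_step + slack 0 r) * rate r x"
    using s f_le_rate'[OF v, of r] by (auto simp: budget_def slack_def algebra_simps)
  then show ?case by (simp add: ennreal_leI)
next
  case (Suc h)
  obtain R where R: "r = Suc R" "h \<le> R" using Suc.prems by (cases r) auto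
  have v: "valid n x" using Suc.prems by (simp add: dominated_def)
  have t: "total y D \<le> n\<^sup>2" "0 < n\<^sup>2" using dominated_total(3)[OF n Suc.prems(1) order_refl] n by auto
  have p01: "0 \<le> p" "p \<le> 1" using t p(1) by auto
  define c where "c = real R * per_step + slack h R"
  have c0: "0 \<le> c" unfolding c_def slack_def using per_step_nonneg Suc.prems s by auto
  \<comment> \<open>Charge for the next iteration if the present one ends with this step; the step
    raises the dimension by at most 1.\<close>
  define e where "e = real (f (dim x + 1))"
  let ?w = "\<lambda>b. if b then weighted_pmf (square D) (product_weight y) else weighted_pmf (square (dim x)) (excess x y)"
  have "(\<integral>\<^sup>+(l, x'). ennreal (budget (r - l) x') \<partial>iteration Q p y D (Suc h) x) \<le>
      (\<integral>\<^sup>+b. \<integral>\<^sup>+k. ennreal (c * rate R (shift 1 (chosen Q k) x)) + ennreal (of_bool (\<not> b) * e) \<partial>?w b \<partial>bernoulli_pmf p)"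
    unfolding iteration.simps nn_integral_bind_pmf
  proof (intro nn_integral_mono_AE AE_pmfI)
    fix b assume b: "b \<in> set_pmf (bernoulli_pmf p)"
    show "(\<integral>\<^sup>+(l, x'). ennreal (budget (r - l) x') \<partial>(if b then weighted_pmf (square D) (product_weight y) \<bind> (\<lambda>k.
         map_pmf (apfst Suc) (iteration Q p y D h (shift 1 (chosen Q k) x)))
       else map_pmf (\<lambda>k. (1, shift 1 (chosen Q k) x)) (weighted_pmf (square (dim x)) (excess x y))))
      \<le> (\<integral>\<^sup>+k. ennreal (c * rate R (shift 1 (chosen Q k) x)) + ennreal (of_bool (\<not> b) * e) \<partial>?w b)"
    proof (cases b)
      case True
      have "(\<integral>\<^sup>+k. \<integral>\<^sup>+(l, x'). ennreal (budget (R - l) x') \<partial>iteration Q p y D h (shift 1 (chosen Q k) x)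
          \<partial>weighted_pmf (square D) (product_weight y))
        \<le> (\<integral>\<^sup>+k. ennreal (c * rate R (shift 1 (chosen Q k) x)) \<partial>weighted_pmf (square D) (product_weight y))"
      proof (intro nn_integral_mono_AE AE_pmfI)
        fix k assume k: "k \<in> set_pmf (weighted_pmf (square D) (product_weight y))"
        have t0: "0 < total y D" using bernoulli_True(1)[OF b[unfolded p(1)] t True] .
        have d: "dominated n y D h (shift 1 (chosen Q k) x)" by (rule dominated_step[OF Suc.prems(1) t0 k])
        have "0 < product_weight y k" using k t0 by (auto simp: set_weighted_pmf total_def)
        then have "0 < y (chosen Q k)" using Suc.prems(1) by (intro positive_product) (auto simp: dominated_def)
        then have "0 < x (chosen Q k)" using dominated_le[OF Suc.prems(1), of "chosen Q k"] by simp
        then have "D \<le> dim (shift 1 (chosen Q k) x)" using dim_shift(1)[OF n v] Suc.prems(2) order_trans by blast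
        from Suc.IH[OF d this R(2)] Suc.prems(4)
        show "(\<integral>\<^sup>+(l, x'). ennreal (budget (R - l) x') \<partial>iteration Q p y D h (shift 1 (chosen Q k) x))
          \<le> ennreal (c * rate R (shift 1 (chosen Q k) x))" by (simp add: c_def)
      qed
      then show ?thesis using True by (simp add: case_prod_unfold R)
    next
      case False
      have "(\<integral>\<^sup>+k. ennreal (budget R (shift 1 (chosen Q k) x)) \<partial>weighted_pmf (square (dim x)) (excess x y))
        \<le> (\<integral>\<^sup>+k. ennreal (c * rate R (shift 1 (chosen Q k) x)) + ennreal e \<partial>weighted_pmf (square (dim x)) (excess x y))"
      proof (intro nn_integral_mono_AE AE_pmfI)
        fix k assume k: "k \<in> set_pmf (weighted_pmf (square (dim x)) (excess x y))"
        note vk = valid_excess[OF n Suc.prems(1) bernoulli_True(2)[OF b[unfolded p(1)] t False] k]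
        have "f (dim (shift 1 (chosen Q k) x)) \<le> f (dim x + 1)"
          using dim_shift(2)[OF n v vk(2)] by (intro monoD[OF f_mono])
        then have "budget R (shift 1 (chosen Q k) x) \<le> real R * per_step * rate R (shift 1 (chosen Q k) x) + e"
          using rate_nonneg[OF vk(1), of R] per_step_nonneg by (auto simp: budget_def e_def)
        also have "\<dots> \<le> c * rate R (shift 1 (chosen Q k) x) + e"
          unfolding c_def using rate_nonneg[OF vk(1), of R] Suc.prems s
          by (intro add_right_mono mult_right_mono) (auto simp: slack_def)
        finally have "ennreal (budget R (shift 1 (chosen Q k) x)) \<le> ennreal (c * rate R (shift 1 (chosen Q k) x) + e)"
          by (rule ennreal_leI)
        also have "\<dots> = ennreal (c * rate R (shift 1 (chosen Q k) x)) + ennreal e"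
          using rate_nonneg[OF vk(1), of R] c0 by (intro ennreal_plus) (auto simp: e_def)
        finally show "ennreal (budget R (shift 1 (chosen Q k) x)) \<le> ennreal (c * rate R (shift 1 (chosen Q k) x)) + ennreal e" .
      qed
      then show ?thesis using False by (simp add: R)
    qed
  qed
  also have "\<dots> = (\<integral>\<^sup>+b. \<integral>\<^sup>+k. ennreal (c * rate R (shift 1 (chosen Q k) x)) \<partial>?w b \<partial>bernoulli_pmf p)
      + (\<integral>\<^sup>+b. ennreal (of_bool (\<not> b) * e) \<partial>bernoulli_pmf p)"
  proof -
    have "(\<integral>\<^sup>+k. ennreal (c * rate R (shift 1 (chosen Q k) x)) + ennreal (of_bool (\<not> b) * e) \<partial>?w b)
      = (\<integral>\<^sup>+k. ennreal (c * rate R (shift 1 (chosen Q k) x)) \<partial>?w b) + ennreal (of_bool (\<not> b) * e)" for b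
      by (subst nn_integral_add) auto
    then show ?thesis by (simp only:) (rule nn_integral_add, auto)
  qed
  \<comment> \<open>Charged in this way, the integrand is the same function of the new counts for
    both kinds of steps, so the two branches recombine into one step of the chain.\<close>
  also have "(\<integral>\<^sup>+b. \<integral>\<^sup>+k. ennreal (c * rate R (shift 1 (chosen Q k) x)) \<partial>?w b \<partial>bernoulli_pmf p)
      = (\<integral>\<^sup>+x'. ennreal (c * rate R x') \<partial>kernel Q x)"
    unfolding kernel_mixture[OF n Suc.prems(1) p(1), of Q] nn_integral_bind_pmf nn_integral_map_pmf ..
  also have "(\<integral>\<^sup>+b. ennreal (of_bool (\<not> b) * e) \<partial>bernoulli_pmf p) = ennreal ((1 - p) * e)"
    using p01 by (simp add: ennreal_mult'[symmetric] e_def mult.commute)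
  also have "(\<integral>\<^sup>+x'. ennreal (c * rate R x') \<partial>kernel Q x) + ennreal ((1 - p) * e)
      \<le> ennreal (c * rate r x) + ennreal (real s / real n * rate r x)"
  proof (rule add_mono)
    show "(\<integral>\<^sup>+x'. ennreal (c * rate R x') \<partial>kernel Q x) \<le> ennreal (c * rate r x)"
      unfolding R by (rule kernel_rate[OF v c0])
    \<comment> \<open>An early end has probability at most \<open>2 * s * D / n\<close>; the factor
      \<open>2 * D\<close> is the one provided for in \<open>f_bound\<close>.\<close>
    have "(1 - p) * e \<le> (2 * real s * real D / real n) * e" using p(2) by (intro mult_right_mono) (auto simp: e_def)
    also have "\<dots> \<le> (2 * real s * real (dim x) / real n) * e"
      using Suc.prems(2) by (intro mult_right_mono divide_right_mono mult_left_mono) (auto simp: e_def)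
    also have "\<dots> = real s / real n * (2 * real (dim x) * real (f (dim x + 1)))" by (simp add: e_def)
    also have "\<dots> \<le> real s / real n * rate r x" by (intro mult_left_mono f_le_rate v) auto
    finally show "ennreal ((1 - p) * e) \<le> ennreal (real s / real n * rate r x)" by (rule ennreal_leI)
  qed
  also have "\<dots> = ennreal ((c + real s / real n) * rate r x)"
    using rate_nonneg[OF v] c0 by (simp add: distrib_right flip: ennreal_plus)
  also have "\<dots> \<le> ennreal ((real r * per_step + slack (Suc h) r) * rate r x)"
  proof (intro ennreal_leI mult_right_mono rate_nonneg[OF v])
    \<comment> \<open>Each step of an iteration saves a further \<open>1 / s\<close> of the cost of
      the next one.\<close>
    have "slack h R \<le> slack (Suc h) r + 1 / real s" using s by (auto simp: slack_def R field_simps)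
    then show "c + real s / real n \<le> real r * per_step + slack (Suc h) r"
      by (simp add: c_def R per_step_def distrib_right)
  qed
  finally show ?case .
qed

lemma process_sampler_budget:
  assumes "valid n x" "r \<le> i"
  shows "(\<integral>\<^sup>+(x', t'). of_nat t' \<partial>law (process_sampler Q n s f i r x t)) \<le> of_nat t + ennreal (budget r x)"
  using assms
proof (induction i arbitrary: r x t)
  case (Suc i)
  show ?case
  proof (cases "r = 0")
    case False
    let ?h = "min s r" let ?y = "low s x" let ?p = "real (total (low s x) (dim x)) / real (n\<^sup>2)"
    let ?I = "iteration Q ?p ?y (dim x) ?h x"
    note it = law_iteration_sampler[OF n Suc.prems(1), of ?h s Q]
    have dom: "dominated n ?y (dim x) ?h x" by (rule low_dominated[OF n Suc.prems(1)]) simp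
    have "(\<integral>\<^sup>+(x', t'). of_nat t' \<partial>law (process_sampler Q n s f (Suc i) r x t)) =
      (\<integral>\<^sup>+(l, x'). \<integral>\<^sup>+(x'', t'). of_nat t' \<partial>law (process_sampler Q n s f i (r - l) x' (t + f (dim x))) \<partial>?I)"
      using False it by (simp add: law_bind case_prod_unfold)
    also have "\<dots> \<le> (\<integral>\<^sup>+(l, x'). of_nat (t + f (dim x)) + ennreal (budget (r - l) x') \<partial>?I)"
    proof (intro nn_integral_mono_AE AE_pmfI)
      fix z assume z: "z \<in> set_pmf ?I"
      obtain l x' where lx: "z = (l, x')" by (cases z)
      have "valid n x'" "r - l \<le> i"
        using set_iteration[OF n dom z[unfolded lx]] Suc.prems(2) False s by auto
      from Suc.IH[OF this, of "t + f (dim x)"]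
      show "(case z of (l, x') \<Rightarrow> \<integral>\<^sup>+(x'', t'). of_nat t' \<partial>law (process_sampler Q n s f i (r - l) x' (t + f (dim x))))
        \<le> (case z of (l, x') \<Rightarrow> of_nat (t + f (dim x)) + ennreal (budget (r - l) x'))"
        by (simp add: lx)
    qed
    also have "\<dots> = of_nat (t + f (dim x)) + (\<integral>\<^sup>+(l, x'). ennreal (budget (r - l) x') \<partial>?I)"
      by (simp add: case_prod_unfold nn_integral_add)
    also have "\<dots> \<le> of_nat (t + f (dim x)) + ennreal ((real r * per_step + slack ?h r) * rate r x)"
      by (intro add_left_mono iteration_budget[OF refl total_low_bound[OF n Suc.prems(1)] dom]) auto
    also have "slack ?h r = 0" using s by (auto simp: slack_def min_def)
    also have "of_nat (t + f (dim x)) + ennreal ((real r * per_step + 0) * rate r x) = of_nat t + ennreal (budget r x)"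
      using False rate_nonneg[OF Suc.prems(1)] per_step_nonneg
      by (simp add: budget_def ennreal_of_nat_eq_real_of_nat add.assoc flip: ennreal_plus)
    finally show ?thesis .
  qed simp
qed simp

text \<open>For \<open>m <= n * ln n\<close> the growth factor is at most
  \<open>exp (2 * ln n) = n ^ 2\<close>, and the potential starts at \<open>n\<close>; this is the
  origin of \<open>n ^ 3\<close>.\<close>

lemma expected_cost:
  assumes "real m \<le> real n * ln (real n)" "2 \<le> n"
  shows "(\<integral>\<^sup>+(x', t'). of_nat t' \<partial>law (process_sampler Q n s f m m (counts_of n (\<lambda>_. 0)) 0))
    \<le> ennreal ((1 + real m * per_step) * (\<alpha> + \<beta> * real n ^ 3))"
proof -
  let ?x = "counts_of n (\<lambda>_. 0)"
  have v: "valid n ?x" by (auto simp: valid_def)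
  have "(1 + 2 / real n) ^ m \<le> exp (2 / real n) ^ m"
    by (intro power_mono exp_ge_add_one_self) auto
  also have "\<dots> = exp (real m * (2 / real n))" by (simp only: exp_of_nat_mult)
  also have "\<dots> \<le> exp (2 * ln (real n))" using assms n by (simp add: field_simps)
  also have "\<dots> = real n ^ 2" using n by (simp add: exp_double)
  finally have "(1 + 2 / real n) ^ m * potential ?x \<le> real n ^ 2 * potential ?x"
    using potential_nonneg[OF v] by (intro mult_right_mono) auto
  moreover have "potential ?x = real n" by (simp add: potential_counts_of[OF n])
  ultimately have "rate m ?x \<le> \<alpha> + \<beta> * real n ^ 3"
    unfolding rate_def by (intro add_left_mono mult_left_mono nonneg) (simp add: power2_eq_square power3_eq_cube)
  moreover have "budget m ?x \<le> (1 + real m * per_step) * rate m ?x"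
    using f_le_rate'[OF v, of m] rate_nonneg[OF v, of m] per_step_nonneg by (auto simp: budget_def distrib_right)
  ultimately have "budget m ?x \<le> (1 + real m * per_step) * (\<alpha> + \<beta> * real n ^ 3)"
    using per_step_nonneg by (smt (verit) mult_left_mono mult_nonneg_nonneg of_nat_0_le_iff)
  then show ?thesis using process_sampler_budget[OF v order_refl, of Q m 0]
    by (simp add: order_trans ennreal_leI)
qed

end

subsection \<open>The sampling subroutine\<close>

lemma sum_digits_less:
  fixes B :: "nat \<Rightarrow> nat"
  assumes "\<And>j. j < i \<Longrightarrow> B j < X"
  shows "(\<Sum>j<i. B j * X ^ j) < X ^ i"
  using assms
proof (induction i)
  case (Suc i)
  have "(\<Sum>j<i. B j * X ^ j) < X ^ i" using Suc by simp
  moreover have "Suc (B i) * X ^ i \<le> X * X ^ i" using Suc.prems[of i] by (intro mult_le_mono1) simp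
  ultimately show ?case by simp
qed simp

text \<open>\<open>N + 2\<close> is the least base for which all prefix sums, being at most
  \<open>N\<close>, are determined by their residues modulo the base minus 1.\<close>

lemma sum_digits_mod:
  fixes B :: "nat \<Rightarrow> nat"
  assumes "(\<Sum>j\<le>h. B j) = N" "i \<le> h"
  shows "(\<Sum>j\<le>h. B j * (N + 2) ^ j) mod (N + 2) ^ i mod (N + 1) = (\<Sum>j<i. B j)"
proof -
  have "B j \<le> N" if "j \<le> h" for j
    unfolding assms(1)[symmetric] using that by (intro member_le_sum) auto
  then have less: "(\<Sum>j<i. B j * (N + 2) ^ j) < (N + 2) ^ i"
    using assms(2) by (intro sum_digits_less) (simp add: le_imp_less_Suc less_SucI)
  have "{..h} = {..<i} \<union> {i..h}" using assms(2) by auto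
  then have "(\<Sum>j\<le>h. B j * (N + 2) ^ j) = (\<Sum>j<i. B j * (N + 2) ^ j) + (\<Sum>j=i..h. B j * (N + 2) ^ j)"
    by (simp only:) (rule sum.union_disjoint, auto)
  also have "(\<Sum>j=i..h. B j * (N + 2) ^ j) = (N + 2) ^ i * (\<Sum>j=i..h. B j * (N + 2) ^ (j - i))"
    unfolding sum_distrib_left by (rule sum.cong) (auto simp flip: power_add)
  finally have 1: "(\<Sum>j\<le>h. B j * (N + 2) ^ j) mod (N + 2) ^ i = (\<Sum>j<i. B j * (N + 2) ^ j)"
    using less by simp
  have pow: "\<exists>c. (N + 2) ^ j = (N + 1) * c + 1" for j
  proof (induction j)
    case (Suc j)
    then obtain c where c: "(N + 2) ^ j = (N + 1) * c + 1" by blast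
    have "(N + 2) ^ Suc j = (N + 1) * (c * (N + 2) + 1) + 1" unfolding power_Suc c by (simp add: algebra_simps)
    then show ?case by blast
  qed (auto intro: exI[of _ 0])
  have "\<exists>C. (\<Sum>j<i. B j * (N + 2) ^ j) = (N + 1) * C + (\<Sum>j<i. B j)"
  proof (induction i)
    case (Suc i)
    obtain C c where C: "(\<Sum>j<i. B j * (N + 2) ^ j) = (N + 1) * C + (\<Sum>j<i. B j)" and c: "(N + 2) ^ i = (N + 1) * c + 1"
      using Suc pow by blast
    have "(\<Sum>j<Suc i. B j * (N + 2) ^ j) = (N + 1) * (C + B i * c) + (\<Sum>j<Suc i. B j)"
      by (simp only: sum.lessThan_Suc C c) (simp add: algebra_simps)
    then show ?case by blast
  qed (auto intro: exI[of _ 0])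
  then obtain C where C: "(\<Sum>j<i. B j * (N + 2) ^ j) = (N + 1) * C + (\<Sum>j<i. B j)" by blast
  have "(\<Sum>j<i. B j) \<le> (\<Sum>j\<le>h. B j)" using assms(2) by (intro sum_mono2) auto
  then have "(\<Sum>j<i. B j) < N + 1" using assms(1) by simp
  then show ?thesis unfolding 1 C by (simp only: mod_mult_self4 mod_less)
qed

lemma real_mod: "0 < b \<Longrightarrow> real a - of_int \<lfloor>real a / real b\<rfloor> * real b = real (a mod b)"
  using floor_divide_of_nat_eq[of a b, where 'a = real] by (metis add_diff_cancel_left' div_mult_mod_eq
    of_int_of_nat_eq of_nat_add of_nat_mult)

text \<open>With \<open>X = N + 2\<close>, the digits of \<open>F = (\<Sum>j\<le>h. B j * X ^ j)\<close> in base \<open>X\<close> are the weights, and \<open>F mod X ^ j\<close>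
  keeps the first \<open>j\<close> of them; reduction modulo \<open>X - 1\<close> adds them up, as \<open>X\<close> is 1 modulo \<open>X - 1\<close>. The
  registers 2 to 6 hold \<open>u\<close>, \<open>N\<close>, \<open>X\<close>, \<open>F\<close>, \<open>h\<close>; the bisection keeps its bounds in 7 and 8 and leaves the
  result in 7.\<close>

definition sample_init :: "instr list" where
  "sample_init = [Binary Mul 2 2 3, Unary Floor 10 2, Binary Sub 2 2 10, Move 7 15, Move 8 6]"

definition sample_test :: "instr list" where
  "sample_test = [Binary Add 9 7 8, Binary Add 9 9 13, Binary Div 9 9 14, Unary Floor 9 9,
     Binary Powr 12 4 9, Binary Div 11 5 12, Unary Floor 11 11, Binary Mul 11 11 12, Binary Sub 11 5 11,
     Binary Sub 12 4 13, Binary Div 38 11 12, Unary Floor 38 38, Binary Mul 38 38 12, Binary Sub 11 11 38]"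

definition sample_code :: "stmt list" where
  "sample_code = map Basic sample_init @
     [Loop Lt 7 8 (map Basic sample_test @ [Branch Le 11 10 [Basic (Move 7 9)] [Basic (Binary Sub 8 9 13)]])]"

definition sample_cells :: "nat set" where
  "sample_cells = {2, 7, 8, 9, 10, 11, 12, 38}"

definition constants :: "(nat \<Rightarrow> real) \<Rightarrow> bool" where
  "constants M \<longleftrightarrow> M 13 = 1 \<and> M 14 = 2 \<and> M 15 = 0"

locale bounded_queries =
  fixes Q cost :: "nat \<Rightarrow> nat \<Rightarrow> nat" and q :: nat
  assumes cost_le: "\<And>a b. cost a b \<le> q"
begin

text \<open>Time in units of \<open>1 + q\<close>, the maximal cost of a single instruction, so that
  the bounds become instruction counts.\<close>

abbreviation wpc where "wpc A c P M \<equiv> wp Q cost A (c * (1 + q)) P M"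

lemma wpc_line:
  assumes "list_all (\<lambda>i. \<not> reads_tape i) is" "wpc A c P (fold (upd Q) is M)" "length is + c \<le> c'"
  shows "wpc (map Basic is @ A) c' P M"
proof (rule wp_mono[OF wp_line[where cost = cost, OF cost_le assms(1,2)]])
  have "(length is + c) * (1 + q) \<le> c' * (1 + q)" using assms(3) by (rule mult_le_mono1)
  then show "c * (1 + q) + length is * (1 + q) \<le> c' * (1 + q)" by (simp add: algebra_simps)
qed

lemma wpc_line_only:
  assumes "list_all (\<lambda>i. \<not> reads_tape i) is" "P (fold (upd Q) is M)" "length is \<le> c'"
  shows "wpc (map Basic is) c' P M"
  using wpc_line[of "is" "[]" 0 P M c'] assms by (simp add: wp_Nil)

lemma wpc_append:
  assumes "wpc A c (\<lambda>M'. wpc A' c' P M') M" "c + c' \<le> d"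
  shows "wpc (A @ A') d P M"
proof (rule wp_mono[OF wp_append[OF assms(1)]])
  have "(c + c') * (1 + q) \<le> d * (1 + q)" using assms(2) by (rule mult_le_mono1)
  then show "c * (1 + q) + c' * (1 + q) \<le> d * (1 + q)" by (simp only: distrib_right)
qed

lemma wpc_Branch:
  assumes "wpc ((if cmp_val r (M x) (M y) then A else B) @ k) c P M" "c + 1 \<le> d"
  shows "wpc (Branch r x y A B # k) d P M"
proof (rule wp_mono[OF wp_Branch[OF assms(1)]])
  have "(c + 1) * (1 + q) \<le> d * (1 + q)" using assms(2) by (rule mult_le_mono1)
  then show "c * (1 + q) + 1 \<le> d * (1 + q)" by simp
qed

lemma wpc_while:
  fixes I :: "'a \<Rightarrow> (nat \<Rightarrow> real) \<Rightarrow> bool" and T :: "'a \<Rightarrow> nat"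
  assumes "wf R" "I a M"
    and body: "\<And>a M. I a M \<Longrightarrow> cmp_val r (M x) (M y) \<Longrightarrow>
      \<exists>b c. (b, a) \<in> R \<and> c + 1 + T b \<le> T a \<and> wpc A c (I b) M"
    and exit: "\<And>a M. I a M \<Longrightarrow> \<not> cmp_val r (M x) (M y) \<Longrightarrow> 1 \<le> T a \<and> P M"
  shows "wpc [Loop r x y A] (T a) P M"
proof (rule wp_while[OF assms(1), where T = "\<lambda>a. T a * (1 + q)" and I = I])
  fix a M assume "I a M" "cmp_val r (M x) (M y)"
  from body[OF this] obtain b c where b: "(b, a) \<in> R" "c + 1 + T b \<le> T a" "wpc A c (I b) M" by blast
  have "(c + 1 + T b) * (1 + q) \<le> T a * (1 + q)" using b(2) by (rule mult_le_mono1)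
  then have "c * (1 + q) + 1 + T b * (1 + q) \<le> T a * (1 + q)" by (simp add: algebra_simps)
  with b show "\<exists>b c. (b, a) \<in> R \<and> c + 1 + T b * (1 + q) \<le> T a * (1 + q) \<and> wp Q cost A c (I b) M" by blast
next
  fix a M assume "I a M" "\<not> cmp_val r (M x) (M y)"
  from exit[OF this] show "1 \<le> T a * (1 + q) \<and> P M" by simp
qed fact

lemma wpc_mono: "wpc A c P M \<Longrightarrow> (\<And>M'. P M' \<Longrightarrow> P' M') \<Longrightarrow> c \<le> c' \<Longrightarrow> wpc A c' P' M"
  by (erule wp_mono, blast, rule mult_le_mono1)

text \<open>A round of the bisection takes 17 units: the loop test, the 14 instructions of
  \<open>sample_test\<close>, the branch and one update. Cell 2 keeps the fractional part as the
  variate for later choices.\<close>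

lemma wp_sample:
  assumes "constants M" "M 3 = real N" "M 4 = real (N + 2)" "M 5 = real (\<Sum>j\<le>h. B j * (N + 2) ^ j)" "M 6 = real h"
    and "(\<Sum>j\<le>h. B j) = N" "0 \<le> M 2" "h < 2 ^ k"
  shows "wpc sample_code (17 * k + 6) (\<lambda>M'. M' 2 = frac (M 2 * real N) \<and>
     M' 7 = real (pick B h (nat \<lfloor>M 2 * real N\<rfloor>)) \<and> (\<forall>i. i \<notin> sample_cells \<longrightarrow> M' i = M i)) M"
proof -
  define W where "W = nat \<lfloor>M 2 * real N\<rfloor>"
  have W: "of_int \<lfloor>M 2 * real N\<rfloor> = real W" using assms(7) by (simp add: W_def)
  define S where "S i = (\<Sum>j<i. B j)" for i
  \<comment> \<open>The result lies between \<open>lo\<close> and \<open>hi\<close>, and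
    \<open>i\<close> bounds the number of rounds that are still to come.\<close>
  define I where "I = (\<lambda>i M'. \<exists>lo hi. M' 7 = real lo \<and> M' 8 = real hi \<and> M' 10 = real W \<and> M' 2 = frac (M 2 * real N) \<and>
    lo \<le> hi \<and> hi \<le> h \<and> hi - lo < 2 ^ i \<and> S lo \<le> W \<and> (hi = h \<or> W < S (Suc hi)) \<and> (\<forall>i. i \<notin> sample_cells \<longrightarrow> M' i = M i))"
  let ?M = "fold (upd Q) sample_init M"
  have I0: "I k ?M"
    unfolding I_def
    by (rule exI[of _ 0], rule exI[of _ h])
      (use assms W in \<open>auto simp: sample_init_def sample_cells_def constants_def S_def frac_def\<close>)
  have "wpc [Loop Lt 7 8 (map Basic sample_test @ [Branch Le 11 10 [Basic (Move 7 9)] [Basic (Binary Sub 8 9 13)]])] (17 * k + 1)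
    (\<lambda>M'. M' 2 = frac (M 2 * real N) \<and> M' 7 = real (pick B h W) \<and> (\<forall>i. i \<notin> sample_cells \<longrightarrow> M' i = M i)) ?M"
  proof (rule wpc_while[where R = less_than and I = I and T = "\<lambda>i. 17 * i + 1"])
    fix i M' assume "I i M'" and c: "cmp_val Lt (M' 7) (M' 8)"
    then obtain lo hi where I: "M' 7 = real lo" "M' 8 = real hi" "M' 10 = real W" "M' 2 = frac (M 2 * real N)"
      "lo \<le> hi" "hi \<le> h" "hi - lo < 2 ^ i" "S lo \<le> W" "hi = h \<or> W < S (Suc hi)"
      and fr: "\<And>i. i \<notin> sample_cells \<Longrightarrow> M' i = M i" unfolding I_def by blast
    have less: "lo < hi" using c I by simp
    then obtain i' where i': "i = Suc i'" using I by (cases i) auto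
    \<comment> \<open>Rounding up makes \<open>mid > lo\<close>, so that both new intervals are
      shorter.\<close>
    define mid where "mid = (lo + hi + 1) div 2"
    have mid: "lo < mid" "mid \<le> hi" "hi - mid < 2 ^ i'" "mid - 1 - lo < 2 ^ i'"
      using less I(7) unfolding mid_def i' by auto
    have M': "M' 4 = real (N + 2)" "M' 5 = real (\<Sum>j\<le>h. B j * (N + 2) ^ j)" "M' 13 = 1" "M' 14 = 2"
      using fr assms by (auto simp: sample_cells_def constants_def)
    have fl: "\<lfloor>(real lo + real hi + 1) / 2\<rfloor> = int mid"
      using floor_divide_of_nat_eq[of "lo + hi + 1" 2, where 'a = real] by (simp add: mid_def add_ac)
    have pw: "(real N + 2) powr real mid = real ((N + 2) ^ mid)" by (simp add: powr_realpow add.commute)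
    have S: "real (\<Sum>j\<le>h. B j * (N + 2) ^ j) - of_int \<lfloor>real (\<Sum>j\<le>h. B j * (N + 2) ^ j) / real ((N + 2) ^ mid)\<rfloor> * real ((N + 2) ^ mid)
        = real ((\<Sum>j\<le>h. B j * (N + 2) ^ j) mod (N + 2) ^ mid)"
      by (rule real_mod) simp
    have S': "real ((\<Sum>j\<le>h. B j * (N + 2) ^ j) mod (N + 2) ^ mid) -
        of_int \<lfloor>real ((\<Sum>j\<le>h. B j * (N + 2) ^ j) mod (N + 2) ^ mid) / real (N + 1)\<rfloor> * real (N + 1) = real (S mid)"
      unfolding S_def using sum_digits_mod[OF assms(6), of mid] mid I(6)
      by (subst real_mod) auto
    define F where "F = real (\<Sum>j\<le>h. B j * (N + 2) ^ j)"
    define M1 where "M1 = fold (upd Q) sample_test M'"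
    have m1: "M1 9 = real mid" by (simp add: M1_def sample_test_def I M'(3,4) fl)
    have m1i: "M1 i = M' i" if "i \<in> {2, 7, 8, 10, 13}" for i
      using that by (auto simp: M1_def sample_test_def)
    define Z where "Z = real N + 2"
    have Z: "real (N + 1) = Z - 1" "M' 4 = Z" "M' 5 = F" using M'(1,2) by (simp_all add: Z_def F_def)
    have "M1 11 = (F - of_int \<lfloor>F / Z powr real mid\<rfloor> * Z powr real mid) -
      of_int \<lfloor>(F - of_int \<lfloor>F / Z powr real mid\<rfloor> * Z powr real mid) / (Z - 1)\<rfloor> * (Z - 1)"
      by (simp add: M1_def sample_test_def I M'(3,4) Z(2,3) fl)
    also have "\<dots> = real (S mid)" unfolding Z_def pw F_def S S'[unfolded Z(1), unfolded Z_def] ..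
    finally have m11: "M1 11 = real (S mid)" .
    have m1f: "M1 i = M i" if "i \<notin> sample_cells" for i
      using that fr[OF that] by (simp add: M1_def sample_test_def sample_cells_def)
    have "wpc [Branch Le 11 10 [Basic (Move 7 9)] [Basic (Binary Sub 8 9 13)]] 2 (I i') M1"
    proof (rule wpc_Branch[where c = 1])
      show "wpc ((if cmp_val Le (M1 11) (M1 10) then [Basic (Move 7 9)] else [Basic (Binary Sub 8 9 13)]) @ []) 1 (I i') M1"
      proof (cases "S mid \<le> W")
        case True
        have "I i' (M1(7 := M1 9))" unfolding I_def
          by (rule exI[of _ mid], rule exI[of _ hi])
            (use m1 m1i mid I True m1f in \<open>auto simp: sample_cells_def\<close>)
        then show ?thesis using True m11 m1i[of 10] I wpc_line_only[of "[Move 7 9]" "I i'" M1 1] by simp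
      next
        case False
        have "I i' (M1(8 := M1 9 - M1 13))" unfolding I_def
          by (rule exI[of _ lo], rule exI[of _ "mid - 1"])
            (use m1 m1i mid I False m1f M' in \<open>auto simp: sample_cells_def of_nat_diff\<close>)
        then show ?thesis using False m11 m1i[of 10] I wpc_line_only[of "[Binary Sub 8 9 13]" "I i'" M1 1] by simp
      qed
    qed simp
    then have "wpc (map Basic sample_test @ [Branch Le 11 10 [Basic (Move 7 9)] [Basic (Binary Sub 8 9 13)]]) 16 (I i') M'"
      by (intro wpc_line[where c = 2]) (auto simp: M1_def sample_test_def)
    then show "\<exists>b c. (b, i) \<in> less_than \<and> c + 1 + (17 * b + 1) \<le> 17 * i + 1 \<and>
       wpc (map Basic sample_test @ [Branch Le 11 10 [Basic (Move 7 9)] [Basic (Binary Sub 8 9 13)]]) c (I b) M'"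
      by (intro exI[of _ i'] exI[of _ 16]) (auto simp: i')
  next
    fix i M' assume "I i M'" and c: "\<not> cmp_val Lt (M' 7) (M' 8)"
    then obtain lo where I: "M' 7 = real lo" "M' 2 = frac (M 2 * real N)"
      "lo \<le> h" "S lo \<le> W" "lo = h \<or> W < S (Suc lo)" "\<And>i. i \<notin> sample_cells \<Longrightarrow> M' i = M i" 
      unfolding I_def by fastforce
    then have "pick B h W = lo" by (intro pick_eqI) (auto simp: S_def)
    then show "1 \<le> 17 * i + 1 \<and> (M' 2 = frac (M 2 * real N) \<and> M' 7 = real (pick B h W) \<and> (\<forall>i. i \<notin> sample_cells \<longrightarrow> M' i = M i))"
      using I by auto
  qed (use I0 in auto)
  then show ?thesis unfolding sample_code_def W_def
    by (intro wpc_line[where c = "17 * k + 1"]) (auto simp: sample_init_def)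
qed

end

subsection \<open>Sampling the moves\<close>

text \<open>From cell \<open>B \<ge> 40\<close> on, the memory holds \<open>x 0\<close>, \<open>y 0\<close>, \<open>x 1\<close>, \<open>y 1\<close>, \<dots>; the cells below 40 are
  registers: 17 holds \<open>dim x\<close>, 18 the number of remaining steps, 19 to 23 hold \<open>s\<close>, \<open>h\<close>, \<open>G\<close>, \<open>n\<^sup>2\<close>, \<open>L\<close>, and
  24 to 30 hold \<open>\<alpha>\<close>, \<open>\<beta>\<close>, the remaining total weight, the remaining number of draws, \<open>a\<close>, \<open>b\<close>, and the weight
  \<open>\<alpha> * x a * x b + \<beta> * y a * y b\<close> of the pair \<open>(a, b)\<close>.\<close>

definition stores :: "nat \<Rightarrow> (nat \<Rightarrow> real) \<Rightarrow> counts \<Rightarrow> counts \<Rightarrow> bool" where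
  "stores B M x y \<longleftrightarrow> M 16 = real B \<and> 40 \<le> B \<and>
     (\<forall>a. M (2 * a + B) = real_of_int (x a) \<and> M (Suc (2 * a + B)) = real_of_int (y a))"

lemma to_nat_cell_address:
  "to_nat_cell (real a * 2 + real B) = 2 * a + B"
  "to_nat_cell (real a * 2 + real B + 1) = Suc (2 * a + B)"
  "to_nat_cell (real a * 2 + real B + 2) = 2 * Suc a + B"
proof -
  have "to_nat_cell (real k) = k" for k by (simp add: to_nat_cell_def)
  from this[of "2 * a + B"] this[of "Suc (2 * a + B)"] this[of "2 * Suc a + B"]
  show "to_nat_cell (real a * 2 + real B) = 2 * a + B"
    "to_nat_cell (real a * 2 + real B + 1) = Suc (2 * a + B)"
    "to_nat_cell (real a * 2 + real B + 2) = 2 * Suc a + B"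
    by (simp_all add: mult.commute add_ac)
qed

lemma to_nat_cell_of_nat [simp]: "to_nat_cell (real k) = k"
  by (simp add: to_nat_cell_def)

lemma address_neq:
  "40 \<le> B \<Longrightarrow> i < 40 \<Longrightarrow> 2 * a + B \<noteq> i" "40 \<le> B \<Longrightarrow> i < 40 \<Longrightarrow> i \<noteq> 2 * a + B"
  "40 \<le> B \<Longrightarrow> i < 40 \<Longrightarrow> Suc (2 * a + B) \<noteq> i" "40 \<le> B \<Longrightarrow> i < 40 \<Longrightarrow> i \<noteq> Suc (2 * a + B)"
  for a B i :: nat
  by auto

lemma stores_cong:
  assumes "stores B M x y" "\<And>i. 40 \<le> i \<or> i = 16 \<Longrightarrow> M' i = M i"
  shows "stores B M' x y"
  using assms unfolding stores_def by (metis le_add2 le_SucI order_trans)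

text \<open>After the weight \<open>p\<close> of the pair this prepares \<open>sample_code\<close>:
  with \<open>X = r ^ L + 2\<close>, the generating polynomial of the binomial weights is
  \<open>(p * X + (r - p)) ^ L\<close> by the binomial theorem, a single
  \<open>Powr\<close>.\<close>

definition weight_code :: "instr list" where
  "weight_code = [Binary Mul 31 28 14, Binary Add 31 31 16, Load 33 31, Binary Add 31 31 13, Load 35 31,
     Binary Mul 32 29 14, Binary Add 32 32 16, Load 34 32, Binary Add 32 32 13, Load 36 32,
     Binary Mul 33 33 34, Binary Mul 33 33 24, Binary Mul 35 35 36, Binary Mul 35 35 25, Binary Add 30 33 35,
     Binary Powr 3 26 27, Binary Add 4 3 14, Binary Mul 5 30 4, Binary Add 5 5 26, Binary Sub 5 5 30,
     Binary Powr 5 5 27, Move 6 27]"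

definition shift_code :: "instr list" where
  "shift_code = [Binary Mul 31 37 14, Binary Add 31 31 16, Load 33 31, Binary Sub 33 33 7, Store 31 33,
     Binary Add 31 31 14, Load 33 31, Binary Add 33 33 7, Store 31 33,
     Binary Sub 26 26 30, Binary Sub 27 27 7, Binary Add 29 29 13]"

definition multinomial_body :: "stmt list" where
  "multinomial_body = map Basic weight_code @ sample_code @ map Basic [Query 37 28 29] @
     Branch Eq 37 15 [Basic (Move 37 28)] [Basic (Move 37 29)] #
     map Basic shift_code @ [Branch Eq 29 17 (map Basic [Move 29 15, Binary Add 28 28 13]) []]"

definition multinomial_code :: "stmt list" where
  "multinomial_code = map Basic [Move 28 15, Move 29 15] @ [Loop Lt 15 27 multinomial_body]"

definition multinomial_cells :: "nat set" where
  "multinomial_cells = {2, 3, 4, 5, 6, 7, 8, 9, 10, 11, 12, 26, 27, 28, 29, 30, 31, 32, 33, 34, 35, 36, 37, 38}"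

definition same_registers :: "nat set \<Rightarrow> (nat \<Rightarrow> real) \<Rightarrow> (nat \<Rightarrow> real) \<Rightarrow> bool" where
  "same_registers S M' M \<longleftrightarrow> (\<forall>i<40. i \<notin> S \<longrightarrow> M' i = M i)"

lemma same_registersD: "same_registers S M' M \<Longrightarrow> i < 40 \<Longrightarrow> i \<notin> S \<Longrightarrow> M' i = M i"
  by (simp add: same_registers_def)

lemma same_registers_trans:
  "same_registers S M2 M1 \<Longrightarrow> same_registers S' M1 M \<Longrightarrow> S \<union> S' \<subseteq> S'' \<Longrightarrow> same_registers S'' M2 M"
  unfolding same_registers_def by (metis UnCI subset_iff)

lemma shift_code_stores:
  fixes Q :: "nat \<Rightarrow> nat \<Rightarrow> nat"
  assumes "constants M" "stores B M x y" "M 37 = real c" "M 7 = real j"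
  defines "M' \<equiv> fold (upd Q) shift_code M"
  shows "stores B M' (shift j c x) y" "M' 26 = M 26 - M 30" "M' 27 = M 27 - M 7" "M' 29 = M 29 + 1"
    "same_registers {26, 27, 29, 31, 33} M' M"
proof -
  have B: "40 \<le> B" and M: "M 16 = real B" "M 13 = 1" "M 14 = 2"
    "\<And>a. M (2 * a + B) = real_of_int (x a)" "\<And>a. M (Suc (2 * a + B)) = real_of_int (y a)"
    using assms by (auto simp: stores_def constants_def)
  note xc = M(4)[of c] M(4)[of "Suc c"]
  have eq: "M' = M(31 := real c * 2 + real B + 2, 33 := real_of_int (x (Suc c)) + real j,
      2 * c + B := real_of_int (x c) - real j, 2 * Suc c + B := real_of_int (x (Suc c)) + real j,
      26 := M 26 - M 30, 27 := M 27 - M 7, 29 := M 29 + 1)"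
    unfolding M'_def shift_code_def using B xc
    by (simp add: M assms(3,4) to_nat_cell_address address_neq fun_eq_iff del: mult_Suc_right)
  have neq: "2 * a + B \<noteq> i" "Suc (2 * a + B) \<noteq> i" if "i < 40" for a i using B that by auto
  show "stores B M' (shift j c x) y"
    unfolding stores_def
  proof (intro conjI allI)
    fix a
    have p: "Suc (2 * a + B) \<noteq> 2 * c + B" "Suc (2 * a + B) \<noteq> 2 * Suc c + B" by presburger+
    show "M' (Suc (2 * a + B)) = real_of_int (y a)"
      unfolding eq using p neq[of _ a] M(5)[of a] by (simp del: mult_Suc_right add: fun_upd_def)
    have even: "2 * a = Suc (Suc (2 * c)) \<longleftrightarrow> a = Suc c" by presburger
    show "M' (2 * a + B) = real_of_int (shift j c x a)"
      unfolding eq using neq(1)[of _ a] M(4)[of a] even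
      by (auto simp: shift_def fun_upd_def)
  qed (use B M in \<open>auto simp: eq\<close>)
  show "M' 26 = M 26 - M 30" "M' 27 = M 27 - M 7" "M' 29 = M 29 + 1"
    "same_registers {26, 27, 29, 31, 33} M' M"
    unfolding same_registers_def eq using B by auto
qed

context bounded_queries begin

text \<open>A pair that carries all the remaining weight takes all remaining draws, whatever
  \<open>W\<close> is. Hence the loop never has draws left without weight.\<close>

lemma pick_binomial_full: "pick (binomial_weights p p L) L W = L"
proof (rule pick_eqI)
  have "(\<Sum>i<L. binomial_weights p p L i) = 0" by (rule sum.neutral) (auto simp: binomial_weights_def)
  then show "(\<Sum>i<L. binomial_weights p p L i) \<le> W" by simp
qed auto

lemma binomial_polynomial:
  assumes "p \<le> r"
  shows "(p * X + (r - p)) ^ L = (\<Sum>j\<le>L. binomial_weights p r L j * X ^ j)"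
  unfolding binomial[of "p * X" "r - p" L]
  by (intro sum.cong) (auto simp: binomial_weights_def power_mult_distrib)

lemma wp_multinomial_body:
  assumes "constants M" "stores B M x y" "M 28 = real a" "M 29 = real b" "M 17 = real D" 
    and "M 26 = real r" "M 27 = real L" "0 < r" "0 \<le> M 2" "L < 2 ^ k"
    and "real p = M 24 * (x a * x b) + M 25 * (y a * y b)" "p \<le> r"
  defines "j \<equiv> pick (binomial_weights p r L) L (nat \<lfloor>M 2 * real (r ^ L)\<rfloor>)"
  shows "wpc multinomial_body (17 * k + 49) (\<lambda>M'.
    stores B M' (shift j (chosen Q (a, b)) x) y \<and> M' 2 = frac (M 2 * real (r ^ L)) \<and>
    M' 26 = real (r - p) \<and> M' 27 = real (L - j) \<and>
    (if b + 1 = D then M' 28 = real (a + 1) \<and> M' 29 = 0 else M' 28 = real a \<and> M' 29 = real (b + 1)) \<and>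
    same_registers multinomial_cells M' M) M"
proof -
  have B: "40 \<le> B" and M: "M 16 = real B" "M 13 = 1" "M 14 = 2" "M 15 = 0"
    "\<And>a. M (2 * a + B) = real_of_int (x a)" "\<And>a. M (Suc (2 * a + B)) = real_of_int (y a)"
    using assms by (auto simp: stores_def constants_def)
  define N where "N = r ^ L"
  define M1 where "M1 = fold (upd Q) weight_code M"
  have neq: "2 * a + B \<noteq> i" "Suc (2 * a + B) \<noteq> i" if "i < 40" for a i using B that by auto
  have p: "M 24 * (x a * x b) + M 25 * (y a * y b) = real p" using assms by simp
  have pw: "real r powr real L = real N" using assms(8) by (simp add: powr_realpow N_def)
  \<comment> \<open>\<open>powr\<close> is known to agree with the natural power only for a positive
    base.\<close>
  have "0 < p * (N + 2) + (r - p)" using assms(8,12) by (cases "p = 0") auto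
  then have pw2: "real (p * (N + 2) + (r - p)) powr real L = real ((p * (N + 2) + (r - p)) ^ L)"
    by (simp only: powr_realpow of_nat_0_less_iff of_nat_power)
  have base: "real p * (real N + 2) + real r - real p = real (p * (N + 2) + (r - p))"
    using assms(12) by (simp add: of_nat_diff algebra_simps)
  have m1: "M1 3 = real N" "M1 4 = real (N + 2)" "M1 30 = real p" "M1 6 = real L"
    "M1 5 = real (\<Sum>j\<le>L. binomial_weights p r L j * (N + 2) ^ j)"
  proof -
    have e: "M1 30 = real_of_int (x a) * real_of_int (x b) * M 24 + real_of_int (y a) * real_of_int (y b) * M 25" "M1 3 = real r powr real L"
      "M1 4 = M1 3 + 2" "M1 6 = real L" "M1 5 = (M1 30 * M1 4 + real r - M1 30) powr real L"
      using B neq unfolding M1_def weight_code_def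
      by (simp_all add: assms(3-7) M to_nat_cell_address)
    show "M1 3 = real N" "M1 4 = real (N + 2)" "M1 30 = real p" "M1 6 = real L"
      using e p pw by (auto simp: mult_ac)
    have "M1 30 = real p" "M1 4 = real N + 2" using e p pw by (auto simp: mult_ac)
    then have "M1 5 = real (p * (N + 2) + (r - p)) powr real L"
      using e(5) by (simp only: base)
    then show "M1 5 = real (\<Sum>j\<le>L. binomial_weights p r L j * (N + 2) ^ j)"
      unfolding pw2 binomial_polynomial[OF assms(12)] .
  qed
  have fr1: "M1 i = M i" if "i \<notin> {3, 4, 5, 6, 30, 31, 32, 33, 34, 35, 36}" for i
    using that by (simp add: M1_def weight_code_def)
  have j: "j = pick (binomial_weights p r L) L (nat \<lfloor>M1 2 * real N\<rfloor>)" by (simp add: j_def fr1 N_def)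
  have jL: "j \<le> L" unfolding j_def by (rule pick_spec)
  have "wpc sample_code (17 * k + 6) (\<lambda>M'. M' 2 = frac (M1 2 * real N) \<and>
     M' 7 = real j \<and> (\<forall>i. i \<notin> sample_cells \<longrightarrow> M' i = M1 i)) M1"
    unfolding j
  proof (rule wp_sample[where h = L])
    show "constants M1" using assms(1) by (simp add: constants_def fr1)
    show "(\<Sum>j\<le>L. binomial_weights p r L j) = N" using sum_binomial_weights[OF assms(12)] by (simp add: N_def)
  qed (use m1 assms fr1 in auto)
  then have "wpc (sample_code @ map Basic [Query 37 28 29] @
     Branch Eq 37 15 [Basic (Move 37 28)] [Basic (Move 37 29)] #
     map Basic shift_code @ [Branch Eq 29 17 (map Basic [Move 29 15, Binary Add 28 28 13]) []]) (17 * k + 27) (\<lambda>M'.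
    stores B M' (shift j (chosen Q (a, b)) x) y \<and> M' 2 = frac (M 2 * real (r ^ L)) \<and>
    M' 26 = real (r - p) \<and> M' 27 = real (L - j) \<and>
    (if b + 1 = D then M' 28 = real (a + 1) \<and> M' 29 = 0 else M' 28 = real a \<and> M' 29 = real (b + 1)) \<and>
    same_registers multinomial_cells M' M) M1"
    (is "wpc _ _ ?P M1")
  proof (intro wpc_append[where c = "17 * k + 6" and c' = 21], elim wpc_mono)
    fix M2 assume M2: "M2 2 = frac (M1 2 * real N) \<and> M2 7 = real j \<and> (\<forall>i. i \<notin> sample_cells \<longrightarrow> M2 i = M1 i)"
    then have fr2: "M2 i = M i" if "i \<notin> multinomial_cells" for i
      using that fr1 by (auto simp: multinomial_cells_def sample_cells_def)
    have m2: "M2 28 = real a" "M2 29 = real b" "M2 15 = 0" "M2 7 = real j" "M2 2 = frac (M 2 * real N)"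
      "M2 26 = real r" "M2 27 = real L" "M2 30 = real p" "M2 17 = real D" "M2 13 = 1" "M2 14 = 2"
      using M2 fr1 assms m1 by (auto simp: sample_cells_def constants_def)
    define c where "c = chosen Q (a, b)"
    define M3 where "M3 = M2(37 := real c)"
    define M4 where "M4 = fold (upd Q) shift_code M3"
    have st3: "stores B M3 x y"
      by (rule stores_cong[OF assms(2)]) (use fr2 in \<open>auto simp: M3_def multinomial_cells_def\<close>)
    have c3: "constants M3" using m2 by (auto simp: constants_def M3_def)
    have m3: "M3 37 = real c" "M3 7 = real j" using m2 by (auto simp: M3_def)
    note sc = shift_code_stores[where Q = Q, OF c3 st3 m3, folded M4_def]
    note s4 = same_registersD[OF sc(5)]
    have m4: "M4 28 = real a" "M4 29 = real b + 1" "M4 15 = 0" "M4 13 = 1" "M4 17 = real D" "M4 26 = real (r - p)"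
      "M4 27 = real (L - j)" "M4 2 = frac (M 2 * real N)"
      using sc(2-4) s4[of 28] s4[of 15] s4[of 13] s4[of 17] s4[of 2] m2 jL assms(12) by (auto simp: M3_def of_nat_diff)
    have sr4: "same_registers multinomial_cells M4 M"
      by (rule same_registers_trans[OF sc(5), of multinomial_cells])
        (use fr2 in \<open>auto simp: same_registers_def M3_def multinomial_cells_def\<close>)
    have bD: "real b + 1 = real D \<longleftrightarrow> b + 1 = D" by linarith
    have sf: "stores B (M4(29 := 0, 28 := real a + 1)) (shift j c x) y"
      by (rule stores_cong[OF sc(1)]) auto
    have last: "wpc [Branch Eq 29 17 (map Basic [Move 29 15, Binary Add 28 28 13]) []] 3 ?P M4"
    proof (rule wpc_Branch[where c = 2])
      show "wpc ((if cmp_val Eq (M4 29) (M4 17) then map Basic [Move 29 15, Binary Add 28 28 13] else []) @ []) 2 ?P M4"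
      proof (cases "b + 1 = D")
        case True
        have "?P (M4(29 := 0, 28 := real a + 1))"
          using True m4 sr4 sf
          by (auto simp: N_def c_def same_registers_def multinomial_cells_def)
        then show ?thesis using True m4 bD wpc_line_only[of "[Move 29 15, Binary Add 28 28 13]" ?P M4 2] by simp
      next
        case False
        have "?P M4" using False m4 sr4 sc(1) by (auto simp: N_def c_def)
        then show ?thesis using False m4 bD by (simp add: wp_Nil)
      qed
    qed simp
    have "wpc (map Basic shift_code @ [Branch Eq 29 17 (map Basic [Move 29 15, Binary Add 28 28 13]) []]) 15 ?P M3"
      by (rule wpc_line[OF _ last[unfolded M4_def]]) (auto simp: shift_code_def)
    note rest = this
    have "wpc (Branch Eq 37 15 [Basic (Move 37 28)] [Basic (Move 37 29)] #
        map Basic shift_code @ [Branch Eq 29 17 (map Basic [Move 29 15, Binary Add 28 28 13]) []]) 17 ?P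
        (M2(37 := real (Q a b)))"
    proof (rule wpc_Branch[where c = 16])
      define M2' where "M2' = M2(37 := real (Q a b))"
      have e: "M2'(37 := M2' 28) = M2(37 := real a)" "M2'(37 := M2' 29) = M2(37 := real b)"
        using m2 by (auto simp: M2'_def)
      show "wpc ((if cmp_val Eq ((M2(37 := real (Q a b))) 37) ((M2(37 := real (Q a b))) 15) then [Basic (Move 37 28)] else [Basic (Move 37 29)]) @
        map Basic shift_code @ [Branch Eq 29 17 (map Basic [Move 29 15, Binary Add 28 28 13]) []]) 16 ?P (M2(37 := real (Q a b)))"
      proof (cases "Q a b = 0")
        case True
        then have "M3 = fold (upd Q) [Move 37 28] M2'" using e by (simp add: M3_def c_def chosen_def)
        with wpc_line[of "[Move 37 28]", OF _ rest[unfolded this]] True m2 show ?thesis by (simp add: M2'_def)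
      next
        case False
        then have "M3 = fold (upd Q) [Move 37 29] M2'" using e by (simp add: M3_def c_def chosen_def)
        with wpc_line[of "[Move 37 29]", OF _ rest[unfolded this]] False m2 show ?thesis by (simp add: M2'_def)
      qed
    qed simp
    moreover have "fold (upd Q) [Query 37 28 29] M2 = M2(37 := real (Q a b))" using m2 by simp
    ultimately show "wpc (map Basic [Query 37 28 29] @ Branch Eq 37 15 [Basic (Move 37 28)] [Basic (Move 37 29)] #
     map Basic shift_code @ [Branch Eq 29 17 (map Basic [Move 29 15, Binary Add 28 28 13]) []]) 21 ?P M2"
      by (intro wpc_line[where c = 17]) auto
  qed auto
  then show ?thesis unfolding multinomial_body_def
    by (intro wpc_line[where c = "17 * k + 27"]) (auto simp: M1_def weight_code_def)
qed

text \<open>The code recomputes each weight from the current counts, which change with the draws.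
  The last assumption makes this harmless: either the weights involve only \<open>y\<close>, or the
  loop stops right after its only draw.\<close>

lemma wp_multinomial:
  assumes "constants M" "stores B M x y" "M 17 = real D" "M 24 = \<alpha>" "M 25 = \<beta>" "M 26 = real r" "M 27 = real L"
    and "r = sum_list (map v (square_list D))" "0 < L \<longrightarrow> 0 < r" "0 \<le> M 2" "M 2 < 1" "L < 2 ^ k"
    and v: "0 < L \<longrightarrow> (\<forall>(a, b) \<in> square D. real (v (a, b)) = \<alpha> * (x a * x b) + \<beta> * (y a * y b))"
    and "\<alpha> = 0 \<or> L \<le> 1"
  shows "wpc multinomial_code (D * D * (17 * k + 50) + 3) (\<lambda>M'.
    stores B M' (fst (run (multinomial Q v (square_list D) r L x) (M 2))) y \<and>
    M' 2 = snd (run (multinomial Q v (square_list D) r L x) (M 2)) \<and>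
    same_registers multinomial_cells M' M) M"
proof -
  define ks where "ks i = map (\<lambda>i. (i div D, i mod D)) [i..<D * D]" for i
  let ?R = "run (multinomial Q v (square_list D) r L x) (M 2)"
  \<comment> \<open>Evaluating the rest of the choice tree on the current variate always yields the
    final result \<open>?R\<close>.\<close>
  define I where "I = (\<lambda>i M'. i \<le> D * D \<and> (\<exists>L' x' r'. 0 \<le> M' 2 \<and> M' 2 < 1 \<and> M' 26 = real r' \<and> M' 27 = real L' \<and>
    M' 28 = real (i div D) \<and> M' 29 = real (i mod D) \<and> stores B M' x' y \<and> r' = sum_list (map v (ks i)) \<and>
    (0 < L' \<longrightarrow> 0 < r') \<and> (0 < L' \<longrightarrow> (\<forall>(a, b) \<in> square D. real (v (a, b)) = \<alpha> * (x' a * x' b) + \<beta> * (y a * y b))) \<and>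
    (\<alpha> = 0 \<or> L' \<le> 1) \<and> L' \<le> L \<and> run (multinomial Q v (ks i) r' L' x') (M' 2) = ?R \<and> same_registers multinomial_cells M' M))"
  let ?M = "fold (upd Q) [Move 28 15, Move 29 15] M"
  have ks0: "ks 0 = square_list D" by (simp add: ks_def square_list_def)
  have I0: "I 0 ?M"
    unfolding I_def
  proof (intro conjI, simp, rule exI[of _ L], rule exI[of _ x], rule exI[of _ r], intro conjI)
    show "stores B ?M x y" by (rule stores_cong[OF assms(2)]) auto
  qed (use assms ks0 in \<open>auto simp: constants_def same_registers_def multinomial_cells_def\<close>)
  have "wpc [Loop Lt 15 27 multinomial_body] ((D * D - 0) * (17 * k + 50) + 1) (\<lambda>M'.
    stores B M' (fst ?R) y \<and> M' 2 = snd ?R \<and> same_registers multinomial_cells M' M) ?M"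
  proof (rule wpc_while[where R = "Wellfounded.measure (\<lambda>i. D * D - i)" and I = I and T = "\<lambda>i. (D * D - i) * (17 * k + 50) + 1"])
    fix i M' assume "I i M'" and cond: "cmp_val Lt (M' 15) (M' 27)"
    then obtain L' x' r' where i: "i \<le> D * D" and u: "0 \<le> M' 2" "M' 2 < 1" and m: "M' 26 = real r'" "M' 27 = real L'"
      "M' 28 = real (i div D)" "M' 29 = real (i mod D)" and st: "stores B M' x' y" and r': "r' = sum_list (map v (ks i))" and
      pos: "0 < L' \<Longrightarrow> 0 < r'" and wt: "0 < L' \<Longrightarrow> (\<forall>(a, b) \<in> square D. real (v (a, b)) = \<alpha> * (x' a * x' b) + \<beta> * (y a * y b))"
      and \<alpha>: "\<alpha> = 0 \<or> L' \<le> 1" and L': "L' \<le> L" and run: "run (multinomial Q v (ks i) r' L' x') (M' 2) = ?R" and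
      sr: "same_registers multinomial_cells M' M" unfolding I_def by blast
    note s = same_registersD[OF sr]
    have cs: "constants M'" "M' 17 = real D" "M' 24 = \<alpha>" "M' 25 = \<beta>"
      using s[of 13] s[of 14] s[of 15] s[of 17] s[of 24] s[of 25] assms by (auto simp: constants_def multinomial_cells_def)
    have L0: "0 < L'" using cond cs m by (simp add: constants_def)
    have iD: "i < D * D" using i r' pos[OF L0] by (cases "i = D * D") (auto simp: ks_def)
    then have D: "0 < D" by (cases D) auto
    let ?k = "(i div D, i mod D)"
    have ks: "ks i = ?k # ks (Suc i)" using iD by (simp add: ks_def upt_conv_Cons)
    have k: "?k \<in> square D" using iD D by (simp add: square_def less_mult_imp_div_less)
    have vk: "real (v ?k) = M' 24 * (x' (i div D) * x' (i mod D)) + M' 25 * (y (i div D) * y (i mod D))"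
      using wt[OF L0] k cs by auto
    have vr: "v ?k \<le> r'" "r' - v ?k = sum_list (map v (ks (Suc i)))" using r' ks by auto
    define j where "j = pick (binomial_weights (v ?k) r' L') L' (nat \<lfloor>M' 2 * real (r' ^ L')\<rfloor>)"
    have "wpc multinomial_body (17 * k + 49) (I (Suc i)) M'"
    proof (rule wpc_mono[OF wp_multinomial_body[where k = k, OF cs(1) st m(3,4) cs(2) m(1,2) pos[OF L0] u(1) _ vk vr(1), folded j_def]])
      show "L' < 2 ^ k" using L' assms(12) by simp
    next
      fix M'' assume P: "stores B M'' (shift j (chosen Q ?k) x') y \<and> M'' 2 = frac (M' 2 * real (r' ^ L')) \<and>
        M'' 26 = real (r' - v ?k) \<and> M'' 27 = real (L' - j) \<and>
        (if i mod D + 1 = D then M'' 28 = real (i div D + 1) \<and> M'' 29 = 0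
         else M'' 28 = real (i div D) \<and> M'' 29 = real (i mod D + 1)) \<and> same_registers multinomial_cells M'' M'"
      show "I (Suc i) M''" unfolding I_def
      proof (intro conjI, use iD in simp, rule exI[of _ "L' - j"], rule exI[of _ "shift j (chosen Q ?k) x'"],
          rule exI[of _ "r' - v ?k"], intro conjI)
        show "0 < L' - j \<longrightarrow> 0 < r' - v ?k"
        proof (rule impI, rule ccontr)
          assume "0 < L' - j" "\<not> 0 < r' - v ?k"
          then have "v ?k = r'" using vr(1) by linarith
          then have "j = L'" unfolding j_def by (simp add: pick_binomial_full)
          then show False using \<open>0 < L' - j\<close> by simp
        qed
        show "0 < L' - j \<longrightarrow> (\<forall>(a, b)\<in>square D. real (v (a, b)) = \<alpha> * (shift j (chosen Q ?k) x' a * shift j (chosen Q ?k) x' b) + \<beta> * (y a * y b))"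
        proof
          assume "0 < L' - j"
          \<comment> \<open>Draws remain, so either the weights ignore \<open>x'\<close> or the
            current pair has not been drawn and \<open>x'\<close> is unchanged.\<close>
          then have "\<alpha> = 0 \<or> j = 0" using \<alpha> by auto
          then show "\<forall>(a, b)\<in>square D. real (v (a, b)) = \<alpha> * (shift j (chosen Q ?k) x' a * shift j (chosen Q ?k) x' b) + \<beta> * (y a * y b)"
            using wt[OF L0] by auto
        qed
        show "M'' 28 = real (Suc i div D)" "M'' 29 = real (Suc i mod D)"
          using P by (auto simp: div_Suc mod_Suc split: if_splits)
        show "run (multinomial Q v (ks (Suc i)) (r' - v ?k) (L' - j) (shift j (chosen Q ?k) x')) (M'' 2) = ?R"
          using P run L0 by (simp add: ks j_def Let_def)
        show "same_registers multinomial_cells M'' M"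
          using P sr by (auto simp: same_registers_def)
      qed (use P vr \<alpha> L' in \<open>auto simp: frac_lt_1\<close>)
    qed auto
    moreover have "(D * D - i) * (17 * k + 50) = (17 * k + 50) + (D * D - Suc i) * (17 * k + 50)"
      using iD by (metis Suc_diff_Suc mult_Suc)
    ultimately show "\<exists>b c. (b, i) \<in> Wellfounded.measure (\<lambda>i. D * D - i) \<and> c + 1 + ((D * D - b) * (17 * k + 50) + 1) \<le> (D * D - i) * (17 * k + 50) + 1 \<and>
        wpc multinomial_body c (I b) M'"
      using iD by (intro exI[of _ "Suc i"] exI[of _ "17 * k + 49"]) auto
  next
    fix i M' assume "I i M'" and cond: "\<not> cmp_val Lt (M' 15) (M' 27)"
    then obtain L' x' r' where m: "M' 27 = real L'" and st: "stores B M' x' y" and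
      run: "run (multinomial Q v (ks i) r' L' x') (M' 2) = ?R" and
      sr: "same_registers multinomial_cells M' M" unfolding I_def by blast
    have "M' 15 = 0" using same_registersD[OF sr, of 15] assms(1) by (auto simp: constants_def multinomial_cells_def)
    then have "L' = 0" using cond m by simp
    then have "run (multinomial Q v (ks i) r' L' x') (M' 2) = (x', M' 2)" by (cases "ks i") auto
    then show "1 \<le> (D * D - i) * (17 * k + 50) + 1 \<and> stores B M' (fst ?R) y \<and> M' 2 = snd ?R \<and> same_registers multinomial_cells M' M"
      using run st sr by auto
  qed (use I0 in auto)
  then show ?thesis unfolding multinomial_code_def
    by (intro wpc_line[where c = "D * D * (17 * k + 50) + 1"]) auto
qed

end

subsection \<open>One iteration\<close>

text \<open>Facts about the support of \<open>law\<close> thus hold for every variate and not merely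
  almost surely, which is what the verification of the code needs.\<close>

lemma run_in_law:
  assumes "wf_sampler t" "0 \<le> u" "u < 1"
  shows "fst (run t u) \<in> set_pmf (law t)"
  using assms
proof (induction t arbitrary: u)
  case (Choose N f)
  have N: "0 < N" using Choose.prems by simp
  have "u * real N < 1 * real N" using Choose.prems N by (intro mult_strict_right_mono) auto
  then have "\<lfloor>u * real N\<rfloor> < int N" by (simp add: floor_less_iff)
  then have k: "nat \<lfloor>u * real N\<rfloor> < N" using N by linarith
  moreover have "fst (run (f (nat \<lfloor>u * real N\<rfloor>)) (frac (u * real N))) \<in> set_pmf (law (f (nat \<lfloor>u * real N\<rfloor>)))"
    using Choose k by (auto simp: frac_lt_1)
  moreover have "set_pmf (pmf_of_set {..<N}) = {..<N}" using N by (intro set_pmf_of_set) auto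
  ultimately show ?case by auto
qed simp

lemma dim_le: "(\<And>a. D \<le> a \<Longrightarrow> x a = 0) \<Longrightarrow> dim x \<le> D"
  unfolding dim_def by (rule Least_le) auto

text \<open>Growth by at most one can be recognized from the single cell of \<open>x D\<close>;
  \<open>grow_code\<close> relies on this.\<close>

lemma dim_grow:
  assumes "0 < n" "valid n x" "D \<le> dim x" "dim x \<le> D + 1"
  shows "dim x = (if x D = 0 then D else D + 1)"
proof (cases "dim x = D")
  case True
  then show ?thesis using valid_ge_dim[OF assms(1,2), of D] by simp
next
  case False
  then have d: "dim x = D + 1" using assms by linarith
  have "x D \<noteq> 0"
  proof
    assume "x D = 0"
    then have "x a = 0" if "D \<le> a" for a
      using valid_ge_dim[OF assms(1,2), of a] that d by (cases "a = D") auto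
    then show False using dim_le[of D x] d by auto
  qed
  then show ?thesis using d by simp
qed

text \<open>These moves start from loads below \<open>D\<close>, hence reach at most load
  \<open>D\<close>: however many there are, the dimension grows by at most one.\<close>

lemma dim_draws:
  assumes "0 < n" "dominated n y D h x" "L \<le> h" "0 < L \<longrightarrow> 0 < total y D" "\<forall>a>D. x a = 0" "d \<le> dim x"
    "x1 \<in> set_pmf (draws Q (square D) (product_weight y) L x)"
  shows "dim x1 \<le> D + 1 \<and> d \<le> dim x1"
  using assms(2-)
proof (induction L arbitrary: h x)
  case 0
  then show ?case using dim_le[of "D + 1" x] by auto
next
  case (Suc L)
  obtain h' where h: "h = Suc h'" using Suc.prems by (cases h) auto
  have t: "0 < total y D" using Suc.prems by simp
  obtain k where k: "k \<in> set_pmf (weighted_pmf (square D) (product_weight y))"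
    "x1 \<in> set_pmf (draws Q (square D) (product_weight y) L (shift 1 (chosen Q k) x))"
    using Suc.prems by auto
  have v: "valid n x" using Suc.prems(1) by (simp add: dominated_def)
  have d: "dominated n y D h' (shift 1 (chosen Q k) x)"
    using dominated_step[of n y D h' x k Q] Suc.prems k h by simp
  have kD: "k \<in> square D" "0 < product_weight y k" using k(1) t by (auto simp: set_weighted_pmf total_def)
  then have "0 < y (chosen Q k)" using Suc.prems(1) by (intro positive_product) (auto simp: dominated_def)
  then have "0 < x (chosen Q k)" using dominated_le[OF Suc.prems(1), of "chosen Q k"] by simp
  then have "d \<le> dim (shift 1 (chosen Q k) x)" using dim_shift(1)[OF assms(1) v] Suc.prems(5) order_trans by blast
  moreover have "\<forall>a>D. shift 1 (chosen Q k) x a = 0"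
    using Suc.prems(4) kD(1) by (auto simp: shift_def chosen_def square_def)
  ultimately show ?case using Suc.IH[OF d _ _ _ _ k(2)] Suc.prems h by simp
qed

lemma sum_list_square_list: "sum_list (map v (square_list D)) = sum v (square D)"
  by (simp add: sum_list_distinct_conv_sum_set distinct_square_list set_square_list)

text \<open>Everything about an iteration that the code depends on, for each single variate:
  positivity of the weights, growth of the dimension, and the result in the order in which it is
  computed.\<close>

lemma iteration_facts:
  fixes u :: real and Q :: "nat \<Rightarrow> nat \<Rightarrow> nat"
  assumes "0 < n" "valid n x" "h \<le> s" "0 < h" "0 \<le> u" "u < 1"
  defines "y \<equiv> low s x" and "D \<equiv> dim x"
  defines "G \<equiv> total y D"
  defines "L \<equiv> pick (geometric_weights G (n\<^sup>2) h) h (nat \<lfloor>u * real ((n\<^sup>2) ^ h)\<rfloor>)"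
  defines "R1 \<equiv> run (multinomial Q (product_weight y) (square_list D) G L x) (frac (u * real ((n\<^sup>2) ^ h)))"
  defines "x1 \<equiv> fst R1"
  defines "R2 \<equiv> run (multinomial Q (excess x1 y) (square_list (dim x1)) (n\<^sup>2 - G) 1 x1) (snd R1)"
  shows "L \<le> h" "G \<le> n\<^sup>2" "0 < L \<Longrightarrow> 0 < G" "L < h \<Longrightarrow> G < n\<^sup>2" "G = sum_list (map (product_weight y) (square_list D))"
    and "dominated n y D 0 x1" "D \<le> dim x1" "dim x1 \<le> D + 1" "0 \<le> snd R1" "snd R1 < 1"
    and "n\<^sup>2 - G = sum_list (map (excess x1 y) (square_list (dim x1)))"
    and "L < h \<Longrightarrow> valid n (fst R2)" "L < h \<Longrightarrow> dim x1 \<le> dim (fst R2)" "L < h \<Longrightarrow> dim (fst R2) \<le> dim x1 + 1"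
    and "run (iteration_sampler Q n s h x) u = (if L < h then ((Suc L, fst R2), snd R2) else ((L, x1), snd R1))"
proof -
  define p where "p = real G / real (n\<^sup>2)"
  have dom: "dominated n y D h x" unfolding y_def D_def by (rule low_dominated[OF assms(1-3)])
  show G: "G \<le> n\<^sup>2" using dominated_total(3)[OF assms(1) dom order_refl] by (simp add: G_def D_def)
  have n2: "0 < n\<^sup>2" using assms(1) by simp
  let ?N = "(n\<^sup>2) ^ h"
  have N: "0 < ?N" using assms(1) by simp
  have "u * real ?N < 1 * real ?N" using assms(6) N by (intro mult_strict_right_mono) (simp_all only: of_nat_0_less_iff)
  then have "\<lfloor>u * real ?N\<rfloor> < int ?N" by (simp only: floor_less_iff mult_1_left of_int_of_nat_eq)
  then have W: "nat \<lfloor>u * real ?N\<rfloor> \<in> {..<?N}" using N by (simp only: lessThan_iff nat_less_iff[OF zero_le_floor[THEN iffD2]])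
  have "L \<in> set_pmf (map_pmf (pick (geometric_weights G (n\<^sup>2) h) h) (pmf_of_set {..<?N}))"
    unfolding L_def set_map_pmf using W N by (subst set_pmf_of_set) auto
  then have L: "L \<in> set_pmf (capped_geometric (real G / real (n\<^sup>2)) h)"
    unfolding law_pick_geometric[OF G n2] .
  note Lf = set_capped_geometric[OF L G n2]
  show "L \<le> h" "0 < L \<Longrightarrow> 0 < G" "L < h \<Longrightarrow> G < n\<^sup>2" using Lf by auto
  show Gs: "G = sum_list (map (product_weight y) (square_list D))" by (simp add: sum_list_square_list G_def total_def)
  have u0: "0 \<le> frac (u * real ?N)" "frac (u * real ?N) < 1" by (simp_all add: frac_lt_1)
  have m: "law (multinomial Q (product_weight y) (square_list D) G L x) = draws Q (square D) (product_weight y) L x"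
      "wf_sampler (multinomial Q (product_weight y) (square_list D) G L x)"
    using law_multinomial[OF distinct_square_list, of G "product_weight y" D L Q x] Lf
    by (auto simp: set_square_list G_def total_def)
  have x1: "x1 \<in> set_pmf (draws Q (square D) (product_weight y) L x)"
    unfolding x1_def R1_def m(1)[symmetric] by (rule run_in_law[OF m(2) u0])
  show u1: "0 \<le> snd R1" "snd R1 < 1" unfolding R1_def using run_snd[OF u0] by auto
  have "dominated n y D (h - L) x1" by (rule dominated_draws[OF dom _ _ x1]) (use Lf G_def in auto)
  then show d1: "dominated n y D 0 x1" by (rule dominated_0)
  have v1: "valid n x1" using d1 by (simp add: dominated_def)
  have "dim x1 \<le> D + 1 \<and> D \<le> dim x1"
    by (rule dim_draws[OF assms(1) dom _ _ _ _ x1]) (use Lf G_def valid_ge_dim[OF assms(1,2)] D_def in auto)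
  then show "D \<le> dim x1" "dim x1 \<le> D + 1" by auto
  note t1 = dominated_total[OF assms(1) d1 order_refl]
  show es: "n\<^sup>2 - G = sum_list (map (excess x1 y) (square_list (dim x1)))"
    using t1(2) by (simp add: sum_list_square_list G_def)
  show "valid n (fst R2)" "dim x1 \<le> dim (fst R2)" "dim (fst R2) \<le> dim x1 + 1" if "L < h"
  proof -
    have Gn: "G < n\<^sup>2" using Lf(3)[OF that] .
    have m2: "law (multinomial Q (excess x1 y) (square_list (dim x1)) (n\<^sup>2 - G) 1 x1) = draws Q (square (dim x1)) (excess x1 y) 1 x1"
      "wf_sampler (multinomial Q (excess x1 y) (square_list (dim x1)) (n\<^sup>2 - G) 1 x1)"
      using law_multinomial[OF distinct_square_list, of "n\<^sup>2 - G" "excess x1 y" "dim x1" 1 Q x1]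
        t1(2) Gn by (auto simp: set_square_list G_def)
    have "fst R2 \<in> set_pmf (draws Q (square (dim x1)) (excess x1 y) 1 x1)"
      unfolding R2_def m2(1)[symmetric] by (rule run_in_law[OF m2(2) u1])
    then obtain k where k: "k \<in> set_pmf (weighted_pmf (square (dim x1)) (excess x1 y))"
      and x2: "fst R2 = shift 1 (chosen Q k) x1" by auto
    note ve = valid_excess[OF assms(1) d1 Gn[unfolded G_def] k]
    show "valid n (fst R2)" "dim x1 \<le> dim (fst R2)" "dim (fst R2) \<le> dim x1 + 1"
      unfolding x2 using ve dim_shift[OF assms(1) v1] by auto
  qed
  show "run (iteration_sampler Q n s h x) u = (if L < h then ((Suc L, fst R2), snd R2) else ((L, x1), snd R1))"
    unfolding iteration_sampler_def Let_def run.simps y_def[symmetric] D_def[symmetric] G_def[symmetric]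
      L_def[symmetric] run_bind R1_def[symmetric]
    by (simp add: case_prod_unfold x1_def[symmetric] run_bind R2_def Let_def)
qed

section \<open>The code of one iteration\<close>

definition low_body :: "stmt list" where
  "low_body = map Basic [Binary Mul 31 28 14, Binary Add 31 31 16, Load 33 31, Binary Sub 33 33 19] @
     Branch Lt 33 15 [Basic (Move 33 15)] [] #
     map Basic [Binary Add 31 31 13, Store 31 33, Binary Add 21 21 33, Binary Add 28 28 13]"

definition low_code :: "stmt list" where
  "low_code = map Basic [Move 21 15, Move 28 15] @ [Loop Lt 28 17 low_body]"

definition geometric_init :: "instr list" where
  "geometric_init = [Binary Mul 21 21 21, Binary Powr 3 22 20, Binary Add 4 3 14, Binary Mul 11 21 4,
     Binary Powr 12 11 20, Binary Sub 5 12 3, Binary Sub 38 11 22, Binary Div 5 5 38, Binary Sub 38 22 21,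
     Binary Mul 5 5 38, Binary Add 5 5 12, Move 6 20]"

definition grow_code :: "stmt list" where
  "grow_code = map Basic [Binary Mul 31 17 14, Binary Add 31 31 16, Load 33 31] @
     [Branch Eq 33 15 [] [Basic (Binary Add 17 17 13)]]"

text \<open>The coefficients \<alpha> and \<beta> are 0 and 1 here, for the weights of
  \<open>y\<close>, and 1 and -1 in \<open>excess_init\<close>, for the excess.\<close>

definition pure_init :: "instr list" where
  "pure_init = [Move 23 7, Binary Sub 18 18 23, Move 24 15, Move 25 13, Move 26 21, Move 27 23]"

definition excess_init :: "instr list" where
  "excess_init = [Binary Sub 18 18 13, Move 24 13, Binary Sub 25 15 13, Binary Sub 26 22 21, Move 27 13]"

definition iteration_code :: "stmt list" where
  "iteration_code = [Branch Le 18 19 [Basic (Move 20 18)] [Basic (Move 20 19)]] @ low_code @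
     map Basic geometric_init @ sample_code @ map Basic pure_init @ multinomial_code @ grow_code @
     [Branch Lt 23 20 (map Basic excess_init @ multinomial_code @ grow_code) []]"

definition iteration_cells :: "nat set" where
  "iteration_cells = {17, 18, 20, 21, 23, 24, 25} \<union> multinomial_cells"

lemma constants_same: "same_registers S M' M \<Longrightarrow> constants M \<Longrightarrow> 13 \<notin> S \<Longrightarrow> 14 \<notin> S \<Longrightarrow> 15 \<notin> S \<Longrightarrow> constants M'"
  by (simp add: constants_def same_registers_def)

text \<open>The part below \<open>h\<close> is \<open>H - G\<close> times a geometric sum in
  \<open>G * X\<close> and \<open>H\<close>, evaluated in constant time as a quotient of differences
  of powers.\<close>

lemma geometric_polynomial:
  fixes G H h :: nat
  assumes "G \<le> H" "0 < H" "0 < h"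
  defines "X \<equiv> H ^ h + 2"
  shows "(real (G * X) ^ h - real (H ^ h)) / (real (G * X) - real H) * (real H - real G) + real (G * X) ^ h
    = real (\<Sum>j\<le>h. geometric_weights G H h j * X ^ j)"
proof -
  \<comment> \<open>The quotient must not be a division by 0: either \<open>G = 0 < H\<close>, or
    \<open>H <= H ^ h < X <= G * X\<close>, where \<open>h > 0\<close> is used.\<close>
  have "G * X \<noteq> H"
  proof (cases "G = 0")
    case False
    have "H ^ 1 \<le> H ^ h" using assms by (intro power_increasing) auto
    then have "H < X" by (simp add: X_def)
    also have "X \<le> G * X" using False by simp
    finally show ?thesis by simp
  qed (use assms in auto)
  then have ne: "real (G * X) - real H \<noteq> 0" by (metis eq_iff_diff_eq_0 of_nat_eq_iff)
  have "real (G * X) ^ h - real (H ^ h) = (real (G * X) - real H) * (\<Sum>i<h. real H ^ (h - Suc i) * real (G * X) ^ i)"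
    unfolding of_nat_power by (rule power_diff_sumr2)
  then have "(real (G * X) ^ h - real (H ^ h)) / (real (G * X) - real H) = (\<Sum>i<h. real H ^ (h - Suc i) * real (G * X) ^ i)"
    using ne by simp
  then have "(real (G * X) ^ h - real (H ^ h)) / (real (G * X) - real H) * (real H - real G) =
      (\<Sum>j<h. real (geometric_weights G H h j * X ^ j))" (is "?A = ?B")
    using assms(1) by (simp add: geometric_weights_def sum_distrib_left sum_distrib_right of_nat_diff power_mult_distrib mult_ac)
  moreover have "real (G * X) ^ h = real (geometric_weights G H h h * X ^ h)"
    by (simp add: geometric_weights_def power_mult_distrib)
  ultimately have "?A + real (G * X) ^ h = ?B + real (geometric_weights G H h h * X ^ h)" by (rule arg_cong2)
  then show ?thesis by (simp only: lessThan_Suc_atMost[symmetric] sum.lessThan_Suc of_nat_add of_nat_sum)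
qed

context bounded_queries begin

lemma wp_grow:
  assumes "constants M" "stores B M x y" "M 17 = real D"
  shows "wpc grow_code 5 (\<lambda>M'. stores B M' x y \<and> M' 17 = real (if x D = 0 then D else D + 1) \<and>
    same_registers {17, 31, 33} M' M) M" (is "wpc _ _ ?P M")
proof -
  have B: "40 \<le> B" and M: "M 16 = real B" "M 13 = 1" "M 14 = 2" "M 15 = 0" "M (2 * D + B) = real_of_int (x D)"
    using assms by (auto simp: stores_def constants_def)
  define M1 where "M1 = M(31 := real D * 2 + real B, 33 := real_of_int (x D))"
  have M1: "fold (upd Q) [Binary Mul 31 17 14, Binary Add 31 31 16, Load 33 31] M = M1"
    using B by (auto simp: M1_def M assms(3) to_nat_cell_address fun_eq_iff)
  have st: "stores B M1 x y" "stores B (M1(17 := z)) x y" for z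
    by (rule stores_cong[OF assms(2)], force simp: M1_def)+
  have "wpc [Branch Eq 33 15 [] [Basic (Binary Add 17 17 13)]] 2 ?P M1"
  proof (rule wpc_Branch[where c = 1])
    show "wpc ((if cmp_val Eq (M1 33) (M1 15) then [] else [Basic (Binary Add 17 17 13)]) @ []) 1 ?P M1"
    proof (cases "x D = 0")
      case True
      then have "?P M1" using st assms(3) by (auto simp: same_registers_def M1_def)
      then show ?thesis using True M by (simp add: M1_def wp_Nil)
    next
      case False
      have "?P (M1(17 := real D + 1))" using False st(2)[of "real D + 1"] by (auto simp: same_registers_def M1_def)
      moreover have "fold (upd Q) [Binary Add 17 17 13] M1 = M1(17 := real D + 1)" using assms(3) M by (simp add: M1_def)
      ultimately show ?thesis using False M wpc_line_only[of "[Binary Add 17 17 13]" ?P M1 1] by (simp add: M1_def)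
    qed
  qed simp
  then show ?thesis unfolding grow_code_def
    by (intro wpc_line[where c = 2]) (auto simp only: M1, auto)
qed

text \<open>Only entries below \<open>dim x\<close> are overwritten; further up the previous
  \<open>y0\<close> must already agree with \<open>low s x\<close>, which is 0 there.\<close>

lemma wp_low:
  assumes "constants M" "stores B M x y0" "M 17 = real (dim x)" "M 19 = real s"
    and "\<And>a. dim x \<le> a \<Longrightarrow> x a = 0" "\<And>a. dim x \<le> a \<Longrightarrow> y0 a = 0"
  shows "wpc low_code (12 * dim x + 3) (\<lambda>M'. stores B M' x (low s x) \<and>
    M' 21 = real_of_int (\<Sum>a<dim x. low s x a) \<and> same_registers {21, 28, 31, 33} M' M) M" (is "wpc _ _ ?P M")
proof -
  let ?D = "dim x"
  define yy where "yy i a = (if a < i then low s x a else y0 a)" for i a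
  define I where "I = (\<lambda>i M'. i \<le> ?D \<and> M' 28 = real i \<and> M' 21 = real_of_int (\<Sum>a<i. low s x a) \<and>
    stores B M' x (yy i) \<and> same_registers {21, 28, 31, 33} M' M)"
  let ?M = "fold (upd Q) [Move 21 15, Move 28 15] M"
  have I0: "I 0 ?M" unfolding I_def
  proof (intro conjI)
    have yy0: "yy 0 = y0" by (simp add: yy_def fun_eq_iff)
    show "stores B ?M x (yy 0)" unfolding yy0 by (rule stores_cong[OF assms(2)]) auto
  qed (use assms(1) in \<open>auto simp: constants_def same_registers_def\<close>)
  have "wpc [Loop Lt 28 17 low_body] ((?D - 0) * 12 + 1) ?P ?M"
  proof (rule wpc_while[where R = "Wellfounded.measure (\<lambda>i. ?D - i)" and I = I and T = "\<lambda>i. (?D - i) * 12 + 1"])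
    fix i M' assume "I i M'" and c: "cmp_val Lt (M' 28) (M' 17)"
    then have m: "M' 28 = real i" "M' 21 = real_of_int (\<Sum>a<i. low s x a)"
      and st: "stores B M' x (yy i)" and sr: "same_registers {21, 28, 31, 33} M' M" by (auto simp: I_def)
    note s = same_registersD[OF sr]
    have m': "M' 13 = 1" "M' 14 = 2" "M' 15 = 0" "M' 17 = real ?D" "M' 19 = real s"
      using s[of 13] s[of 14] s[of 15] s[of 17] s[of 19] assms by (auto simp: constants_def)
    have iD: "i < ?D" using c m m' by simp
    have B: "40 \<le> B" and B': "M' 16 = real B" "M' (2 * i + B) = real_of_int (x i)" using st by (auto simp: stores_def)
    define M1 where "M1 = M'(31 := real i * 2 + real B, 33 := real_of_int (x i) - real s)"
    define M2 where "M2 = M1(33 := real_of_int (low s x i))"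
    define M3 where "M3 = M2(31 := real i * 2 + real B + 1, Suc (2 * i + B) := real_of_int (low s x i),
      21 := real_of_int (\<Sum>a<Suc i. low s x a), 28 := real i + 1)"
    have M1: "fold (upd Q) [Binary Mul 31 28 14, Binary Add 31 31 16, Load 33 31, Binary Sub 33 33 19] M' = M1"
      using B by (auto simp: M1_def B' m m' to_nat_cell_address fun_eq_iff)
    have M3: "fold (upd Q) [Binary Add 31 31 13, Store 31 33, Binary Add 21 21 33, Binary Add 28 28 13] M2 = M3"
      using B by (auto simp: M1_def M2_def M3_def B' m m' to_nat_cell_address fun_eq_iff)
    have neq: "2 * a + B \<noteq> j" "Suc (2 * a + B) \<noteq> j" if "j < 40" for a j using B that by auto
    have "I (Suc i) M3" unfolding I_def
    proof (intro conjI)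
      show "stores B M3 x (yy (Suc i))" unfolding stores_def
      proof (intro conjI allI)
        fix a
        have p: "2 * a + B \<noteq> Suc (2 * i + B)" "Suc (2 * a + B) = Suc (2 * i + B) \<longleftrightarrow> a = i" by presburger+
        show "M3 (2 * a + B) = real_of_int (x a)"
          using st p(1) neq(1)[of _ a] by (simp add: M3_def M2_def M1_def stores_def)
        have "M3 (Suc (2 * a + B)) = (if a = i then real_of_int (low s x i) else M' (Suc (2 * a + B)))"
          using neq[of _ a] neq(2)[of _ i] by (auto simp: M3_def M2_def M1_def fun_upd_def)
        also have "\<dots> = real_of_int (yy (Suc i) a)" using st by (auto simp: stores_def yy_def)
        finally show "M3 (Suc (2 * a + B)) = real_of_int (yy (Suc i) a)" .
      qed (use B B' in \<open>auto simp: M3_def M2_def M1_def\<close>)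
      show "same_registers {21, 28, 31, 33} M3 M"
        using sr B by (auto simp: same_registers_def M3_def M2_def M1_def)
    qed (use iD B in \<open>auto simp: M3_def\<close>)
    then have l3: "wpc (map Basic [Binary Add 31 31 13, Store 31 33, Binary Add 21 21 33, Binary Add 28 28 13]) 4 (I (Suc i)) M2"
      by (intro wpc_line_only) (simp_all only: M3, auto)
    have "wpc (Branch Lt 33 15 [Basic (Move 33 15)] [] #
        map Basic [Binary Add 31 31 13, Store 31 33, Binary Add 21 21 33, Binary Add 28 28 13]) 6 (I (Suc i)) M1"
    proof (rule wpc_Branch[where c = 5])
      show "wpc ((if cmp_val Lt (M1 33) (M1 15) then [Basic (Move 33 15)] else []) @
        map Basic [Binary Add 31 31 13, Store 31 33, Binary Add 21 21 33, Binary Add 28 28 13]) 5 (I (Suc i)) M1"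
      proof (cases "x i < int s")
        case True
        then have M2: "M2 = fold (upd Q) [Move 33 15] M1" using m' by (auto simp: M2_def M1_def low_def)
        have "real_of_int (x i) < real s" using True by linarith
        then show ?thesis
          using wpc_line[of "[Move 33 15]", OF _ l3[unfolded M2], of 5] m' by (simp add: M1_def)
      next
        case False
        then have "M2 = M1" by (auto simp: M2_def M1_def low_def fun_eq_iff)
        moreover have "\<not> real_of_int (x i) < real s" using False by linarith
        ultimately show ?thesis using wpc_mono[OF l3, of "I (Suc i)" 5] m' by (simp add: M1_def)
      qed
    qed simp
    then have "wpc low_body 10 (I (Suc i)) M'" unfolding low_body_def
      by (intro wpc_line[where c = 6]) (simp_all only: M1, auto)
    moreover have "(?D - i) * 12 = 12 + (?D - Suc i) * 12" using iD by simp
    ultimately show "\<exists>b c. (b, i) \<in> Wellfounded.measure (\<lambda>i. ?D - i) \<and> c + 1 + ((?D - b) * 12 + 1) \<le> (?D - i) * 12 + 1 \<and> wpc low_body c (I b) M'"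
      using iD by (intro exI[of _ "Suc i"] exI[of _ 10]) auto
  next
    fix i M' assume I: "I i M'" and c: "\<not> cmp_val Lt (M' 28) (M' 17)"
    then have sr: "same_registers {21, 28, 31, 33} M' M" by (auto simp: I_def)
    have "M' 17 = real ?D" using same_registersD[OF sr, of 17] assms by simp
    then have i: "i = ?D" using I c by (auto simp: I_def)
    have "yy ?D = low s x" by (auto simp: yy_def low_def assms(5,6) fun_eq_iff)
    then show "1 \<le> (?D - i) * 12 + 1 \<and> ?P M'" using I by (auto simp: I_def i)
  qed (use I0 in auto)
  then show ?thesis unfolding low_code_def
    by (intro wpc_line[where c = "?D * 12 + 1"]) auto
qed

end

context bounded_queries begin

lemma wp_iteration:
  assumes con: "constants M" and st: "stores B M x y0" and y0: "\<And>a. dim x \<le> a \<Longrightarrow> y0 a = 0"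
    and m17: "M 17 = real (dim x)" and m18: "M 18 = real r" and r: "0 < r" and m19: "M 19 = real s" and s: "0 < s"
    and m22: "M 22 = real (n\<^sup>2)" and n: "0 < n" and v: "valid n x" and u: "0 \<le> M 2" "M 2 < 1" and k: "s < 2 ^ k"
  defines "R \<equiv> run (iteration_sampler Q n s (min s r) x) (M 2)"
  shows "wpc iteration_code (200 * ((dim x + 2)\<^sup>2 * (k + 1))) (\<lambda>M'. stores B M' (snd (fst R)) (low s x) \<and>
    M' 17 = real (dim (snd (fst R))) \<and> M' 18 = real (r - fst (fst R)) \<and> M' 2 = snd R \<and>
    same_registers iteration_cells M' M) M" (is "wpc _ _ ?P M")
proof -
  define h where "h = min s r"
  define y where "y = low s x"
  define D where "D = dim x"
  define G where "G = total y D"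
  define N where "N = (n\<^sup>2) ^ h"
  define L where "L = pick (geometric_weights G (n\<^sup>2) h) h (nat \<lfloor>M 2 * real N\<rfloor>)"
  define R1 where "R1 = run (multinomial Q (product_weight y) (square_list D) G L x) (frac (M 2 * real N))"
  define x1 where "x1 = fst R1"
  define R2 where "R2 = run (multinomial Q (excess x1 y) (square_list (dim x1)) (n\<^sup>2 - G) 1 x1) (snd R1)"
  have h: "0 < h" "h \<le> s" "h \<le> r" using r s by (auto simp: h_def)
  note facts = iteration_facts(1-5)[OF n v h(2,1) u, folded y_def D_def, folded G_def, folded N_def, folded L_def]
    iteration_facts(6-)[OF n v h(2,1) u, where Q = Q, folded y_def D_def, folded G_def, folded N_def, folded L_def,
      folded R1_def, folded x1_def, folded R2_def]
  have LG: "L \<le> h" "G \<le> n\<^sup>2" "0 < L \<Longrightarrow> 0 < G" "L < h \<Longrightarrow> G < n\<^sup>2" "G = sum_list (map (product_weight y) (square_list D))"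
    and x1: "dominated n y D 0 x1" "D \<le> dim x1" "dim x1 \<le> D + 1" "0 \<le> snd R1" "snd R1 < 1"
    and es: "n\<^sup>2 - G = sum_list (map (excess x1 y) (square_list (dim x1)))"
    and x2: "L < h \<Longrightarrow> valid n (fst R2)" "L < h \<Longrightarrow> dim x1 \<le> dim (fst R2)" "L < h \<Longrightarrow> dim (fst R2) \<le> dim x1 + 1"
    and R: "R = (if L < h then ((Suc L, fst R2), snd R2) else ((L, x1), snd R1))"
    using facts unfolding R_def h_def by blast+
  have y_nn: "0 \<le> y a" for a by (simp add: y_def low_def)
  have hk: "h < 2 ^ k" "L < 2 ^ k" using h LG(1) k by auto
  have v1: "valid n x1" using x1(1) by (simp add: dominated_def)
  have D1: "1 \<le> D" unfolding D_def by (rule potential_ge(2)[OF n v])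
  have base: "constants M'" "M' 16 = real B" "M' 19 = real s" "M' 22 = real (n\<^sup>2)" if "same_registers iteration_cells M' M" for M'
    using that con st m19 m22 constants_same[OF that con] same_registersD[OF that, of 16]
      same_registersD[OF that, of 19] same_registersD[OF that, of 22]
    by (auto simp: iteration_cells_def multinomial_cells_def stores_def)
  let ?c2 = "(D + 1) * (D + 1) * (17 * k + 50)"
  \<comment> \<open>The blocks are treated from the last to the first, so that each finds the
    statement about its continuation ready.\<close>
  have step5: "wpc [Branch Lt 23 20 (map Basic excess_init @ multinomial_code @ grow_code) []] (?c2 + 14) ?P M5"
    if st5: "stores B M5 x1 y" and m5: "M5 17 = real (dim x1)" "M5 18 = real (r - L)" "M5 21 = real G" "M5 23 = real L"
      "M5 20 = real h" "M5 2 = snd R1" and sr5: "same_registers iteration_cells M5 M" for M5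
  proof (rule wpc_Branch[where c = "?c2 + 13"])
    note b5 = base[OF sr5]
    show "wpc ((if cmp_val Lt (M5 23) (M5 20) then map Basic excess_init @ multinomial_code @ grow_code else []) @ []) (?c2 + 13) ?P M5"
    proof (cases "L < h")
      case False
      then have "?P M5" using st5 m5 sr5 R by (auto simp: y_def)
      then show ?thesis using False m5 by (simp add: wp_Nil)
    next
      case True
      define M6 where "M6 = fold (upd Q) excess_init M5"
      have m6: "M6 18 = real (r - Suc L)" "M6 24 = 1" "M6 25 = -1" "M6 26 = real (n\<^sup>2 - G)" "M6 27 = real 1"
        using b5 m5 True h LG(2) by (auto simp: M6_def excess_init_def constants_def of_nat_diff)
      have fr6: "M6 i = M5 i" if "i \<notin> {18, 24, 25, 26, 27}" for i
        using that by (simp add: M6_def excess_init_def)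
      have st6: "stores B M6 x1 y" by (rule stores_cong[OF st5]) (auto intro!: fr6)
      have c6: "constants M6" using b5(1) by (simp add: constants_def fr6)
      have "wpc multinomial_code (dim x1 * dim x1 * (17 * k + 50) + 3) (\<lambda>M'.
        stores B M' (fst R2) y \<and> M' 2 = snd R2 \<and> same_registers multinomial_cells M' M6) M6"
      proof -
        have "\<forall>(a, b)\<in>square (dim x1). real (excess x1 y (a, b)) = 1 * (real_of_int (x1 a) * real_of_int (x1 b)) + - 1 * (real_of_int (y a) * real_of_int (y b))"
        proof (intro ballI, clarify)
          fix a b
          have "real (excess x1 y (a, b)) = real (product_weight x1 (a, b)) - real (product_weight y (a, b))"
            unfolding excess_def by (rule of_nat_diff[OF product_weight_mono[OF x1(1)]])
          also have "\<dots> = real_of_int (x1 a * x1 b) - real_of_int (y a * y b)"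
            using y_nn valid_nonneg[OF v1] by (simp add: product_weight_def)
          finally show "real (excess x1 y (a, b)) = 1 * (real_of_int (x1 a) * real_of_int (x1 b)) + - 1 * (real_of_int (y a) * real_of_int (y b))"
            by simp
        qed
        then show ?thesis
          using wp_multinomial[OF c6 st6 _ m6(2,3,4,5) es, of k] LG(4)[OF True] x1(4,5) fr6 m5 k s
          by (simp add: R2_def fr6 m5)
      qed
      moreover have "wpc grow_code 5 ?P M7"
        if "stores B M7 (fst R2) y \<and> M7 2 = snd R2 \<and> same_registers multinomial_cells M7 M6" for M7
      proof (rule wpc_mono[OF wp_grow[where B = B and x = "fst R2" and y = y and D = "dim x1"]])
        have s7: "M7 i = M6 i" if "i < 40" "i \<notin> multinomial_cells" for i
          using \<open>stores B M7 (fst R2) y \<and> _\<close> that by (auto simp: same_registers_def)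
        show "constants M7" using c6 s7[of 13] s7[of 14] s7[of 15] by (simp add: constants_def multinomial_cells_def)
        show "M7 17 = real (dim x1)" using s7[of 17] fr6[of 17] m5 by (simp add: multinomial_cells_def)
        fix M8 assume M8: "stores B M8 (fst R2) y \<and> M8 17 = real (if fst R2 (dim x1) = 0 then dim x1 else dim x1 + 1) \<and>
          same_registers {17, 31, 33} M8 M7"
        have "M8 18 = M7 18" "M8 2 = M7 2" using M8 by (auto simp: same_registers_def)
        moreover have "M7 18 = M6 18" using s7[of 18] by (simp add: multinomial_cells_def)
        moreover have "same_registers iteration_cells M8 M"
          unfolding same_registers_def
        proof (intro allI impI)
          fix i :: nat assume i: "i < 40" "i \<notin> iteration_cells"
          then have "M8 i = M7 i" using M8 by (auto simp: same_registers_def iteration_cells_def multinomial_cells_def)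
          also have "\<dots> = M6 i" using s7[of i] i by (auto simp: iteration_cells_def)
          also have "\<dots> = M5 i" using i by (intro fr6) (auto simp: iteration_cells_def multinomial_cells_def)
          also have "\<dots> = M i" using sr5 i by (auto simp: same_registers_def)
          finally show "M8 i = M i" .
        qed
        ultimately show "?P M8" using M8 that True R m6(1) dim_grow[OF n x2[OF True]] by (auto simp: y_def)
      qed (use that in auto)
      ultimately have "wpc (multinomial_code @ grow_code) (?c2 + 8) ?P M6"
      proof (intro wpc_append[where c = "dim x1 * dim x1 * (17 * k + 50) + 3" and c' = 5], elim wpc_mono)
        have "dim x1 * dim x1 * (17 * k + 50) \<le> ?c2" using x1(3) by (intro mult_le_mono) auto
        then show "dim x1 * dim x1 * (17 * k + 50) + 3 + 5 \<le> ?c2 + 8" by simp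
      qed auto
      then have "wpc (map Basic excess_init @ multinomial_code @ grow_code) (?c2 + 13) ?P M5"
        by (intro wpc_line[where c = "?c2 + 8"]) (auto simp: M6_def excess_init_def)
      then show ?thesis using True m5 by simp
    qed
  qed simp
  let ?c1 = "D * D * (17 * k + 50)"
  let ?tail = "[Branch Lt 23 20 (map Basic excess_init @ multinomial_code @ grow_code) []]"
  have step3: "wpc (map Basic pure_init @ multinomial_code @ grow_code @ ?tail) (?c1 + ?c2 + 28) ?P M3"
    if st3: "stores B M3 x y" and m3: "M3 17 = real D" "M3 18 = real r" "M3 21 = real G" "M3 7 = real L"
      "M3 20 = real h" "M3 2 = frac (M 2 * real N)" and sr3: "same_registers iteration_cells M3 M" for M3
  proof -
    note b3 = base[OF sr3]
    define M4 where "M4 = fold (upd Q) pure_init M3"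
    have m4: "M4 23 = real L" "M4 18 = real (r - L)" "M4 24 = 0" "M4 25 = 1" "M4 26 = real G" "M4 27 = real L"
      using b3 m3 h LG by (auto simp: M4_def pure_init_def constants_def of_nat_diff)
    have fr4: "M4 i = M3 i" if "i \<notin> {18, 23, 24, 25, 26, 27}" for i
      using that by (simp add: M4_def pure_init_def)
    have st4: "stores B M4 x y" by (rule stores_cong[OF st3]) (auto intro!: fr4)
    have c4: "constants M4" using b3(1) by (simp add: constants_def fr4)
    have "wpc multinomial_code (?c1 + 3) (\<lambda>M'.
        stores B M' x1 y \<and> M' 2 = snd R1 \<and> same_registers multinomial_cells M' M4) M4"
    proof -
      have "\<forall>(a, b)\<in>square D. real (product_weight y (a, b)) = 0 * (real_of_int (x a) * real_of_int (x b)) + 1 * (real_of_int (y a) * real_of_int (y b))"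
        using y_nn by (auto simp: product_weight_def)
      then show ?thesis
        using wp_multinomial[OF c4 st4 _ m4(3,4,5,6) LG(5), of k] LG(3) fr4 m3 hk
        by (simp add: R1_def x1_def fr4 m3 frac_lt_1)
    qed
    moreover have "wpc (grow_code @ ?tail) (?c2 + 19) ?P M7"
      if M7: "stores B M7 x1 y \<and> M7 2 = snd R1 \<and> same_registers multinomial_cells M7 M4" for M7
    proof (rule wpc_append[OF wpc_mono[OF wp_grow[where B = B and x = x1 and y = y and D = D]], where c' = "?c2 + 14"])
      have s7: "M7 i = M4 i" if "i < 40" "i \<notin> multinomial_cells" for i
        using M7 that by (auto simp: same_registers_def)
      show "constants M7" using c4 s7[of 13] s7[of 14] s7[of 15] by (simp add: constants_def multinomial_cells_def)
      show "M7 17 = real D" using s7[of 17] fr4[of 17] m3 by (simp add: multinomial_cells_def)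
      fix M8 assume M8: "stores B M8 x1 y \<and> M8 17 = real (if x1 D = 0 then D else D + 1) \<and> same_registers {17, 31, 33} M8 M7"
      then have s8: "M8 i = M7 i" if "i < 40" "i \<notin> {17, 31, 33}" for i using that by (auto simp: same_registers_def)
      show "wpc ?tail (?c2 + 14) ?P M8"
      proof (rule step5)
        show "M8 17 = real (dim x1)" using M8 dim_grow[OF n v1 x1(2,3)] by simp
        show "M8 18 = real (r - L)" "M8 21 = real G" "M8 23 = real L" "M8 20 = real h" "M8 2 = snd R1"
          using s8[of 18] s8[of 21] s8[of 23] s8[of 20] s8[of 2] s7[of 18] s7[of 21] s7[of 23] s7[of 20]
            M7 m4 fr4[of 21] fr4[of 20] m3 by (auto simp: multinomial_cells_def)
        show "same_registers iteration_cells M8 M"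
          unfolding same_registers_def
        proof (intro allI impI)
          fix i :: nat assume i: "i < 40" "i \<notin> iteration_cells"
          then have "M8 i = M7 i" by (intro s8) (auto simp: iteration_cells_def multinomial_cells_def)
          also have "\<dots> = M4 i" using s7[of i] i by (auto simp: iteration_cells_def)
          also have "\<dots> = M3 i" using i by (intro fr4) (auto simp: iteration_cells_def multinomial_cells_def)
          also have "\<dots> = M i" using sr3 i by (auto simp: same_registers_def)
          finally show "M8 i = M i" .
        qed
      qed (use M8 in auto)
    qed (use M7 in auto)
    ultimately have "wpc (multinomial_code @ grow_code @ ?tail) (?c1 + ?c2 + 22) ?P M4"
      by (intro wpc_append[where c = "?c1 + 3" and c' = "?c2 + 19"], elim wpc_mono) auto
    then show ?thesis
      by (intro wpc_line[where c = "?c1 + ?c2 + 22"]) (auto simp: M4_def pure_init_def)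
  qed
  let ?tail3 = "map Basic pure_init @ multinomial_code @ grow_code @ ?tail"
  have step2: "wpc (map Basic geometric_init @ sample_code @ ?tail3) (?c1 + ?c2 + 17 * k + 46) ?P M1"
    if st1: "stores B M1 x y" and m1: "M1 20 = real h" "M1 21 = real_of_int (\<Sum>a<D. y a)"
      and sr1: "same_registers {20, 21, 28, 31, 33} M1 M" for M1
  proof -
    have sr1': "same_registers iteration_cells M1 M"
      using sr1 by (auto simp: same_registers_def iteration_cells_def multinomial_cells_def)
    note b1 = base[OF sr1'] same_registersD[OF sr1]
    define M2 where "M2 = fold (upd Q) geometric_init M1"
    have "real G = real_of_int (int G)" by simp
    also have "\<dots> = real_of_int (\<Sum>a<D. y a) * real_of_int (\<Sum>a<D. y a)"
      unfolding G_def total_eq[of y D, OF y_nn] by (simp add: power2_eq_square)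
    finally have G: "real_of_int (\<Sum>a<D. y a) * real_of_int (\<Sum>a<D. y a) = real G" ..
    have pw: "real (n\<^sup>2) powr real h = real N" using n by (simp add: N_def powr_realpow)
    \<comment> \<open>The base is 0 if \<open>G = 0\<close>; then \<open>powr\<close> gives 0, in
      agreement with the natural power because \<open>h > 0\<close>.\<close>
    have pw2: "real (G * (N + 2)) powr real h = real (G * (N + 2)) ^ h"
    proof (cases "G = 0")
      case False
      then have "0 < G * (N + 2)" by simp
      then show ?thesis by (simp only: powr_realpow of_nat_0_less_iff)
    qed (use h in \<open>simp add: zero_power\<close>)
    have e: "M2 21 = M1 21 * M1 21" "M2 3 = M1 22 powr M1 20" "M2 4 = M2 3 + M1 14" "M2 6 = M1 20"
      "M2 5 = ((M2 21 * M2 4) powr M1 20 - M2 3) / (M2 21 * M2 4 - M1 22) * (M1 22 - M2 21) + (M2 21 * M2 4) powr M1 20"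
      by (simp_all add: M2_def geometric_init_def)
    have m2: "M2 21 = real G" "M2 3 = real N" "M2 4 = real (N + 2)" "M2 6 = real h"
      using e(1-4) m1 G pw b1 by (auto simp: constants_def)
    have X: "real G * real (N + 2) = real (G * (N + 2))" by (simp only: of_nat_mult)
    have m25: "M2 5 = real (\<Sum>j\<le>h. geometric_weights G (n\<^sup>2) h j * (N + 2) ^ j)"
      unfolding e(5) m2(1-3) m1 b1(4) X pw2 using geometric_polynomial[OF LG(2) _ h(1)] n by (simp only: N_def) simp
    have fr2: "M2 i = M1 i" if "i \<notin> {3, 4, 5, 6, 11, 12, 21, 38}" for i
      using that by (simp add: M2_def geometric_init_def)
    have st2: "stores B M2 x y" by (rule stores_cong[OF st1]) (auto intro!: fr2)
    have c2: "constants M2" using b1(1) by (simp add: constants_def fr2)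
    have u2: "M2 2 = M 2" using fr2[of 2] b1(5)[of 2] by simp
    have "wpc sample_code (17 * k + 6) (\<lambda>M'. M' 2 = frac (M 2 * real N) \<and>
       M' 7 = real L \<and> (\<forall>i. i \<notin> sample_cells \<longrightarrow> M' i = M2 i)) M2"
      unfolding L_def u2[symmetric]
      by (rule wp_sample[where h = h]) (use c2 m2 m25 u2 u hk sum_geometric_weights[OF LG(2)] n N_def in auto)
    then have "wpc (sample_code @ ?tail3) (?c1 + ?c2 + 17 * k + 34) ?P M2"
    proof (intro wpc_append[where c = "17 * k + 6" and c' = "?c1 + ?c2 + 28"], elim wpc_mono)
      fix M3 assume M3: "M3 2 = frac (M 2 * real N) \<and> M3 7 = real L \<and> (\<forall>i. i \<notin> sample_cells \<longrightarrow> M3 i = M2 i)"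
      then have s3: "M3 i = M2 i" if "i \<notin> sample_cells" for i using that by auto
      show "wpc ?tail3 (?c1 + ?c2 + 28) ?P M3"
      proof (rule step3)
        show "stores B M3 x y" by (rule stores_cong[OF st2]) (auto intro!: s3 simp: sample_cells_def)
        show "M3 17 = real D" "M3 18 = real r" "M3 21 = real G" "M3 20 = real h"
          using s3[of 17] s3[of 18] s3[of 21] s3[of 20] fr2[of 17] fr2[of 18] fr2[of 20] b1(5)[of 17] b1(5)[of 18] m1 m2 m17 m18
          by (auto simp: sample_cells_def D_def)
        show "same_registers iteration_cells M3 M"
          unfolding same_registers_def
        proof (intro allI impI)
          fix i :: nat assume i: "i < 40" "i \<notin> iteration_cells"
          then have "M3 i = M2 i" by (intro s3) (auto simp: iteration_cells_def multinomial_cells_def sample_cells_def)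
          also have "\<dots> = M1 i" using i by (intro fr2) (auto simp: iteration_cells_def multinomial_cells_def)
          also have "\<dots> = M i" using sr1' i by (auto simp: same_registers_def)
          finally show "M3 i = M i" .
        qed
      qed (use M3 in auto)
    qed auto
    then show ?thesis
      by (intro wpc_line[where c = "?c1 + ?c2 + 17 * k + 34"]) (auto simp: M2_def geometric_init_def)
  qed
  let ?tail2 = "map Basic geometric_init @ sample_code @ ?tail3"
  have step1: "wpc (low_code @ ?tail2) (?c1 + ?c2 + 17 * k + 12 * D + 49) ?P (M(20 := real h))"
  proof (rule wpc_append[OF wpc_mono[OF wp_low[where B = B and x = x and ?y0.0 = y0 and s = s]], where c' = "?c1 + ?c2 + 17 * k + 46"])
    show "stores B (M(20 := real h)) x y0" by (rule stores_cong[OF st]) auto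
    fix M1 assume M1: "stores B M1 x (low s x) \<and> M1 21 = real_of_int (\<Sum>a<dim x. low s x a) \<and>
      same_registers {21, 28, 31, 33} M1 (M(20 := real h))"
    show "wpc ?tail2 (?c1 + ?c2 + 17 * k + 46) ?P M1"
      by (rule step2) (use M1 in \<open>auto simp: y_def D_def same_registers_def\<close>)
  qed (use con m17 m19 y0 valid_ge_dim[OF n v] in \<open>auto simp: constants_def D_def\<close>)
  have "wpc iteration_code (?c1 + ?c2 + 17 * k + 12 * D + 51) ?P M"
    unfolding iteration_code_def append.simps(2) append.simps(1)
  proof (rule wpc_Branch[where c = "?c1 + ?c2 + 17 * k + 12 * D + 50"])
    show "wpc ((if cmp_val Le (M 18) (M 19) then [Basic (Move 20 18)] else [Basic (Move 20 19)]) @ low_code @ ?tail2)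
      (?c1 + ?c2 + 17 * k + 12 * D + 50) ?P M"
    proof (cases "r \<le> s")
      case True
      then have e: "M(20 := real h) = fold (upd Q) [Move 20 18] M" using m18 by (simp add: h_def)
      show ?thesis using True m18 m19 wpc_line[of "[Move 20 18]", OF _ step1[unfolded e], of "?c1 + ?c2 + 17 * k + 12 * D + 50"] by simp
    next
      case False
      then have e: "M(20 := real h) = fold (upd Q) [Move 20 19] M" using m19 by (simp add: h_def)
      show ?thesis using False m18 m19 wpc_line[of "[Move 20 19]", OF _ step1[unfolded e], of "?c1 + ?c2 + 17 * k + 12 * D + 50"] by simp
    qed
  qed simp
  note main = this
  \<comment> \<open>The main terms are the two multinomial loops, over \<open>D ^ 2\<close> and at
    most \<open>(D + 1) ^ 2\<close> pairs.\<close>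
  have le: "?c1 + ?c2 + 17 * k + 12 * D + 51 \<le> 200 * ((D + 2)\<^sup>2 * (k + 1))"
    by (simp add: power2_eq_square algebra_simps)
  show ?thesis unfolding D_def[symmetric] by (rule wpc_mono[OF main _ le])
qed

end

subsection \<open>The whole program\<close>

text \<open>Growth by at most 2 (one from the draws with weights of \<open>y\<close>, one from the
  last move) lets the accumulated cost bound the dimension. Growth by at most \<open>l\<close> keeps
  the output below the array of counts.\<close>

lemma iteration_dim:
  assumes "0 < n" "valid n x" "h \<le> s" "0 < h" "0 \<le> u" "u < 1"
    and "run (iteration_sampler Q n s h x) u = ((l, x'), u')"
  shows "valid n x'" "1 \<le> l" "l \<le> h" "dim x \<le> dim x'" "dim x' \<le> dim x + l" "dim x' \<le> dim x + 2" "0 \<le> u'" "u' < 1"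
proof -
  note f = iteration_facts(1)[OF assms(1-6)] iteration_facts(6-)[OF assms(1-6), where Q = Q]
  define L where "L = pick (geometric_weights (total (low s x) (dim x)) (n\<^sup>2) h) h (nat \<lfloor>u * real ((n\<^sup>2) ^ h)\<rfloor>)"
  define R1 where "R1 = run (multinomial Q (product_weight (low s x)) (square_list (dim x)) (total (low s x) (dim x)) L x)
    (frac (u * real ((n\<^sup>2) ^ h)))"
  define R2 where "R2 = run (multinomial Q (excess (fst R1) (low s x)) (square_list (dim (fst R1)))
    (n\<^sup>2 - total (low s x) (dim x)) 1 (fst R1)) (snd R1)"
  note f = f[folded L_def, folded R1_def, folded R2_def]
  have x1: "fst R1 = x" if "L = 0"
    unfolding R1_def that by (cases "square_list (dim x)") auto
  have d: "dim (fst R1) \<le> dim x + L" using f(4) x1 by (cases "L = 0") auto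
  have v1: "valid n (fst R1)" using f(2) by (simp add: dominated_def)
  have u2: "0 \<le> snd R2 \<and> snd R2 < 1" unfolding R2_def by (rule run_snd[OF f(5,6)])
  have "valid n x' \<and> 1 \<le> l \<and> l \<le> h \<and> dim x \<le> dim x' \<and> dim x' \<le> dim x + l \<and> dim x' \<le> dim x + 2 \<and> 0 \<le> u' \<and> u' < 1"
  proof (cases "L < h")
    case True
    then have e: "l = Suc L" "x' = fst R2" "u' = snd R2" using f(11) assms(7) by auto
    then show ?thesis using True f(3,4) f(8-10)[OF True] u2 d by auto
  next
    case False
    then have e: "l = L" "x' = fst R1" "u' = snd R1" using f(11) assms(7) by auto
    then show ?thesis using False f(1,3,4,5,6) d v1 assms(4) by auto
  qed
  then show "valid n x'" "1 \<le> l" "l \<le> h" "dim x \<le> dim x'" "dim x' \<le> dim x + l" "dim x' \<le> dim x + 2" "0 \<le> u'" "u' < 1" by auto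
qed

text \<open>Makes the natural subtraction \<open>snd R - t\<close> in \<open>wp_process\<close>
  exact.\<close>

lemma process_sampler_mono: "t \<le> snd (fst (run (process_sampler Q n s f i r x t) u))"
proof (induction i arbitrary: r x t u)
  case (Suc i)
  show ?case
  proof (cases "r = 0")
    case False
    obtain l x' u' where R: "run (iteration_sampler Q n s (min s r) x) u = ((l, x'), u')" by (metis prod.exhaust)
    have "t + f (dim x) \<le> snd (fst (run (process_sampler Q n s f i (r - l) x' (t + f (dim x))) u'))" by (rule Suc)
    then show ?thesis using False R by (simp add: run_bind)
  qed simp
qed simp

definition iteration_cost :: "nat \<Rightarrow> nat \<Rightarrow> nat" where
  "iteration_cost k D = (D + 2)\<^sup>2 * (k + 1)"

text \<open>The offset is \<open>14 = 2 * 7\<close>: the loop starts with \<open>x 7\<close>, which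
  belongs in cell 8.\<close>

definition output_init :: "instr list" where
  "output_init = [Move 0 17, Move 7 16, Const 4 14, Binary Add 1 16 4, Const 2 8, Move 3 17, Const 4 1, Const 5 2]"

definition output_body :: "instr list" where
  "output_body = [Load 6 1, Store 2 6, Binary Add 1 1 5, Binary Add 2 2 4]"

text \<open>Each of the cells 1 to 7 first receives the address of its own entry, which
  \<open>Load\<close> then replaces by the content, so no further register is involved. Cell 6
  serves as the constant 2 until its turn comes.\<close>

definition output_final :: "instr list" where
  "output_final = [Move 1 7, Const 6 2, Binary Add 2 1 6, Binary Add 3 2 6, Binary Add 4 3 6, Binary Add 5 4 6,
     Binary Add 7 5 6, Binary Add 7 7 6, Binary Sub 6 7 6,
     Load 1 1, Load 2 2, Load 3 3, Load 4 4, Load 5 5, Load 6 6, Load 7 7]"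

text \<open>The loop overwrites all registers from 8 on; the cells 1 to 7, which it uses itself, come last.\<close>

definition output_code :: "stmt list" where
  "output_code = map Basic output_init @ [Loop Le 2 3 (map Basic output_body)] @ map Basic output_final"

text \<open>The first two instructions reduce the variate to its fractional part. The array starts
  at \<open>m + 40\<close>, beyond the cells \<open>0\<close> to \<open>m + 1\<close> that the
  output may fill, and \<open>powr\<close> with exponent \<open>1 / 2\<close> provides the square
  root.\<close>

definition main_init :: "instr list" where
  "main_init = [Unary Floor 10 2, Binary Sub 2 2 10, Const 13 1, Const 14 2, Const 16 40, Binary Add 16 16 1,
     Const 17 1, Move 18 1, Binary Div 11 13 14, Binary Powr 19 0 11, Unary Floor 19 19, Binary Mul 22 0 0, Store 16 0]"

definition main_code :: "stmt list" where
  "main_code = map Basic main_init @ [Loop Lt 15 18 iteration_code] @ output_code"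

context bounded_queries begin

lemma wp_process:
  assumes con: "constants M" and st: "stores B M x y0" and y0: "\<And>a. dim x \<le> a \<Longrightarrow> y0 a = 0"
    and m17: "M 17 = real (dim x)" and m18: "M 18 = real r" and m19: "M 19 = real s" and s: "0 < s"
    and m22: "M 22 = real (n\<^sup>2)" and n: "0 < n" and v: "valid n x" and u: "0 \<le> M 2" "M 2 < 1" and k: "s < 2 ^ k"
    and d: "dim x \<le> 1"
  defines "R \<equiv> fst (run (process_sampler Q n s (iteration_cost k) r r x 0) (M 2))"
  shows "wpc [Loop Lt 15 18 iteration_code] (201 * snd R + 1) (\<lambda>M'. (\<exists>y. stores B M' (fst R) y) \<and>
    M' 17 = real (dim (fst R)) \<and> dim (fst R) \<le> 1 + snd R \<and> dim (fst R) \<le> r + 1) M" (is "wpc _ _ ?P M")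
proof -
  \<comment> \<open>\<open>dim x' <= 1 + t\<close> will pay for the output;
    \<open>dim x' + r' <= r + 1\<close> keeps it away from the array.\<close>
  define I where "I = (\<lambda>(i, t) M'. \<exists>x' r' y. r' \<le> i \<and> stores B M' x' y \<and> (\<forall>a\<ge>dim x'. y a = 0) \<and>
    M' 17 = real (dim x') \<and> M' 18 = real r' \<and> valid n x' \<and> 0 \<le> M' 2 \<and> M' 2 < 1 \<and> dim x' \<le> 1 + t \<and> dim x' + r' \<le> r + 1 \<and>
    fst (run (process_sampler Q n s (iteration_cost k) i r' x' t) (M' 2)) = R \<and> same_registers iteration_cells M' M)"
  have "wpc [Loop Lt 15 18 iteration_code] ((\<lambda>(i, t). 201 * (snd R - t) + 1) (r, 0)) ?P M"
  proof (rule wpc_while[where R = "Wellfounded.measure fst" and I = I])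
    have "\<exists>x' r' y. r' \<le> r \<and> stores B M x' y \<and> (\<forall>a\<ge>dim x'. y a = 0) \<and>
      M 17 = real (dim x') \<and> M 18 = real r' \<and> valid n x' \<and> 0 \<le> M 2 \<and> M 2 < 1 \<and> dim x' \<le> 1 + 0 \<and> dim x' + r' \<le> r + 1 \<and>
      fst (run (process_sampler Q n s (iteration_cost k) r r' x' 0) (M 2)) = R \<and> same_registers iteration_cells M M"
      by (rule exI[of _ x], rule exI[of _ r], rule exI[of _ y0]) (use assms in \<open>auto simp: same_registers_def\<close>)
    then show "I (r, 0) M" unfolding I_def by simp
  next
    fix a M' assume "I a M'" and c: "cmp_val Lt (M' 15) (M' 18)"
    then obtain i t x' r' y where a: "a = (i, t)" and ri: "r' \<le> i" and st': "stores B M' x' y" and y: "\<And>a. dim x' \<le> a \<Longrightarrow> y a = 0"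
      and m': "M' 17 = real (dim x')" "M' 18 = real r'" and v': "valid n x'" and u': "0 \<le> M' 2" "M' 2 < 1"
      and d': "dim x' \<le> 1 + t" "dim x' + r' \<le> r + 1"
      and R: "fst (run (process_sampler Q n s (iteration_cost k) i r' x' t) (M' 2)) = R" and sr: "same_registers iteration_cells M' M"
      by (cases a) (auto simp: I_def)
    note sg = same_registersD[OF sr]
    have b: "constants M'" "M' 19 = real s" "M' 22 = real (n\<^sup>2)"
      using con m19 m22 sg[of 13] sg[of 14] sg[of 15] sg[of 19] sg[of 22]
      by (auto simp: constants_def iteration_cells_def multinomial_cells_def)
    have r': "0 < r'" using c m' b by (simp add: constants_def)
    obtain i' where i: "i = Suc i'" using ri r' by (cases i) auto
    obtain l x2 u2 where it: "run (iteration_sampler Q n s (min s r') x') (M' 2) = ((l, x2), u2)" by (metis prod.exhaust)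
    have h: "min s r' \<le> s" "0 < min s r'" using s r' by auto
    note dm = iteration_dim[OF n v' h u' it]
    let ?t = "t + iteration_cost k (dim x')"
    have R': "fst (run (process_sampler Q n s (iteration_cost k) i' (r' - l) x2 ?t) u2) = R"
      using R r' it by (simp add: i run_bind)
    have tR: "?t \<le> snd R" unfolding R'[symmetric] by (rule process_sampler_mono)
    \<comment> \<open>A cost of at least 4 covers the growth of the dimension by at most 2, and the
      loop test, for which 201 instead of 200 per unit is charged.\<close>
    have c4: "4 \<le> iteration_cost k (dim x')"
    proof -
      have "2 * 2 * 1 \<le> (dim x' + 2) * (dim x' + 2) * (k + 1)" by (intro mult_le_mono) auto
      then show ?thesis by (simp only: iteration_cost_def power2_eq_square)
    qed
    have "wpc iteration_code (200 * iteration_cost k (dim x')) (I (i', ?t)) M'"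
      unfolding iteration_cost_def
    proof (rule wpc_mono[OF wp_iteration[OF b(1) st' y m' r' b(2) s b(3) n v' u' k]])
      fix M2 assume M2: "stores B M2 (snd (fst (run (iteration_sampler Q n s (min s r') x') (M' 2)))) (low s x') \<and>
        M2 17 = real (dim (snd (fst (run (iteration_sampler Q n s (min s r') x') (M' 2))))) \<and>
        M2 18 = real (r' - fst (fst (run (iteration_sampler Q n s (min s r') x') (M' 2)))) \<and>
        M2 2 = snd (run (iteration_sampler Q n s (min s r') x') (M' 2)) \<and> same_registers iteration_cells M2 M'"
      have low0: "\<forall>a\<ge>dim x2. low s x' a = 0"
        using valid_ge_dim[OF n v'] dm(4) by (auto simp: low_def)
      have "same_registers iteration_cells M2 M" using M2 sr by (auto simp: same_registers_def)
      then have "\<exists>x' r' y. r' \<le> i' \<and> stores B M2 x' y \<and> (\<forall>a\<ge>dim x'. y a = 0) \<and>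
        M2 17 = real (dim x') \<and> M2 18 = real r' \<and> valid n x' \<and> 0 \<le> M2 2 \<and> M2 2 < 1 \<and> dim x' \<le> 1 + ?t \<and> dim x' + r' \<le> r + 1 \<and>
        fst (run (process_sampler Q n s (iteration_cost k) i' r' x' ?t) (M2 2)) = R \<and> same_registers iteration_cells M2 M"
        using M2 it dm low0 R' d' c4 ri i r'
        by - (rule exI[of _ x2], rule exI[of _ "r' - l"], rule exI[of _ "low s x'"], auto)
      then show "I (i', t + (dim x' + 2)\<^sup>2 * (k + 1)) M2" by (simp add: I_def iteration_cost_def)
    qed auto
    moreover have "200 * iteration_cost k (dim x') + 1 + (201 * (snd R - ?t) + 1) \<le> 201 * (snd R - t) + 1"
      using tR c4 by linarith
    ultimately show "\<exists>b c. (b, a) \<in> Wellfounded.measure fst \<and> c + 1 + (case b of (i, t) \<Rightarrow> 201 * (snd R - t) + 1)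
        \<le> (case a of (i, t) \<Rightarrow> 201 * (snd R - t) + 1) \<and> wpc iteration_code c (I b) M'"
      by (intro exI[of _ "(i', ?t)"] exI[of _ "200 * iteration_cost k (dim x')"]) (simp add: a i)
  next
    fix a M' assume "I a M'" and c: "\<not> cmp_val Lt (M' 15) (M' 18)"
    then obtain i t x' r' y where a: "a = (i, t)" and st': "stores B M' x' y"
      and m': "M' 17 = real (dim x')" "M' 18 = real r'"
      and d': "dim x' \<le> 1 + t" "dim x' + r' \<le> r + 1"
      and R: "fst (run (process_sampler Q n s (iteration_cost k) i r' x' t) (M' 2)) = R" and sr: "same_registers iteration_cells M' M"
      by (cases a) (auto simp: I_def)
    have "M' 15 = 0" using con same_registersD[OF sr, of 15] by (auto simp: constants_def iteration_cells_def multinomial_cells_def)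
    then have "r' = 0" using c m' by simp
    then have "R = (x', t)" using R by (cases i) auto
    then show "1 \<le> (case a of (i, t) \<Rightarrow> 201 * (snd R - t) + 1) \<and> ?P M'" using a st' m' d' by auto
  qed auto
  then show ?thesis by simp
qed

text \<open>Targets are cells up to \<open>D\<close> or below 8 and sources start at
  \<open>B\<close>, so copying never destroys an entry that is still to be read.\<close>

lemma wp_output:
  assumes st: "stores B M x y" and m17: "M 17 = real D" and D: "D < B"
  shows "wpc output_code (5 * D + 26) (\<lambda>M'. M' 0 = real D \<and> (\<forall>a<D. M' (Suc a) = real_of_int (x a))) M"
proof -
  have B: "40 \<le> B" and M: "M 16 = real B" "\<And>a. M (2 * a + B) = real_of_int (x a)"
    using st by (auto simp: stores_def)
  define I where "I = (\<lambda>d M'. 8 \<le> d \<and> M' 0 = real D \<and> M' 1 = real (2 * (d - 1) + B) \<and> M' 2 = real d \<and> M' 3 = real D \<and>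
    M' 4 = 1 \<and> M' 5 = 2 \<and> M' 7 = real B \<and> (\<forall>a. M' (2 * a + B) = real_of_int (x a)) \<and>
    (\<forall>j. 8 \<le> j \<longrightarrow> j < d \<longrightarrow> M' j = real_of_int (x (j - 1))))"
  define P where "P = (\<lambda>M'. M' 0 = real D \<and> M' 7 = real B \<and> (\<forall>a. M' (2 * a + B) = real_of_int (x a)) \<and>
    (\<forall>a. 7 \<le> a \<longrightarrow> a < D \<longrightarrow> M' (Suc a) = real_of_int (x a)))"
  let ?M = "fold (upd Q) output_init M"
  have M': "?M i = M i" if "8 \<le> i" for i using that by (simp add: output_init_def)
  have "wpc [Loop Le 2 3 (map Basic output_body)] ((D + 1 - 8) * 5 + 1) P ?M"
  proof (rule wpc_while[where R = "Wellfounded.measure (\<lambda>d. D + 1 - d)" and I = I and T = "\<lambda>d. (D + 1 - d) * 5 + 1"])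
    show "I 8 ?M" unfolding I_def using B M M' m17
      by (auto simp: M' simp del: upd.simps) (auto simp: output_init_def)
  next
    fix d M' assume I: "I d M'" and c: "cmp_val Le (M' 2) (M' 3)"
    then have dD: "d \<le> D" by (simp add: I_def)
    have d8: "8 \<le> d" using I by (simp add: I_def)
    define M2 where "M2 = fold (upd Q) output_body M'"
    have x1: "M' (2 * (d - 1) + B) = real_of_int (x (d - 1))" using I by (simp add: I_def)
    have M2: "M2 = M'(6 := real_of_int (x (d - 1)), d := real_of_int (x (d - 1)), 1 := real (2 * (d - 1) + B) + 2, 2 := real d + 1)"
    proof -
      have m: "M' 1 = real (2 * (d - 1) + B)" "M' 2 = real d" "M' 4 = 1" "M' 5 = 2" using I by (auto simp: I_def)
      have e1: "upd Q (Load 6 1) M' = M'(6 := real_of_int (x (d - 1)))"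
        using x1 by (simp only: upd.simps m(1) to_nat_cell_of_nat)
      have e2: "upd Q (Store 2 6) (M'(6 := real_of_int (x (d - 1)))) = M'(6 := real_of_int (x (d - 1)), d := real_of_int (x (d - 1)))"
        using m by simp
      show ?thesis unfolding M2_def output_body_def using d8 m
        by (simp only: fold_simps e1 e2 id_apply) (auto simp: fun_eq_iff m)
    qed
    have "I (Suc d) M2" unfolding I_def
    proof (intro conjI allI impI)
      fix a
      have "2 * a + B \<noteq> d" "2 * a + B \<noteq> 1" "2 * a + B \<noteq> 2" "2 * a + B \<noteq> 6" using dD D B by auto
      then show "M2 (2 * a + B) = real_of_int (x a)" using I by (simp add: M2 I_def)
    next
      fix j :: nat assume j: "8 \<le> j" "j < Suc d"
      show "M2 j = real_of_int (x (j - 1))"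
        using j I by (cases "j = d") (auto simp: M2 I_def)
    next
      show "M2 1 = real (2 * (Suc d - 1) + B)" using d8 by (simp add: M2 of_nat_diff)
    qed (use I d8 in \<open>auto simp: M2 I_def\<close>)
    then have "wpc (map Basic output_body) 4 (I (Suc d)) M'"
      by (intro wpc_line_only) (auto simp: output_body_def M2_def)
    moreover have "(D + 1 - d) * 5 = 5 + (D + 1 - Suc d) * 5" using dD by simp
    ultimately show "\<exists>b c. (b, d) \<in> Wellfounded.measure (\<lambda>d. D + 1 - d) \<and> c + 1 + ((D + 1 - b) * 5 + 1) \<le> (D + 1 - d) * 5 + 1 \<and>
      wpc (map Basic output_body) c (I b) M'"
      using dD by (intro exI[of _ "Suc d"] exI[of _ 4]) auto
  next
    fix d M' assume I: "I d M'" and c: "\<not> cmp_val Le (M' 2) (M' 3)"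
    then have dD: "D < d" by (simp add: I_def)
    have "M' (Suc a) = real_of_int (x a)" if "7 \<le> a" "a < D" for a
    proof -
      have "8 \<le> Suc a" "Suc a < d" using that dD by auto
      then have "M' (Suc a) = real_of_int (x (Suc a - 1))" using I unfolding I_def by blast
      then show ?thesis by simp
    qed
    then show "1 \<le> (D + 1 - d) * 5 + 1 \<and> P M'" using I by (auto simp: P_def I_def)
  qed auto
  then have loop: "wpc [Loop Le 2 3 (map Basic output_body)] (5 * D + 1) P ?M"
    by (rule wpc_mono) auto
  have fin: "wpc (map Basic output_final) 16 (\<lambda>M'. M' 0 = real D \<and> (\<forall>a<D. M' (Suc a) = real_of_int (x a))) M1" if P: "P M1" for M1
  proof (rule wpc_line_only)
    have m: "M1 7 = real B" "M1 0 = real D" using P by (auto simp: P_def)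
    have X: "M1 (2 * a + B) = real_of_int (x a)" for a using P by (simp add: P_def)
    have x: "M1 B = real_of_int (x 0)" "M1 (B + 2) = real_of_int (x 1)" "M1 (B + 4) = real_of_int (x 2)"
      "M1 (B + 6) = real_of_int (x 3)" "M1 (B + 8) = real_of_int (x 4)" "M1 (B + 10) = real_of_int (x 5)" "M1 (B + 12) = real_of_int (x 6)"
      using X[of 0] X[of 1] X[of 2] X[of 3] X[of 4] X[of 5] X[of 6] by (simp_all add: add.commute)
    define M2 where "M2 = fold (upd Q) (take 9 output_final) M1"
    have m2: "M2 1 = real B" "M2 2 = real (B + 2)" "M2 3 = real (B + 4)" "M2 4 = real (B + 6)" "M2 5 = real (B + 8)"
      "M2 6 = real (B + 10)" "M2 7 = real (B + 12)" "M2 0 = real D"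
      by (simp_all add: M2_def output_final_def m)
    have m2f: "M2 i = M1 i" if "8 \<le> i" for i using that by (simp add: M2_def output_final_def)
    define M3 where "M3 = fold (upd Q) output_final M1"
    have M3: "M3 = fold (upd Q) [Load 1 1, Load 2 2, Load 3 3, Load 4 4, Load 5 5, Load 6 6, Load 7 7] M2"
      by (simp add: M3_def M2_def output_final_def)
    have ad: "B + c \<noteq> i" if "i < 8" for c i using B that by auto
    have l: "M3 0 = real D" "M3 1 = M2 B" "M3 2 = M2 (B + 2)" "M3 3 = M2 (B + 4)" "M3 4 = M2 (B + 6)" "M3 5 = M2 (B + 8)"
      "M3 6 = M2 (B + 10)" "M3 7 = M2 (B + 12)"
    proof -
      have t: "to_nat_cell (M2 1) = B" "to_nat_cell (M2 2) = B + 2" "to_nat_cell (M2 3) = B + 4" "to_nat_cell (M2 4) = B + 6"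
        "to_nat_cell (M2 5) = B + 8" "to_nat_cell (M2 6) = B + 10" "to_nat_cell (M2 7) = B + 12"
        by (simp_all only: m2 to_nat_cell_of_nat)
      show "M3 0 = real D" "M3 1 = M2 B" "M3 2 = M2 (B + 2)" "M3 3 = M2 (B + 4)" "M3 4 = M2 (B + 6)" "M3 5 = M2 (B + 8)"
        "M3 6 = M2 (B + 10)" "M3 7 = M2 (B + 12)"
        using B t m2(8) unfolding M3 by simp_all
    qed
    have g: "M3 i = M1 i" if "8 \<le> i" for i using that m2f by (simp add: M3)
    show "M3 0 = real D \<and> (\<forall>a<D. M3 (Suc a) = real_of_int (x a))"
    proof (intro conjI allI impI, rule l(1))
      fix a assume a: "a < D"
      consider "a = 0" | "a = 1" | "a = 2" | "a = 3" | "a = 4" | "a = 5" | "a = 6" | "7 \<le> a" by linarith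
      then show "M3 (Suc a) = real_of_int (x a)"
        by cases (use l m2f B x g[of "Suc a"] P a in \<open>auto simp: P_def eval_nat_numeral\<close>)
    qed
  qed (auto simp: output_final_def)
  have "wpc ([Loop Le 2 3 (map Basic output_body)] @ map Basic output_final) (5 * D + 17)
      (\<lambda>M'. M' 0 = real D \<and> (\<forall>a<D. M' (Suc a) = real_of_int (x a))) ?M"
    by (intro wpc_append[where c = "5 * D + 1" and c' = 16] wpc_mono[OF loop] fin) auto
  then show ?thesis unfolding output_code_def
    by (intro wpc_line[where c = "5 * D + 17"]) (auto simp: output_init_def)
qed

end

subsection \<open>Numerical bounds\<close>

lemma cube_le_power: "(g + 2) ^ 3 \<le> 27 * 2 ^ (g::nat)"
proof (induction g)
  case (Suc g)
  consider "g = 0" | "g = 1" | "2 \<le> g" by linarith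
  then show ?case
  proof cases
    case 3
    have "(Suc g + 2) ^ 3 \<le> 2 * (g + 2) ^ 3"
    proof -
      obtain d where d: "g = d + 2" using 3 by (metis add.commute le_Suc_ex)
      show ?thesis unfolding d by (simp add: power3_eq_cube algebra_simps)
    qed
    also have "\<dots> \<le> 2 * (27 * 2 ^ g)" using Suc by simp
    finally show ?thesis by simp
  qed (simp_all add: power3_eq_cube)
qed (simp add: power3_eq_cube)

text \<open>For \<open>D <= 6 * k\<close> the constant term suffices. Otherwise
  \<open>2 ^ (D - 1) = 8 ^ k * 2 ^ g\<close> with \<open>D + 3 <= 2 * (g + 2)\<close>, and
  \<open>2 ^ g\<close> beats the cube, with \<open>216 = 8 * 27\<close>. The factor
  \<open>1 / 8 ^ k\<close> makes an expected potential of \<open>n ^ 3\<close> harmless.\<close>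

lemma cube_bound:
  fixes D k :: nat
  assumes "1 \<le> D" "1 \<le> k"
  shows "real ((D + 3) ^ 3) \<le> real ((9 * k) ^ 3) + 216 / 8 ^ k * 2 ^ (D - 1)"
proof (cases "D - 1 < 6 * k")
  case True
  then have "D + 3 \<le> 9 * k" using assms by linarith
  then have "(D + 3) ^ 3 \<le> (9 * k) ^ 3" by (rule power_mono) simp
  then have "real ((D + 3) ^ 3) \<le> real ((9 * k) ^ 3)" by (simp only: of_nat_le_iff)
  moreover have "0 \<le> 216 / 8 ^ k * (2::real) ^ (D - 1)" by simp
  ultimately show ?thesis by linarith
next
  case False
  define g where "g = D - 1 - 3 * k"
  have g: "D - 1 = 3 * k + g" "D + 3 \<le> 2 * (g + 2)" using False assms by (auto simp: g_def)
  have "(D + 3) ^ 3 \<le> (2 * (g + 2)) ^ 3" using g(2) by (rule power_mono) simp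
  also have "\<dots> = 8 * (g + 2) ^ 3" by (simp only: power_mult_distrib) simp
  also have "\<dots> \<le> 8 * (27 * 2 ^ g)" using cube_le_power by (intro mult_left_mono) auto
  finally have "real ((D + 3) ^ 3) \<le> real (8 * (27 * 2 ^ g))" by (simp only: of_nat_le_iff)
  also have "\<dots> = 216 / 8 ^ k * 2 ^ (D - 1)" unfolding g(1) power_add power_mult by simp
  finally have "real ((D + 3) ^ 3) \<le> 216 / 8 ^ k * 2 ^ (D - 1)" .
  moreover have "0 \<le> real ((9 * k) ^ 3)" by simp
  ultimately show ?thesis by linarith
qed

lemma iteration_cost_potential:
  assumes "0 < n" "0 < s" "1 \<le> k"
  shows "cost_potential n s (iteration_cost k) (2 * (k + 1) * (9 * k) ^ 3) (2 * (real k + 1) * (216 / 8 ^ k))"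
proof
  show "mono (iteration_cost k)"
    unfolding iteration_cost_def by (intro monoI mult_le_mono1 power_mono) auto
next
  fix x assume v: "valid n x"
  let ?D = "dim x"
  have "2 * real ?D * real (iteration_cost k (?D + 1)) = 2 * (real k + 1) * (real ?D * (real ?D + 3)\<^sup>2)"
    by (simp add: iteration_cost_def algebra_simps)
  also have "\<dots> \<le> 2 * (real k + 1) * ((real ?D + 3) * (real ?D + 3)\<^sup>2)"
    by (intro mult_left_mono mult_right_mono) auto
  also have "\<dots> = 2 * (real k + 1) * real ((?D + 3) ^ 3)" by (simp add: power2_eq_square power3_eq_cube)
  also have "\<dots> \<le> 2 * (real k + 1) * (real ((9 * k) ^ 3) + 216 / 8 ^ k * 2 ^ (?D - 1))"
    using potential_ge(2)[OF assms(1) v] assms(3) by (intro mult_left_mono cube_bound) auto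
  also have "\<dots> \<le> 2 * (real k + 1) * (real ((9 * k) ^ 3) + 216 / 8 ^ k * potential x)"
    using potential_ge(1)[OF assms(1) v] by (intro mult_left_mono add_left_mono) auto
  finally show "2 * real ?D * real (iteration_cost k (?D + 1)) \<le>
      real (2 * (k + 1) * (9 * k) ^ 3) + 2 * (real k + 1) * (216 / 8 ^ k) * potential x"
    by (simp only: of_nat_mult of_nat_add of_nat_1 of_nat_numeral distrib_left mult.assoc)
qed (use assms in auto)

text \<open>The range of \<open>m\<close> is empty for small \<open>n\<close>; hence lower powers of
  the logarithm are always absorbed by higher ones.\<close>

lemma ln_ge_1:
  assumes "n \<le> m" "real m \<le> real n * ln (real n)" "0 < n"
  shows "1 \<le> ln (real n)"
proof -
  have "real n * 1 \<le> real m" using assms(1) by simp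
  then have "real n * 1 \<le> real n * ln (real n)" using assms(2) by (rule order_trans)
  then show ?thesis using assms(3) by (simp only: mult_le_cancel_left_pos of_nat_0_less_iff)
qed

text \<open>\<open>k\<close> belongs to the analysis: the program never computes it, as its
  bisections stop by themselves.\<close>

lemma expected_cost_log:
  assumes "n \<le> m" "real m \<le> real n * ln (real n)" "0 < n"
  obtains k where "nat \<lfloor>sqrt (real n)\<rfloor> < 2 ^ k" "0 < nat \<lfloor>sqrt (real n)\<rfloor>"
    "\<And>Q. (\<integral>\<^sup>+(x', t'). of_nat t' \<partial>law (process_sampler Q n (nat \<lfloor>sqrt (real n)\<rfloor>) (iteration_cost k) m m (counts_of n (\<lambda>_. 0)) 0))
      \<le> ennreal (2000000 * (sqrt (real n) * ln (real n) ^ 5))"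
proof -
  define l where "l = ln (real n)"
  define s where "s = nat \<lfloor>sqrt (real n)\<rfloor>"
  have l1: "1 \<le> l" unfolding l_def by (rule ln_ge_1[OF assms])
  have n2: "2 \<le> n"
  proof (rule ccontr)
    assume "\<not> 2 \<le> n"
    then have "n = 1" using assms(3) by simp
    then show False using l1 by (simp add: l_def)
  qed
  have sq1: "1 \<le> sqrt (real n)" using n2 by simp
  then have f1: "1 \<le> \<lfloor>sqrt (real n)\<rfloor>" by (simp add: le_floor_iff)
  then have s0: "0 < s" by (simp add: s_def)
  have rs: "real s = of_int \<lfloor>sqrt (real n)\<rfloor>" using f1 by (simp add: s_def)
  have s_le: "real s \<le> sqrt (real n)" unfolding rs by simp
  have "sqrt (real n) < real s + 1" unfolding rs by linarith
  then have s_ge: "sqrt (real n) \<le> 2 * real s" using s0 by linarith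
  \<comment> \<open>\<open>k = j + 1\<close> is the number of binary digits of \<open>n\<close>. It
    bounds the rounds of a bisection, through \<open>s < 2 ^ k\<close>, and calibrates the
    coefficient of the potential, through \<open>n ^ 3 <= 8 ^ k\<close>.\<close>
  obtain j where j: "2 ^ j \<le> n" "n < 2 ^ (j + 1)" using ex_power_ivl1[of 2 n] assms(3) by auto
  define k where "k = j + 1"
  have k1: "1 \<le> k" "real n \<le> 2 ^ k"
  proof -
    have "real n \<le> real (2 ^ k)" using j(2) by (simp only: k_def of_nat_le_iff less_imp_le)
    then show "real n \<le> 2 ^ k" by simp
  qed (simp add: k_def)
  have "real j * ln 2 = ln (2 ^ j :: real)" by (simp add: ln_realpow)
  also have "\<dots> \<le> l" 
  proof -
    have "real (2 ^ j) \<le> real n" using j(1) by (simp only: of_nat_le_iff)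
    then show ?thesis unfolding l_def using assms(3) by (subst ln_le_cancel_iff) auto
  qed
  finally have "real j * ln 2 \<le> l" .
  moreover have "real j * (2 / 3) \<le> real j * ln 2" using ln2_ge_two_thirds by (intro mult_left_mono) auto
  \<comment> \<open>\<open>k + 1 = j + 2\<close> with \<open>j <= 3 / 2 * l\<close> and
    \<open>2 <= 2 * l\<close>.\<close>
  ultimately have kl: "real k + 1 \<le> 7 / 2 * l" using l1 by (simp add: k_def)
  have "sqrt (real n) * 1 \<le> sqrt (real n) * sqrt (real n)" using sq1 by (intro mult_left_mono) auto
  then have "real s \<le> real n" using s_le by simp
  then have sk: "s < 2 ^ k" using j(2) by (simp add: k_def)
  interpret cost_potential n s "iteration_cost k" "2 * (k + 1) * (9 * k) ^ 3" "2 * (real k + 1) * (216 / 8 ^ k)"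
    by (rule iteration_cost_potential[OF assms(3) s0 k1(1)])
  have "real n ^ 3 \<le> (2 ^ k) ^ 3" using k1(2) by (intro power_mono) auto
  also have "(2 ^ k) ^ 3 = (8::real) ^ k" by (simp add: power_mult[symmetric] mult.commute[of k] power_mult)
  finally have n3: "real n ^ 3 / 8 ^ k \<le> 1" by simp
  have "2 * (real k + 1) * (216 / 8 ^ k) * real n ^ 3 = 432 * (real k + 1) * (real n ^ 3 / 8 ^ k)" by simp
  also have "\<dots> \<le> 432 * (real k + 1) * 1" using n3 by (intro mult_left_mono) auto
  finally have ab: "real (2 * (k + 1) * (9 * k) ^ 3) + 2 * (real k + 1) * (216 / 8 ^ k) * real n ^ 3
      \<le> 2 * (real k + 1) * (9 * real k) ^ 3 + 432 * (real k + 1)"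
    by (simp only: of_nat_mult of_nat_add of_nat_1 of_nat_numeral of_nat_power mult_1_right add_le_cancel_left)
  also have "\<dots> = (real k + 1) * (1458 * real k ^ 3 + 432)" by (simp add: power_mult_distrib algebra_simps)
  also have "\<dots> \<le> (real k + 1) * (1890 * (real k + 1) ^ 3)"
  proof (intro mult_left_mono)
    have "real k ^ 3 \<le> (real k + 1) ^ 3" "1 \<le> (real k + 1) ^ 3" by (auto intro: power_mono one_le_power)
    then show "1458 * real k ^ 3 + 432 \<le> 1890 * (real k + 1) ^ 3" by linarith
  qed simp
  also have "\<dots> = 1890 * (real k + 1) ^ 4" by (simp add: eval_nat_numeral)
  also have "\<dots> \<le> 1890 * (7 / 2 * l) ^ 4" using kl by (intro mult_left_mono power_mono) auto
  also have "\<dots> = 1890 * 2401 / 16 * l ^ 4" by (simp add: power_mult_distrib power_divide)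
  also have "\<dots> \<le> 300000 * l ^ 4" using l1 by (intro mult_right_mono) auto
  finally have AB: "real (2 * (k + 1) * (9 * k) ^ 3) + 2 * (real k + 1) * (216 / 8 ^ k) * real n ^ 3 \<le> 300000 * l ^ 4" .
  have q: "sqrt (real n) * sqrt (real n) = real n" by simp
  have "2 / (2 * real s) \<le> 2 / sqrt (real n)" using s_ge s0 assms(3) by (intro divide_left_mono) auto
  then have "1 / real s \<le> 2 / sqrt (real n)" by simp
  moreover have "real s / real n \<le> sqrt (real n) / real n" using s_le by (intro divide_right_mono) auto
  moreover have "sqrt (real n) / real n = 1 / sqrt (real n)" using sq1 q by (simp add: field_simps)
  ultimately have ps: "per_step \<le> 3 / sqrt (real n)" unfolding per_step_def by simp
  have "real m * per_step \<le> (real n * l) * (3 / sqrt (real n))"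
    using assms(2) ps per_step_nonneg by (intro mult_mono) (auto simp: l_def)
  also have "\<dots> = (sqrt (real n) * sqrt (real n) * l) * (3 / sqrt (real n))" by (simp only: q)
  also have "\<dots> = 3 * (sqrt (real n) * l)" using sq1 by (simp add: field_simps)
  finally have "1 + real m * per_step \<le> 1 + 3 * (sqrt (real n) * l)" by simp
  moreover have "1 * 1 \<le> sqrt (real n) * l" using sq1 l1 by (intro mult_mono) auto
  ultimately have mp: "1 + real m * per_step \<le> 4 * (sqrt (real n) * l)" by simp
  have "(1 + real m * per_step) * (real (2 * (k + 1) * (9 * k) ^ 3) + 2 * (real k + 1) * (216 / 8 ^ k) * real n ^ 3)
      \<le> (4 * (sqrt (real n) * l)) * (300000 * l ^ 4)"
    using l1 per_step_nonneg by (intro mult_mono[OF mp AB]) auto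
  also have "\<dots> \<le> 2000000 * (sqrt (real n) * l ^ 5)"
    using l1 by (simp add: eval_nat_numeral mult_ac)
  finally have bound: "(1 + real m * per_step) * (real (2 * (k + 1) * (9 * k) ^ 3) + 2 * (real k + 1) * (216 / 8 ^ k) * real n ^ 3)
      \<le> 2000000 * (sqrt (real n) * l ^ 5)" .
  have "(\<integral>\<^sup>+(x', t'). of_nat t' \<partial>law (process_sampler Q n s (iteration_cost k) m m (counts_of n (\<lambda>_. 0)) 0))
      \<le> ennreal (2000000 * (sqrt (real n) * l ^ 5))" for Q
    by (rule order_trans[OF expected_cost[OF assms(2) n2]]) (rule ennreal_leI[OF bound])
  then show ?thesis using that[of k] sk s0 by (simp add: s_def l_def)
qed

context bounded_queries begin

lemma wp_main:
  fixes u :: real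
  assumes "n \<le> m" "0 < n" "s = nat \<lfloor>sqrt (real n)\<rfloor>" "0 < s" "s < 2 ^ k"
  defines "R \<equiv> fst (run (process_sampler Q n s (iteration_cost k) m m (counts_of n (\<lambda>_. 0)) 0) (frac u))"
  shows "wpc main_code (206 * snd R + 60) (\<lambda>M'. to_nat_cell (M' 0) = dim (fst R) \<and>
    (\<forall>a<dim (fst R). to_nat_cell (M' (Suc a)) = nat (fst R a))) ((\<lambda>_. 0)(0 := real n, 1 := real m, 2 := u))"
    (is "wpc _ _ ?P ?M0")
proof -
  let ?x = "counts_of n (\<lambda>_. 0)"
  have x: "?x a = (if a = 0 then int n else 0)" for a by (simp add: counts_of_def)
  have dim: "dim ?x = 1" using dim_counts_of[OF assms(2), of "\<lambda>_. 0"] assms(2) by (simp add: image_constant_conv lessThan_empty_iff)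
  define M where "M = fold (upd Q) main_init ?M0"
  define B where "B = m + 40"
  have rs: "real_of_int \<lfloor>sqrt (real n)\<rfloor> = real s" using assms(3,4) by simp
  have pw: "real n powr (1 / 2) = sqrt (real n)" by (simp add: powr_half_sqrt)
  have tb: "to_nat_cell (40 + real m) = B" by (simp add: to_nat_cell_def B_def nat_add_distrib)
  have m: "M 2 = frac u" "M 13 = 1" "M 14 = 2" "M 15 = 0" "M 16 = real B" "M 17 = 1" "M 18 = real m" "M 19 = real s"
    "M 22 = real (n\<^sup>2)" "M B = real n"
    using tb by (auto simp: M_def main_init_def frac_def pw rs power2_eq_square B_def)
  have m0: "M i = 0" if "40 \<le> i" "i \<noteq> B" for i
    using that tb by (auto simp: M_def main_init_def B_def)
  have st: "stores B M ?x (\<lambda>_. 0)" unfolding stores_def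
  proof (intro conjI allI)
    fix a
    show "M (2 * a + B) = real_of_int (?x a)"
    proof (cases "a = 0")
      case False
      then have "M (2 * a + B) = 0" by (intro m0) (auto simp: B_def)
      then show ?thesis using False by (simp add: x)
    qed (simp add: x m)
    have "M (Suc (2 * a + B)) = 0" by (intro m0) (auto simp: B_def)
    then show "M (Suc (2 * a + B)) = real_of_int 0" by simp
  qed (auto simp: m B_def)
  have v: "valid n ?x" by (auto simp: valid_def)
  have con: "constants M" by (simp add: constants_def m)
  have fr: "0 \<le> M 2" "M 2 < 1" by (simp_all add: m frac_lt_1)
  have proc: "wpc [Loop Lt 15 18 iteration_code] (201 * snd R + 1) (\<lambda>M'. (\<exists>y. stores B M' (fst R) y) \<and>
    M' 17 = real (dim (fst R)) \<and> dim (fst R) \<le> 1 + snd R \<and> dim (fst R) \<le> m + 1) M"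
    unfolding R_def m(1)[symmetric]
    by (rule wp_process[OF con st _ _ m(7,8) assms(4) m(9) assms(2) v fr assms(5)]) (auto simp: dim m)
  \<comment> \<open>\<open>206 = 201 + 5\<close>: writing the output takes 5 units per entry, and
    its length is at most \<open>1 + snd R\<close>.\<close>
  have "wpc ([Loop Lt 15 18 iteration_code] @ output_code) (206 * snd R + 46) ?P M"
  proof (rule wpc_append[OF wpc_mono[OF proc], where c' = "5 * snd R + 40"])
    fix M' assume "(\<exists>y. stores B M' (fst R) y) \<and> M' 17 = real (dim (fst R)) \<and> dim (fst R) \<le> 1 + snd R \<and> dim (fst R) \<le> m + 1"
    then obtain y where y: "stores B M' (fst R) y" "M' 17 = real (dim (fst R))" "dim (fst R) \<le> 1 + snd R" "dim (fst R) < B"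
      by (auto simp: B_def)
    have "to_nat_cell (real_of_int z) = nat z" for z by (simp add: to_nat_cell_def)
    then show "wpc output_code (5 * snd R + 40) ?P M'"
      by (intro wpc_mono[OF wp_output[OF y(1,2,4)]]) (use y(3) in auto)
  qed auto
  then show ?thesis unfolding main_code_def
    by (intro wpc_line[where c = "206 * snd R + 46"]) (auto simp: M_def main_init_def)
qed

end

theorem theorem3:
  fixes Q :: "nat \<Rightarrow> nat \<Rightarrow> nat" and cost :: "nat \<Rightarrow> nat \<Rightarrow> nat"
  assumes decision: "\<And>a b. Q a b \<in> {0, 1}"
    and constant_time: "\<exists>c. \<forall>a b. cost a b \<le> c"
  shows "\<exists>(prog :: stmt list) (C :: real) (\<epsilon> :: nat \<Rightarrow> real).
    \<epsilon> \<longlonglongrightarrow> 0 \<and>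
    (\<forall>n m :: nat. 1 \<le> n \<and> n \<le> m \<and> real m \<le> real n * ln (real n) \<longrightarrow>
      (let X = algorithm_output Q cost prog n m;
           T = running_time Q cost prog n m;
           bound = C * sqrt (real n) * ln (real n) ^ 6
       in X \<in> measurable uniform_tape (count_space UNIV) \<and>
          T \<in> borel_measurable uniform_tape \<and>
          distr uniform_tape (count_space UNIV) X =
            measure_pmf (map_pmf Some (bin_cardinalities_law Q n m)) \<and>
          (\<integral>\<^sup>+\<omega>. T \<omega> \<partial>uniform_tape) \<le> ennreal bound \<and>
          measure uniform_tape {\<omega> \<in> space uniform_tape. T \<omega> \<le> ennreal bound} \<ge> 1 - \<epsilon> n))"
proof -
  obtain q where q: "\<And>a b. cost a b \<le> q" using constant_time by blast
  interpret bounded_queries Q cost q by standard (rule q)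
  interpret prob_space uniform_tape by (rule prob_space_uniform_tape)
  define prog where "prog = Basic (Uniform 2) # main_code"
  define K where "K = real (1 + q)"
  \<comment> \<open>206 and 60 come from \<open>wp_main\<close>, one more unit from reading the
    variate, and 2000000 from \<open>expected_cost_log\<close>; the additive term is absorbed
    because \<open>sqrt n * (ln n) ^ 5 >= 1\<close>.\<close>
  define C where "C = 206 * K * 2000000 + 61 * K"
  have K: "1 \<le> K" by (simp add: K_def)
  have eps: "(\<lambda>n. 1 / ln (real n)) \<longlonglongrightarrow> 0"
    by (rule tendsto_divide_0[OF tendsto_const])
      (intro filterlim_at_top_imp_at_infinity filterlim_compose[OF ln_at_top filterlim_real_sequentially])
  have main: "let X = algorithm_output Q cost prog n m;
           T = running_time Q cost prog n m;
           bound = C * sqrt (real n) * ln (real n) ^ 6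
       in X \<in> measurable uniform_tape (count_space UNIV) \<and>
          T \<in> borel_measurable uniform_tape \<and>
          distr uniform_tape (count_space UNIV) X =
            measure_pmf (map_pmf Some (bin_cardinalities_law Q n m)) \<and>
          (\<integral>\<^sup>+\<omega>. T \<omega> \<partial>uniform_tape) \<le> ennreal bound \<and>
          measure uniform_tape {\<omega> \<in> space uniform_tape. T \<omega> \<le> ennreal bound} \<ge> 1 - 1 / ln (real n)"
    if n: "1 \<le> n" "n \<le> m" "real m \<le> real n * ln (real n)" for n m
  proof -
    define s where "s = nat \<lfloor>sqrt (real n)\<rfloor>"
    have n0: "0 < n" using n by simp
    obtain k where k: "s < 2 ^ k" "0 < s" and cost: "\<And>Q. (\<integral>\<^sup>+(x', t'). of_nat t' \<partial>law (process_sampler Q n s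
        (iteration_cost k) m m (counts_of n (\<lambda>_. 0)) 0)) \<le> ennreal (2000000 * (sqrt (real n) * ln (real n) ^ 5))"
      using expected_cost_log[OF n(2,3) n0, folded s_def] by blast
    define tree where "tree = process_sampler Q n s (iteration_cost k) m m (counts_of n (\<lambda>_. 0)) 0"
    define V where "V = (\<lambda>\<omega> :: nat \<Rightarrow> real. fst (run tree (frac (\<omega> 0))))"
    define out where "out = (\<lambda>x :: counts. map (\<lambda>a. nat (x a)) [0..<dim x])"
    define X where "X = algorithm_output Q cost prog n m"
    define T where "T = running_time Q cost prog n m"
    have valid: "valid n (counts_of n (\<lambda>_. 0))" by (auto simp: valid_def)
    note lp = law_process_sampler[OF n0 valid order_refl k(2), where Q = Q and f = "iteration_cost k" and t = 0 and i = m,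
        folded tree_def]
    have dV: "distr uniform_tape (count_space UNIV) V = measure_pmf (law tree)"
      and mV: "V \<in> measurable uniform_tape (count_space UNIV)"
      unfolding V_def using distr_run[of tree] lp by auto
    \<comment> \<open>For every tape, the output is a function of the value \<open>V\<close> of the
      choice tree, and the accumulated cost in \<open>V\<close> bounds the time. Law and expected
      time are thereby reduced to the law of the tree.\<close>
    have XT: "X \<omega> = Some (out (fst (V \<omega>))) \<and> T \<omega> \<le> of_nat ((206 * snd (V \<omega>) + 60) * (1 + q) + 1)" for \<omega>
    proof -
      obtain M p t where f: "final_state Q cost prog n m \<omega> = Some (M, p, t)"
        and M: "to_nat_cell (M 0) = dim (fst (V \<omega>))" "\<forall>a<dim (fst (V \<omega>)). to_nat_cell (M (Suc a)) = nat (fst (V \<omega>) a)"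
        and t: "t \<le> (206 * snd (V \<omega>) + 60) * (1 + q) + 1"
        using final_state_wp[where d = 2 and \<omega> = \<omega>, OF wp_main[OF n(2) n0 s_def k(2,1), of "\<omega> 0", folded tree_def]]
        unfolding prog_def V_def by blast
      have "X \<omega> = Some (out (fst (V \<omega>)))"
        using M by (auto simp: X_def algorithm_output_def f out_def)
      moreover have "T \<omega> = of_nat t" by (simp add: T_def running_time_def f)
      ultimately show ?thesis using t by (simp only: of_nat_le_iff)
    qed
    have X: "X = (\<lambda>\<omega>. (Some \<circ> out \<circ> fst) (V \<omega>))" using XT by auto
    have mX: "X \<in> measurable uniform_tape (count_space UNIV)"
      unfolding X by (rule measurable_compose[OF mV]) simp
    have mT: "T \<in> borel_measurable uniform_tape" unfolding T_def by (rule running_time_measurable)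
    have "distr uniform_tape (count_space UNIV) X = distr (distr uniform_tape (count_space UNIV) V) (count_space UNIV) (Some \<circ> out \<circ> fst)"
      unfolding X by (subst distr_distr[OF _ mV]) (auto simp: comp_def)
    also have "\<dots> = measure_pmf (map_pmf (Some \<circ> out \<circ> fst) (law tree))"
      unfolding dV by (rule map_pmf_rep_eq[symmetric])
    also have "map_pmf (Some \<circ> out \<circ> fst) (law tree) = map_pmf Some (map_pmf out (map_pmf fst (law tree)))"
      by (simp add: pmf.map_comp comp_assoc)
    also have "\<dots> = map_pmf Some (bin_cardinalities_law Q n m)"
      using lp by (simp add: bin_cardinalities_law_steps[OF n0] out_def)
    finally have dX: "distr uniform_tape (count_space UNIV) X = measure_pmf (map_pmf Some (bin_cardinalities_law Q n m))" .
    define l where "l = ln (real n)"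
    have l1: "1 \<le> l" unfolding l_def by (rule ln_ge_1[OF n(2,3) n0])
    have b1: "1 \<le> sqrt (real n) * l ^ 5"
      using mult_mono[of 1 "sqrt (real n)" 1 "l ^ 5"] n l1 one_le_power[OF l1, of 5] by simp
    have "(\<integral>\<^sup>+\<omega>. of_nat (snd (V \<omega>)) \<partial>uniform_tape) = (\<integral>\<^sup>+v. of_nat (snd v) \<partial>distr uniform_tape (count_space UNIV) V)"
      by (subst nn_integral_distr[OF mV]) auto
    also have "\<dots> \<le> ennreal (2000000 * (sqrt (real n) * l ^ 5))"
      unfolding dV using cost[of Q] by (simp add: tree_def l_def case_prod_unfold)
    finally have EV: "(\<integral>\<^sup>+\<omega>. of_nat (snd (V \<omega>)) \<partial>uniform_tape) \<le> ennreal (2000000 * (sqrt (real n) * l ^ 5))" .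
    have "(\<integral>\<^sup>+\<omega>. T \<omega> \<partial>uniform_tape) \<le> (\<integral>\<^sup>+\<omega>. ennreal (206 * K) * of_nat (snd (V \<omega>)) + ennreal (61 * K) \<partial>uniform_tape)"
    proof (rule nn_integral_mono)
      fix \<omega>
      have "T \<omega> \<le> of_nat ((206 * snd (V \<omega>) + 60) * (1 + q) + 1)" using XT by blast
      also have "\<dots> = ennreal (real ((206 * snd (V \<omega>) + 60) * (1 + q) + 1))" by (rule ennreal_of_nat_eq_real_of_nat)
      also have "\<dots> \<le> ennreal (206 * K * real (snd (V \<omega>)) + 61 * K)"
        by (rule ennreal_leI) (use K in \<open>simp add: K_def algebra_simps\<close>)
      also have "\<dots> = ennreal (206 * K * real (snd (V \<omega>))) + ennreal (61 * K)"
        by (rule ennreal_plus) (use K in auto)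
      also have "ennreal (206 * K * real (snd (V \<omega>))) = ennreal (206 * K) * ennreal (real (snd (V \<omega>)))"
        by (rule ennreal_mult) (use K in auto)
      finally show "T \<omega> \<le> ennreal (206 * K) * of_nat (snd (V \<omega>)) + ennreal (61 * K)"
        by (simp only: ennreal_of_nat_eq_real_of_nat)
    qed
    also have "\<dots> = ennreal (206 * K) * (\<integral>\<^sup>+\<omega>. of_nat (snd (V \<omega>)) \<partial>uniform_tape) + ennreal (61 * K)"
    proof -
      have [measurable]: "(\<lambda>\<omega>. of_nat (snd (V \<omega>)) :: ennreal) \<in> borel_measurable uniform_tape"
        by (rule measurable_compose[OF mV]) simp
      have "(\<integral>\<^sup>+\<omega>. ennreal (206 * K) * of_nat (snd (V \<omega>)) + ennreal (61 * K) \<partial>uniform_tape)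
        = (\<integral>\<^sup>+\<omega>. ennreal (206 * K) * of_nat (snd (V \<omega>)) \<partial>uniform_tape) + (\<integral>\<^sup>+\<omega>. ennreal (61 * K) \<partial>uniform_tape)"
        by (rule nn_integral_add) measurable
      also have "(\<integral>\<^sup>+\<omega>. ennreal (206 * K) * of_nat (snd (V \<omega>)) \<partial>uniform_tape)
        = ennreal (206 * K) * (\<integral>\<^sup>+\<omega>. of_nat (snd (V \<omega>)) \<partial>uniform_tape)"
        by (rule nn_integral_cmult) measurable
      finally show ?thesis by (simp only: nn_integral_const emeasure_space_1 mult_1_right)
    qed
    also have "\<dots> \<le> ennreal (206 * K) * ennreal (2000000 * (sqrt (real n) * l ^ 5)) + ennreal (61 * K)"
      by (intro add_right_mono mult_left_mono EV) auto
    also have "\<dots> = ennreal (206 * K * (2000000 * (sqrt (real n) * l ^ 5)) + 61 * K)"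
      using K l1 by (subst ennreal_plus) (auto simp flip: ennreal_mult)
    also have "\<dots> \<le> ennreal (C * (sqrt (real n) * l ^ 5))"
    proof (rule ennreal_leI)
      have "61 * K * 1 \<le> 61 * K * (sqrt (real n) * l ^ 5)" using b1 K by (intro mult_left_mono) auto
      then show "206 * K * (2000000 * (sqrt (real n) * l ^ 5)) + 61 * K \<le> C * (sqrt (real n) * l ^ 5)"
        by (simp add: C_def algebra_simps)
    qed
    finally have ET: "(\<integral>\<^sup>+\<omega>. T \<omega> \<partial>uniform_tape) \<le> ennreal (C * (sqrt (real n) * l ^ 5))" .
    define b where "b = C * sqrt (real n) * l ^ 6"
    have C0: "0 < C" using K by (simp add: C_def)
    have b: "b = l * (C * (sqrt (real n) * l ^ 5))" by (simp add: b_def eval_nat_numeral)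
    have c0: "0 < C * (sqrt (real n) * l ^ 5)" using C0 b1 by simp
    have b0: "0 < b" unfolding b using c0 l1 by simp
    have "C * (sqrt (real n) * l ^ 5) \<le> b" unfolding b using mult_right_mono[OF l1, of "C * (sqrt (real n) * l ^ 5)"] c0 by simp
    then have ET6: "(\<integral>\<^sup>+\<omega>. T \<omega> \<partial>uniform_tape) \<le> ennreal b" using ET by (meson ennreal_leI order_trans)
    \<comment> \<open>Markov's inequality: the mean is bounded with \<open>l ^ 5\<close> and the
      threshold contains \<open>l ^ 6\<close>, which leaves \<open>1 / l\<close>.\<close>
    have "prob {\<omega> \<in> space uniform_tape. \<not> T \<omega> \<le> ennreal b} \<le> 1 / l"
    proof -
      have "emeasure uniform_tape {\<omega> \<in> space uniform_tape. \<not> T \<omega> \<le> ennreal b} \<le>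
          emeasure uniform_tape ({\<omega> \<in> space uniform_tape. 1 \<le> ennreal (1 / b) * T \<omega>})"
      proof (rule emeasure_mono)
        show "{\<omega> \<in> space uniform_tape. \<not> T \<omega> \<le> ennreal b} \<subseteq> {\<omega> \<in> space uniform_tape. 1 \<le> ennreal (1 / b) * T \<omega>}"
        proof safe
          fix \<omega> assume "\<not> T \<omega> \<le> ennreal b"
          then have "ennreal (1 / b) * ennreal b \<le> ennreal (1 / b) * T \<omega>" by (intro mult_left_mono) auto
          then show "1 \<le> ennreal (1 / b) * T \<omega>" using b0 by (simp flip: ennreal_mult)
        qed
      qed (use mT in measurable)
      also have "\<dots> \<le> ennreal (1 / b) * (\<integral>\<^sup>+\<omega>. T \<omega> \<partial>uniform_tape)"
      proof -
        have "(\<lambda>\<omega>. T \<omega> * indicator (space uniform_tape) \<omega>) = T" by (simp add: space_uniform_tape)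
        then show ?thesis
          using nn_integral_Markov_inequality[where u = T and A = "space uniform_tape" and M = uniform_tape and c = "ennreal (1 / b)"] mT
          by (simp only: sets.top)
      qed
      also have "\<dots> \<le> ennreal (1 / b) * ennreal (C * (sqrt (real n) * l ^ 5))" by (intro mult_left_mono ET) auto
      also have "\<dots> = ennreal (1 / l)"
        using c0 l1 b0 C0 n0 unfolding b by (simp flip: ennreal_mult)
      finally show ?thesis using l1 by (simp add: emeasure_eq_measure)
    qed
    moreover have "prob {\<omega> \<in> space uniform_tape. T \<omega> \<le> ennreal b} = 1 - prob {\<omega> \<in> space uniform_tape. \<not> T \<omega> \<le> ennreal b}"
    proof -
      have "{\<omega> \<in> space uniform_tape. T \<omega> \<le> ennreal b} = space uniform_tape - {\<omega> \<in> space uniform_tape. \<not> T \<omega> \<le> ennreal b}" by auto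
      then show ?thesis using prob_compl[of "{\<omega> \<in> space uniform_tape. \<not> T \<omega> \<le> ennreal b}"] mT by simp
    qed
    ultimately have "1 - 1 / l \<le> prob {\<omega> \<in> space uniform_tape. T \<omega> \<le> ennreal b}" by simp
    then show ?thesis using mX mT dX ET6 unfolding Let_def X_def T_def b_def l_def by blast
  qed
  show ?thesis
    by (rule exI[of _ prog], rule exI[of _ C], rule exI[of _ "\<lambda>n. 1 / ln (real n)"]) (use eps main in blast)
qed

end
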